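(* Let $\mathbb K$ be a field and $d\ge0$ an integer. Let $\rho$ be the bijection from the set of isomorphism classes of TH systems over $\mathbb K$ of diameter $d$ to the set of normalized west-south Vandermonde systems in $\mathrm{Mat}_{d+1}(\mathbb K)$ which sends the isomorphism class of a TH system $\Phi$ with eigenvalue sequence $\{\theta_i\}_{i=0}^d$, dual eigenvalue sequence $\{\theta_i^*\}_{i=0}^d$ and west-south normalized transition matrix $\mathcal P$ to $(\mathcal P,\{\theta_i\}_{i=0}^d,\{\theta_i^*\}_{i=0}^d)$. Then $\rho$ induces a bijection from the set of affine isomorphism classes of TH systems over $\mathbb K$ of diameter $d$ to the set of affine classes of normalized west-south Vandermonde systems in $\mathrm{Mat}_{d+1}(\mathbb K)$.
   Context: Rows and columns of matrices in $\mathrm{Mat}_{d+1}(\mathbb K)$ are indexed by $0,\dots,d$. The symbol $*$ is only notation. Let $V$ be a $\mathbb K$-vector space of dimension $d+1$. An element of $\mathrm{End}(V)$ is multiplicity-free if it is diagonalizable and all its eigenspaces have dimension one; the primitive idempotent attached to an eigenspace acts as the identity on it and as $0$ on the other eigenspaces. A TH system on $V$ (of diameter $d$, over $\mathbb K$) is a sequence $\Phi=(A;\{E_i\}_{i=0}^d;A^*;\{E^*_i\}_{i=0}^d)$ such that $A,A^*\in\mathrm{End}(V)$ are multiplicity-free; $\{E_i\}$ (resp. $\{E_i^*\}$) is an ordering of the primitive idempotents of $A$ (resp. $A^*$); and for $0\le i,j\le d$, each of $E_iA^*E_j$ and $E^*_iAE^*_j$ is $0$ if $i-j>1$ and nonzero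 if $i-j=1$. The eigenvalue sequence $\{\theta_i\}$ (resp. dual eigenvalue sequence $\{\theta_i^*\}$): $\theta_i$ (resp. $\theta_i^*$) is the eigenvalue of $A$ (resp. $A^*$) corresponding to $E_i$ (resp. $E_i^*$). TH systems $(A;\{E_i\};A^*;\{E_i^*\})$ on $V$ and $(B;\{F_i\};B^*;\{F_i^*\})$ on $W$ are isomorphic if there is a $\mathbb K$-algebra isomorphism $\gamma:\mathrm{End}(V)\to\mathrm{End}(W)$ with $B=A^\gamma$, $B^*=A^{*\gamma}$, $F_i=E_i^\gamma$, $F_i^*=E_i^{*\gamma}$ for all $i$. An affine transformation of $\Phi$ is a TH system $(\alpha A+\beta I;\{E_i\};\alpha^*A^*+\beta^*I;\{E_i^*\})$ with $\alpha,\beta,\alpha^*,\beta^*\in\mathbb K$ and $\alpha,\alpha^*$ nonzero. $\Phi$ and $\Phi'$ are affine isomorphic if $\Phi$ is isomorphic to an affine transformation of $\Phi'$; this is an equivalence relation. Split sequence: for $0\le i\le d$ put $U_i=(E^*_0V+\cdots+E^*_iV)\cap(E_0V+\cdots+E_{d-i}V)$. It is known that the $U_i$ are one-dimensional, $V=\bigoplus_i U_i$, and (with $U_{-1}=U_{d+1}=0$) $(A-\theta_{d-i}I)U_i=U_{i+1}$, $(A^*-\theta^*_iI)U_i=U_{i-1}$. For $1\le i\le d$, $\phi_i$ is the (nonzero) eigenvalue of $(A-\theta_{d-i+1}I)(A^*-\theta_i^*I)$ on $U_i$. West-south normalized transition matrix $\mathcal P\in\mathrm{Mat}_{d+1}(\mathbb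 K)$ of $\Phi$: $$\mathcal P_{ij}=\sum_{h=0}^d\frac{(\theta_i-\theta_d)(\theta_i-\theta_{d-1})\cdots(\theta_i-\theta_{d-h+1})\,(\theta_j^*-\theta_0^* )(\theta_j^*-\theta_1^* )\cdots(\theta_j^*-\theta_{h-1}^* )}{\phi_1\phi_2\cdots\phi_h}.$$ A sequence of polynomials $\{f_i\}_{i=0}^d$ in $\mathbb K[\lambda]$ is graded if $f_0=1$ and $\deg f_i=i$. A normalized west-south Vandermonde system in $\mathrm{Mat}_{d+1}(\mathbb K)$ is a sequence $(X,\{\theta_i\}_{i=0}^d,\{\theta^*_i\}_{i=0}^d)$ where $X\in\mathrm{Mat}_{d+1}(\mathbb K)$, $\{\theta_i\}$ are mutually distinct scalars in $\mathbb K$, $\{\theta_i^*\}$ are mutually distinct scalars in $\mathbb K$, there is a graded sequence $\{f_i\}_{i=0}^d$ with $X_{ij}=f_j(\theta_i)$ for all $i,j$, and there is a graded sequence $\{f_i^*\}_{i=0}^d$ with $X_{ij}=f^*_{d-i}(\theta^*_j)$ for all $i,j$. An affine transformation of such a system is a system $(X,\{\alpha\theta_i+\beta\},\{\alpha^*\theta_i^*+\beta^*\})$ with $\alpha,\beta,\alpha^*,\beta^*\in\mathbb K$ and $\alpha,\alpha^*$ nonzero. Two such systems are affine related if one is an affine transformation of the other; this is an equivalence relation whose classes are called affine classes. *)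

theory Defs
  imports "Jordan_Normal_Form.VS_Connect" "HOL-Algebra.QuotRing"
begin

text \<open>
  The ground field is a type \<open>'k :: field\<close>. Vector spaces over it are \<open>HOL-Algebra\<close> modules over
  \<^term>\<open>class_ring\<close>; their carriers are subsets of a type \<open>'v\<close>, so that TH systems living on
  different vector spaces can be compared. A finite sequence indexed by \<open>0, \<dots>, d\<close> is a list
  of length \<open>d + 1\<close>; matrices are indexed from 0.
\<close>

definition space_of_dim :: "nat \<Rightarrow> ('k::field, 'v) module \<Rightarrow> bool" where
  "space_of_dim n V \<longleftrightarrow>
     vectorspace class_ring V \<and> vectorspace.fin_dim class_ring V \<and> vectorspace.dim class_ring V = n"

text \<open>Endomorphisms are made extensional, so that equality in the carrier of \<open>End_alg V\<close> is
  equality of maps on \<open>V\<close>.\<close>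

definition End_alg :: "('k::field, 'v) module \<Rightarrow> ('k, 'v \<Rightarrow> 'v) module" where
  "End_alg V =
     \<lparr> carrier = LinearCombinations.module_hom class_ring V V \<inter> extensional (carrier V),
       mult = (\<lambda>X Y. compose (carrier V) X Y),
       one = (\<lambda>v\<in>carrier V. v),
       zero = (\<lambda>v\<in>carrier V. \<zero>\<^bsub>V\<^esub>),
       add = (\<lambda>X Y. \<lambda>v\<in>carrier V. X v \<oplus>\<^bsub>V\<^esub> Y v),
       smult = (\<lambda>c X. \<lambda>v\<in>carrier V. c \<odot>\<^bsub>V\<^esub> X v) \<rparr>"

definition alg_iso ::
  "('k::field, 'v) module \<Rightarrow> ('k, 'v) module \<Rightarrow> (('v \<Rightarrow> 'v) \<Rightarrow> ('v \<Rightarrow> 'v)) set" where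
  "alg_iso V W = {\<gamma> \<in> ring_iso (End_alg V) (End_alg W).
     \<forall>c. \<forall>X\<in>carrier (End_alg V). \<gamma> (c \<odot>\<^bsub>End_alg V\<^esub> X) = c \<odot>\<^bsub>End_alg W\<^esub> \<gamma> X}"


subsection \<open>Multiplicity-free endomorphisms and primitive idempotents\<close>

definition eigenspace_on :: "('k::field, 'v) module \<Rightarrow> ('v \<Rightarrow> 'v) \<Rightarrow> 'k \<Rightarrow> 'v set" where
  "eigenspace_on V X \<theta> = {v \<in> carrier V. X v = \<theta> \<odot>\<^bsub>V\<^esub> v}"

definition eigenvalues_on :: "('k::field, 'v) module \<Rightarrow> ('v \<Rightarrow> 'v) \<Rightarrow> 'k set" where
  "eigenvalues_on V X = {\<theta>. \<exists>v\<in>eigenspace_on V X \<theta>. v \<noteq> \<zero>\<^bsub>V\<^esub>}"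

definition diagonalizable_on :: "('k::field, 'v) module \<Rightarrow> ('v \<Rightarrow> 'v) \<Rightarrow> bool" where
  "diagonalizable_on V X \<longleftrightarrow>
     (\<exists>B. vectorspace.basis class_ring V B \<and> (\<forall>v\<in>B. \<exists>\<theta>. X v = \<theta> \<odot>\<^bsub>V\<^esub> v))"

definition multiplicity_free :: "('k::field, 'v) module \<Rightarrow> ('v \<Rightarrow> 'v) \<Rightarrow> bool" where
  "multiplicity_free V X \<longleftrightarrow>
     X \<in> carrier (End_alg V) \<and> diagonalizable_on V X \<and>
     (\<forall>\<theta>\<in>eigenvalues_on V X.
        vectorspace.dim class_ring (V\<lparr>carrier := eigenspace_on V X \<theta>\<rparr>) = 1)"

definition prim_idem :: "('k::field, 'v) module \<Rightarrow> ('v \<Rightarrow> 'v) \<Rightarrow> 'k \<Rightarrow> ('v \<Rightarrow> 'v) \<Rightarrow> bool" where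
  "prim_idem V X \<theta> E \<longleftrightarrow>
     \<theta> \<in> eigenvalues_on V X \<and> E \<in> carrier (End_alg V) \<and>
     (\<forall>v\<in>eigenspace_on V X \<theta>. E v = v) \<and>
     (\<forall>\<mu>\<in>eigenvalues_on V X - {\<theta>}. \<forall>v\<in>eigenspace_on V X \<mu>. E v = \<zero>\<^bsub>V\<^esub>)"

definition prim_idem_ordering ::
  "nat \<Rightarrow> ('k::field, 'v) module \<Rightarrow> ('v \<Rightarrow> 'v) \<Rightarrow> ('v \<Rightarrow> 'v) list \<Rightarrow> bool" where
  "prim_idem_ordering d V X Es \<longleftrightarrow>
     length Es = d + 1 \<and> distinct Es \<and> set Es = {E. \<exists>\<theta>. prim_idem V X \<theta> E}"

definition eigenvalue_of_idem :: "('k::field, 'v) module \<Rightarrow> ('v \<Rightarrow> 'v) \<Rightarrow> ('v \<Rightarrow> 'v) \<Rightarrow> 'k" where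
  "eigenvalue_of_idem V X E = (THE \<theta>. prim_idem V X \<theta> E)"


subsection \<open>TH systems\<close>

record ('k, 'v) th_system =
  th_space :: "('k, 'v) module"
  th_A :: "'v \<Rightarrow> 'v"
  th_E :: "('v \<Rightarrow> 'v) list"
  th_A_star :: "'v \<Rightarrow> 'v"
  th_E_star :: "('v \<Rightarrow> 'v) list"

definition th_systems :: "nat \<Rightarrow> ('k::field, 'v) th_system set" where
  "th_systems d = {\<Phi>.
     let V = th_space \<Phi>; A = th_A \<Phi>; E = th_E \<Phi>; As = th_A_star \<Phi>; Es = th_E_star \<Phi> in
     space_of_dim (d + 1) V \<and>
     multiplicity_free V A \<and> multiplicity_free V As \<and>
     prim_idem_ordering d V A E \<and> prim_idem_ordering d V As Es \<and>
     (\<forall>i\<le>d. \<forall>j\<le>d.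
        (i > j + 1 \<longrightarrow> E ! i \<otimes>\<^bsub>End_alg V\<^esub> As \<otimes>\<^bsub>End_alg V\<^esub> E ! j = \<zero>\<^bsub>End_alg V\<^esub> \<and>
                      Es ! i \<otimes>\<^bsub>End_alg V\<^esub> A \<otimes>\<^bsub>End_alg V\<^esub> Es ! j = \<zero>\<^bsub>End_alg V\<^esub>) \<and>
        (i = j + 1 \<longrightarrow> E ! i \<otimes>\<^bsub>End_alg V\<^esub> As \<otimes>\<^bsub>End_alg V\<^esub> E ! j \<noteq> \<zero>\<^bsub>End_alg V\<^esub> \<and>
                      Es ! i \<otimes>\<^bsub>End_alg V\<^esub> A \<otimes>\<^bsub>End_alg V\<^esub> Es ! j \<noteq> \<zero>\<^bsub>End_alg V\<^esub>))}"

definition eigenvalue_seq :: "('k::field, 'v) th_system \<Rightarrow> 'k list" where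
  "eigenvalue_seq \<Phi> = map (eigenvalue_of_idem (th_space \<Phi>) (th_A \<Phi>)) (th_E \<Phi>)"

definition dual_eigenvalue_seq :: "('k::field, 'v) th_system \<Rightarrow> 'k list" where
  "dual_eigenvalue_seq \<Phi> = map (eigenvalue_of_idem (th_space \<Phi>) (th_A_star \<Phi>)) (th_E_star \<Phi>)"

definition th_iso :: "nat \<Rightarrow> (('k::field, 'v) th_system \<times> ('k, 'v) th_system) set" where
  "th_iso d = {(\<Phi>, \<Psi>). \<Phi> \<in> th_systems d \<and> \<Psi> \<in> th_systems d \<and>
     (\<exists>\<gamma>\<in>alg_iso (th_space \<Phi>) (th_space \<Psi>).
        th_A \<Psi> = \<gamma> (th_A \<Phi>) \<and> th_A_star \<Psi> = \<gamma> (th_A_star \<Phi>) \<and>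
        th_E \<Psi> = map \<gamma> (th_E \<Phi>) \<and> th_E_star \<Psi> = map \<gamma> (th_E_star \<Phi>))}"

definition affine_op :: "('k::field, 'v) module \<Rightarrow> 'k \<Rightarrow> 'k \<Rightarrow> ('v \<Rightarrow> 'v) \<Rightarrow> ('v \<Rightarrow> 'v)" where
  "affine_op V \<alpha> \<beta> X =
     \<alpha> \<odot>\<^bsub>End_alg V\<^esub> X \<oplus>\<^bsub>End_alg V\<^esub> \<beta> \<odot>\<^bsub>End_alg V\<^esub> \<one>\<^bsub>End_alg V\<^esub>"

definition th_affine ::
  "'k::field \<Rightarrow> 'k \<Rightarrow> 'k \<Rightarrow> 'k \<Rightarrow> ('k, 'v) th_system \<Rightarrow> ('k, 'v) th_system" where
  "th_affine \<alpha> \<beta> \<alpha>s \<beta>s \<Phi> =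
     \<Phi>\<lparr>th_A := affine_op (th_space \<Phi>) \<alpha> \<beta> (th_A \<Phi>),
       th_A_star := affine_op (th_space \<Phi>) \<alpha>s \<beta>s (th_A_star \<Phi>)\<rparr>"

definition th_affine_iso :: "nat \<Rightarrow> (('k::field, 'v) th_system \<times> ('k, 'v) th_system) set" where
  "th_affine_iso d = {(\<Phi>, \<Psi>). \<Phi> \<in> th_systems d \<and> \<Psi> \<in> th_systems d \<and>
     (\<exists>\<alpha> \<beta> \<alpha>s \<beta>s. \<alpha> \<noteq> 0 \<and> \<alpha>s \<noteq> 0 \<and> (\<Phi>, th_affine \<alpha> \<beta> \<alpha>s \<beta>s \<Psi>) \<in> th_iso d)}"


subsection \<open>Split sequence and west-south normalized transition matrix\<close>

text \<open>The sum \<open>S 0 + \<dots> + S n\<close> of subspaces.\<close>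

definition sum_space :: "('k::field, 'v) module \<Rightarrow> (nat \<Rightarrow> 'v set) \<Rightarrow> nat \<Rightarrow> 'v set" where
  "sum_space V S n = {finsum V w {..n} | w. \<forall>h\<le>n. w h \<in> S h}"

definition split_space :: "nat \<Rightarrow> ('k::field, 'v) th_system \<Rightarrow> nat \<Rightarrow> 'v set" where
  "split_space d \<Phi> i = (let V = th_space \<Phi> in
     sum_space V (\<lambda>h. (th_E_star \<Phi> ! h) ` carrier V) i \<inter>
     sum_space V (\<lambda>h. (th_E \<Phi> ! h) ` carrier V) (d - i))"

text \<open>Meaningful for \<open>1 \<le> i \<le> d\<close>; the space \<open>split_space d \<Phi> i\<close> is one-dimensional, so the
  eigenvalue is unique.\<close>

definition split_seq :: "nat \<Rightarrow> ('k::field, 'v) th_system \<Rightarrow> nat \<Rightarrow> 'k" where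
  "split_seq d \<Phi> i = (let V = th_space \<Phi>; \<theta> = eigenvalue_seq \<Phi>; \<theta>s = dual_eigenvalue_seq \<Phi> in
     THE c. \<forall>u\<in>split_space d \<Phi> i.
       ((th_A \<Phi> \<ominus>\<^bsub>End_alg V\<^esub> \<theta> ! (d - i + 1) \<odot>\<^bsub>End_alg V\<^esub> \<one>\<^bsub>End_alg V\<^esub>) \<otimes>\<^bsub>End_alg V\<^esub>
        (th_A_star \<Phi> \<ominus>\<^bsub>End_alg V\<^esub> \<theta>s ! i \<odot>\<^bsub>End_alg V\<^esub> \<one>\<^bsub>End_alg V\<^esub>)) u = c \<odot>\<^bsub>V\<^esub> u)"

definition transition_mat :: "nat \<Rightarrow> ('k::field, 'v) th_system \<Rightarrow> 'k mat" where
  "transition_mat d \<Phi> = (let \<theta> = eigenvalue_seq \<Phi>; \<theta>s = dual_eigenvalue_seq \<Phi> in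
     mat (d + 1) (d + 1) (\<lambda>(i, j). \<Sum>h=0..d.
       ((\<Prod>l<h. \<theta> ! i - \<theta> ! (d - l)) * (\<Prod>l<h. \<theta>s ! j - \<theta>s ! l)) /
       (\<Prod>l=1..h. split_seq d \<Phi> l)))"


subsection \<open>Normalized west-south Vandermonde systems\<close>

type_synonym 'k vsystem = "'k mat \<times> 'k list \<times> 'k list"

definition graded_polys :: "nat \<Rightarrow> (nat \<Rightarrow> 'k::field poly) \<Rightarrow> bool" where
  "graded_polys d f \<longleftrightarrow> f 0 = 1 \<and> (\<forall>i\<le>d. Polynomial.degree (f i) = i)"

definition ws_vandermonde :: "nat \<Rightarrow> 'k::field vsystem set" where
  "ws_vandermonde d = {(X, \<theta>, \<theta>s).
     X \<in> carrier_mat (d + 1) (d + 1) \<and>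
     length \<theta> = d + 1 \<and> distinct \<theta> \<and> length \<theta>s = d + 1 \<and> distinct \<theta>s \<and>
     (\<exists>f. graded_polys d f \<and> (\<forall>i\<le>d. \<forall>j\<le>d. X $$ (i, j) = poly (f j) (\<theta> ! i))) \<and>
     (\<exists>fs. graded_polys d fs \<and> (\<forall>i\<le>d. \<forall>j\<le>d. X $$ (i, j) = poly (fs (d - i)) (\<theta>s ! j)))}"

definition vsystem_affine_of :: "'k::field vsystem \<Rightarrow> 'k vsystem \<Rightarrow> bool" where
  "vsystem_affine_of T S \<longleftrightarrow> (case S of (X, \<theta>, \<theta>s) \<Rightarrow>
     \<exists>\<alpha> \<beta> \<alpha>s \<beta>s. \<alpha> \<noteq> 0 \<and> \<alpha>s \<noteq> 0 \<and>
       T = (X, map (\<lambda>t. \<alpha> * t + \<beta>) \<theta>, map (\<lambda>t. \<alpha>s * t + \<beta>s) \<theta>s))"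

definition vsystem_affine_rel :: "nat \<Rightarrow> ('k::field vsystem \<times> 'k vsystem) set" where
  "vsystem_affine_rel d = {(S, T). S \<in> ws_vandermonde d \<and> T \<in> ws_vandermonde d \<and>
     (vsystem_affine_of S T \<or> vsystem_affine_of T S)}"


subsection \<open>The map \<open>\<rho>\<close> on isomorphism classes\<close>

definition vsystem_of :: "nat \<Rightarrow> ('k::field, 'v) th_system \<Rightarrow> 'k vsystem" where
  "vsystem_of d \<Phi> = (transition_mat d \<Phi>, eigenvalue_seq \<Phi>, dual_eigenvalue_seq \<Phi>)"

definition rho :: "nat \<Rightarrow> ('k::field, 'v) th_system set \<Rightarrow> 'k vsystem" where
  "rho d C = (THE S. \<forall>\<Phi>\<in>C. vsystem_of d \<Phi> = S)"

end

theory Submission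
  imports Defs
begin

text \<open>
  Every TH system has an eigenbasis \<open>v\<^sub>0, \<dots>, v\<^sub>d\<close> of \<open>A\<close> and an eigenbasis \<open>w\<^sub>0, \<dots>, w\<^sub>d\<close> of \<open>A\<^sup>*\<close>, ordered by the
  idempotents and unique up to scaling the individual vectors. The defining conditions say that \<open>A\<^sup>*\<close> is
  upper Hessenberg with nonzero subdiagonal in the basis \<open>v\<close>, and \<open>A\<close> in the basis \<open>w\<close>. The idea of
  the proof is to describe the triple attached to a TH system by these bases alone:
  the west-south normalized transition matrix is the transition matrix from \<open>v\<close> to \<open>w\<close>, when both
  are scaled so that its first column and its last row consist of ones. This scaling is unique up to a common
  scalar, so it determines the matrix (\<open>normalized_frames_unique\<close>).

  That the scaling exists and yields the matrix given by the split sequence is shown in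
  \<open>th_system_transition\<close>. As \<open>A\<close> is Hessenberg in \<open>w\<close>, each factor \<open>A - \<theta>\<close> raises the last nonzero
  \<open>w\<close>-coordinate of a vector by one, as long as there is room. Hence no \<open>v\<close>-coordinate of \<open>w\<^sub>0\<close> vanishes, and
  \<open>w\<^sub>0 = v\<^sub>0 + \<dots> + v\<^sub>d\<close> after scaling \<open>v\<close>. The vector
  \<open>u\<^sub>i = (A - \<theta>\<^sub>d\<^sub>-\<^sub>i\<^sub>+\<^sub>1) \<cdots> (A - \<theta>\<^sub>d) w\<^sub>0\<close> spans the split space \<open>U\<^sub>i\<close>, and \<open>(A\<^sup>* - \<theta>\<^sup>*\<^sub>i) u\<^sub>i = \<phi>\<^sub>i u\<^sub>i\<^sub>-\<^sub>1\<close> with \<open>\<phi>\<^sub>i \<noteq> 0\<close>.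
  From this, an eigenvector of \<open>A\<^sup>*\<close> for \<open>\<theta>\<^sup>*\<^sub>j\<close> can be written down in terms of the \<open>u\<^sub>h\<close>,
  and its \<open>v\<close>-coordinates form the \<open>j\<close>-th column of the defining formula.

  Three consequences give the theorem. First, two TH systems are isomorphic if and only if their triples are
  equal (\<open>th_iso_iff\<close>): equal triples allow one to match both pairs of bases by a linear map and to conjugate
  by it, and conversely every isomorphism of endomorphism algebras is such a conjugation
  (\<open>alg_iso_inner\<close>). Secondly, the triples that occur are exactly the normalized west-south
  Vandermonde systems: one direction is the Newton shape of the formula
  (\<open>vsystem_of_ws_vandermonde\<close>), and for the other one takes \<open>A\<close> and \<open>A\<^sup>*\<close> diagonal in bases related by
  the given matrix, where the Hessenberg shape expresses that multiplication by the variable raises the degree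
  in a graded sequence by one (\<open>th_system_of_vandermonde\<close>). Thirdly, an affine transformation keeps both
  eigenbases and changes only the eigenvalues (\<open>th_affine_vsystem_of\<close>). So affine isomorphism is the pull-back
  of the affine relation along a surjection, and such a surjection induces a bijection of the quotients
  (\<open>quotient_bij_of_surj\<close>).
\<close>

section \<open>Finite-dimensional vector spaces in coordinates\<close>

locale kspace =
  fixes V :: "('k::field, 'v) module" and d :: nat
  assumes space: "space_of_dim (d + 1) V"
begin

sublocale vectorspace class_ring V
  using space by (simp add: space_of_dim_def)

lemma fin_dim_space: fin_dim and dim_space: "dim = d + 1"
  using space by (simp_all add: space_of_dim_def)

lemma smult_in [simp]: "x \<in> carrier V \<Longrightarrow> a \<odot>\<^bsub>V\<^esub> x \<in> carrier V"
  by (rule smult_closed) simp_all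

lemma smult_add_left: "x \<in> carrier V \<Longrightarrow> (a + b) \<odot>\<^bsub>V\<^esub> x = a \<odot>\<^bsub>V\<^esub> x \<oplus>\<^bsub>V\<^esub> b \<odot>\<^bsub>V\<^esub> x"
  using smult_l_distr[of a b x] by simp

lemma smult_add_right:
  "x \<in> carrier V \<Longrightarrow> y \<in> carrier V \<Longrightarrow> a \<odot>\<^bsub>V\<^esub> (x \<oplus>\<^bsub>V\<^esub> y) = a \<odot>\<^bsub>V\<^esub> x \<oplus>\<^bsub>V\<^esub> a \<odot>\<^bsub>V\<^esub> y"
  using smult_r_distr[of a x y] by simp

lemma smult_smult: "x \<in> carrier V \<Longrightarrow> a \<odot>\<^bsub>V\<^esub> (b \<odot>\<^bsub>V\<^esub> x) = (a * b) \<odot>\<^bsub>V\<^esub> x"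
  using smult_assoc1[of a b x] by simp

lemma one_smult [simp]: "x \<in> carrier V \<Longrightarrow> 1 \<odot>\<^bsub>V\<^esub> x = x"
  using smult_one[of x] by simp

lemma zero_smult [simp]: "x \<in> carrier V \<Longrightarrow> 0 \<odot>\<^bsub>V\<^esub> x = \<zero>\<^bsub>V\<^esub>"
  using smult_l_null[of x] by simp

lemma smult_zero [simp]: "a \<odot>\<^bsub>V\<^esub> \<zero>\<^bsub>V\<^esub> = \<zero>\<^bsub>V\<^esub>"
  using smult_r_null[of a] by simp

definition lc :: "(nat \<Rightarrow> 'v) \<Rightarrow> (nat \<Rightarrow> 'k) \<Rightarrow> 'v" where
  "lc b c = (\<Oplus>\<^bsub>V\<^esub>i\<in>{..d}. c i \<odot>\<^bsub>V\<^esub> b i)"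

abbreviation family :: "(nat \<Rightarrow> 'v) \<Rightarrow> bool" where
  "family b \<equiv> \<forall>i\<le>d. b i \<in> carrier V"

definition frame :: "(nat \<Rightarrow> 'v) \<Rightarrow> bool" where
  "frame b \<longleftrightarrow> family b \<and> (\<forall>x\<in>carrier V. \<exists>c. x = lc b c) \<and>
     (\<forall>c. lc b c = \<zero>\<^bsub>V\<^esub> \<longrightarrow> (\<forall>i\<le>d. c i = 0))"

lemma lc_in [simp]: "family b \<Longrightarrow> lc b c \<in> carrier V"
  unfolding lc_def by (rule finsum_closed) auto

lemma lc_cong: "family b \<Longrightarrow> (\<And>i. i \<le> d \<Longrightarrow> c i = c' i) \<Longrightarrow> (\<And>i. i \<le> d \<Longrightarrow> b i = b' i) \<Longrightarrow> lc b c = lc b' c'"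
  unfolding lc_def by (rule finsum_cong') auto

lemma lc_add: "family b \<Longrightarrow> lc b c \<oplus>\<^bsub>V\<^esub> lc b c' = lc b (\<lambda>i. c i + c' i)"
proof -
  assume b: "family b"
  have "lc b (\<lambda>i. c i + c' i) = (\<Oplus>\<^bsub>V\<^esub>i\<in>{..d}. c i \<odot>\<^bsub>V\<^esub> b i \<oplus>\<^bsub>V\<^esub> c' i \<odot>\<^bsub>V\<^esub> b i)"
    unfolding lc_def using b by (intro finsum_cong') (auto simp: smult_add_left)
  also have "\<dots> = lc b c \<oplus>\<^bsub>V\<^esub> lc b c'"
    unfolding lc_def using b by (intro finsum_addf) auto
  finally show ?thesis by simp
qed

lemma lc_smult: "family b \<Longrightarrow> a \<odot>\<^bsub>V\<^esub> lc b c = lc b (\<lambda>i. a * c i)"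
proof -
  assume b: "family b"
  have "a \<odot>\<^bsub>V\<^esub> lc b c = (\<Oplus>\<^bsub>V\<^esub>i\<in>{..d}. a \<odot>\<^bsub>V\<^esub> (c i \<odot>\<^bsub>V\<^esub> b i))"
    unfolding lc_def using b by (intro finsum_smult_ldistr) auto
  also have "\<dots> = lc b (\<lambda>i. a * c i)"
    unfolding lc_def using b by (intro finsum_cong') (auto simp: smult_smult)
  finally show ?thesis .
qed

lemma lc_zero: "family b \<Longrightarrow> (\<And>i. i \<le> d \<Longrightarrow> c i = 0) \<Longrightarrow> lc b c = \<zero>\<^bsub>V\<^esub>"
  unfolding lc_def by (rule finsum_all0) auto

lemma lc_single: "family b \<Longrightarrow> j \<le> d \<Longrightarrow> lc b (\<lambda>i. if i = j then a else 0) = a \<odot>\<^bsub>V\<^esub> b j"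
proof -
  assume b: "family b" and j: "j \<le> d"
  have "lc b (\<lambda>i. if i = j then a else 0) = (\<Oplus>\<^bsub>V\<^esub>i\<in>{..d}. if j = i then a \<odot>\<^bsub>V\<^esub> b i else \<zero>\<^bsub>V\<^esub>)"
    unfolding lc_def using b by (intro finsum_cong') auto
  also have "\<dots> = a \<odot>\<^bsub>V\<^esub> b j" using b j by (intro finsum_singleton) auto
  finally show ?thesis .
qed

lemma lc_lincomb:
  assumes "family b" "inj_on b {..d}"
  shows "lincomb a (b ` {..d}) = lc b (\<lambda>i. a (b i))"
  unfolding lincomb_def lc_def using assms by (intro finsum_reindex) auto

lemma frame_of_basis:
  assumes "basis B"
  shows "\<exists>b. frame b \<and> b ` {..d} = B"
proof -
  have B: "lin_indpt B" "span B = carrier V" "B \<subseteq> carrier V"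
    using assms by (simp_all add: basis_def)
  have fin: "finite B" using fin_dim_li_fin[OF fin_dim_space] B by blast
  have "card B = d + 1" using dim_basis[OF fin assms] dim_space by simp
  then obtain b where b: "bij_betw b {..d} B"
    using fin by (metis finite_same_card_bij card_atMost finite_atMost Suc_eq_plus1)
  have im: "b ` {..d} = B" and inj: "inj_on b {..d}" using b by (auto simp: bij_betw_def)
  have fam: "family b" using im B(3) by blast
  have "\<exists>c. x = lc b c" if x: "x \<in> carrier V" for x
  proof -
    have "x \<in> span B" using x B(2) by simp
    then obtain a where "lincomb a B = x" using finite_in_span[OF fin B(3)] by blast
    then show ?thesis using lc_lincomb[OF fam inj] im by metis
  qed
  moreover have "c i = 0" if c: "lc b c = \<zero>\<^bsub>V\<^esub>" and i: "i \<le> d" for c i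
  proof (rule ccontr)
    assume nz: "c i \<noteq> 0"
    define a where "a x = c (the_inv_into {..d} b x)" for x
    have ab: "a (b j) = c j" if "j \<le> d" for j
      unfolding a_def using the_inv_into_f_f[OF inj] that by auto
    have "lincomb a B = lc b (\<lambda>i. a (b i))" using lc_lincomb[OF fam inj] im by metis
    also have "\<dots> = lc b c" using fam ab by (intro lc_cong) auto
    finally have "lincomb a B = \<zero>\<^bsub>V\<^esub>" using c by simp
    then have "lin_dep B"
    proof (rule lin_dep_crit[OF fin subset_refl, rotated 3])
      show "b i \<in> B" using i im by blast
    qed (simp_all add: ab[OF i] nz)
    with B show False by simp
  qed
  ultimately show ?thesis using fam im unfolding frame_def by blast
qed

text \<open>
  The bridge between families indexed by \<open>0, \<dots>, d\<close> and the library notion of a basis, which is a set: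
  a repeated entry \<open>b i = b j\<close> would be the relation \<open>b i - b j = 0\<close>, so an independent family is
  injective, and its range has as many elements as the dimension.
\<close>

lemma basis_of_independent:
  assumes fam: "family b" and ind: "\<And>c. lc b c = \<zero>\<^bsub>V\<^esub> \<Longrightarrow> \<forall>i\<le>d. c i = 0"
  shows "basis (b ` {..d})" "inj_on b {..d}"
proof -
  show inj: "inj_on b {..d}"
  proof (rule inj_onI)
    fix i j assume ij: "i \<in> {..d}" "j \<in> {..d}" "b i = b j"
    show "i = j"
    proof (rule ccontr)
      assume ne: "i \<noteq> j"
      have "lc b (\<lambda>l. (if l = i then 1 else 0) + (if l = j then - 1 else 0))
          = 1 \<odot>\<^bsub>V\<^esub> b i \<oplus>\<^bsub>V\<^esub> (- 1) \<odot>\<^bsub>V\<^esub> b j"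
        using fam ij by (simp add: lc_add[symmetric] lc_single)
      also have "\<dots> = (1 + - 1) \<odot>\<^bsub>V\<^esub> b i" unfolding ij(3)[symmetric]
        using fam ij(1) smult_add_left[of "b i" 1 "-1"] by (simp del: add.right_inverse)
      also have "\<dots> = \<zero>\<^bsub>V\<^esub>" using fam ij by simp
      finally have "(if i = i then 1 else 0) + (if i = j then - 1 else 0) = (0::'k)"
        using ind ij(1) by fastforce
      then show False using ne by simp
    qed
  qed
  have "lin_indpt (b ` {..d})"
  proof (rule finite_lin_indpt2)
    fix a assume "lincomb a (b ` {..d}) = \<zero>\<^bsub>V\<^esub>"
    then show "\<forall>v\<in>b ` {..d}. a v = \<zero>\<^bsub>class_ring\<^esub>"
      using ind[of "\<lambda>i. a (b i)"] lc_lincomb[OF fam inj, of a] by auto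
  qed (use fam in auto)
  then show "basis (b ` {..d})"
    by (intro dim_li_is_basis fin_dim_space)
       (use fam dim_space card_image[OF inj] in auto)
qed

lemma frame_of_independent:
  assumes fam: "family b" and ind: "\<And>c. lc b c = \<zero>\<^bsub>V\<^esub> \<Longrightarrow> \<forall>i\<le>d. c i = 0"
  shows "frame b"
proof -
  note bas = basis_of_independent[OF assms]
  have "\<exists>c. x = lc b c" if x: "x \<in> carrier V" for x
  proof -
    obtain a where "lincomb a (b ` {..d}) = x"
      using finite_in_span[of "b ` {..d}" x] x bas fam unfolding basis_def by auto
    then show ?thesis using lc_lincomb[OF fam bas(2)] by metis
  qed
  then show ?thesis using fam ind by (simp add: frame_def)
qed

lemma frame_exists: "\<exists>b. frame b"
  using finite_basis_exists[OF fin_dim_space] frame_of_basis by blast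

text \<open>
  Coordinates are set to 0 beyond \<open>d\<close>, so that a triangularity condition such as
  \<open>coord b x h = 0\<close> for all \<open>h > i\<close> can be written without an upper bound on \<open>h\<close>.
\<close>

definition coord :: "(nat \<Rightarrow> 'v) \<Rightarrow> 'v \<Rightarrow> nat \<Rightarrow> 'k" where
  "coord b x i = (if i \<le> d then (SOME c. x = lc b c) i else 0)"

lemma coord_beyond [simp]: "d < i \<Longrightarrow> coord b x i = 0"
  by (simp add: coord_def)

lemma frame_family: "frame b \<Longrightarrow> family b" by (simp add: frame_def)

lemma frame_in [simp]: "frame b \<Longrightarrow> i \<le> d \<Longrightarrow> b i \<in> carrier V" by (simp add: frame_def)

lemma lc_frame_in [simp]: "frame b \<Longrightarrow> lc b c \<in> carrier V" by (simp add: frame_def)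

lemma lc_inj:
  assumes b: "frame b" and eq: "lc b c = lc b c'" and i: "i \<le> d"
  shows "c i = c' i"
proof -
  have f: "family b" using b by (rule frame_family)
  have "lc b (\<lambda>i. c i + (-1) * c' i) = lc b c \<oplus>\<^bsub>V\<^esub> (-1) \<odot>\<^bsub>V\<^esub> lc b c'"
    using f by (simp only: lc_add lc_smult)
  also have "\<dots> = lc b c \<oplus>\<^bsub>V\<^esub> (-1) \<odot>\<^bsub>V\<^esub> lc b c" using eq by simp
  also have "\<dots> = lc b (\<lambda>i. c i + (-1) * c i)" using f by (simp only: lc_add lc_smult)
  also have "\<dots> = \<zero>\<^bsub>V\<^esub>" using f by (intro lc_zero) auto
  finally have "\<forall>i\<le>d. c i + (-1) * c' i = 0" using b unfolding frame_def by blast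
  then show ?thesis using i by simp
qed

lemma lc_coord: assumes "frame b" "x \<in> carrier V" shows "lc b (coord b x) = x"
proof -
  have "\<exists>c. x = lc b c" using assms by (simp add: frame_def)
  then have "x = lc b (SOME c. x = lc b c)" by (rule someI_ex)
  moreover have "lc b (SOME c. x = lc b c) = lc b (coord b x)"
    by (rule lc_cong[OF frame_family[OF assms(1)]]) (simp_all add: coord_def)
  ultimately show ?thesis by simp
qed

lemma coord_lc [simp]:
  assumes "frame b" shows "coord b (lc b c) i = (if i \<le> d then c i else 0)"
  using lc_inj[OF assms, of "coord b (lc b c)" c i] lc_coord[OF assms, of "lc b c"] assms
  by simp

lemma coord_eqI:
  assumes "frame b" "x \<in> carrier V" "y \<in> carrier V" "\<And>i. i \<le> d \<Longrightarrow> coord b x i = coord b y i"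
  shows "x = y"
proof -
  have "lc b (coord b x) = lc b (coord b y)"
    by (rule lc_cong[OF frame_family[OF assms(1)] assms(4) refl])
  then show ?thesis by (simp only: lc_coord[OF assms(1,2)] lc_coord[OF assms(1,3)])
qed

lemma coord_add [simp]:
  assumes "frame b" "x \<in> carrier V" "y \<in> carrier V"
  shows "coord b (x \<oplus>\<^bsub>V\<^esub> y) i = coord b x i + coord b y i"
proof -
  have "x \<oplus>\<^bsub>V\<^esub> y = lc b (\<lambda>i. coord b x i + coord b y i)"
    using lc_add[OF frame_family[OF assms(1)], of "coord b x" "coord b y"]
    by (simp only: lc_coord[OF assms(1,2)] lc_coord[OF assms(1,3)])
  then show ?thesis by (simp add: coord_lc[OF assms(1)])
qed

lemma coord_smult [simp]:
  assumes "frame b" "x \<in> carrier V"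
  shows "coord b (a \<odot>\<^bsub>V\<^esub> x) i = a * coord b x i"
proof -
  have "a \<odot>\<^bsub>V\<^esub> x = lc b (\<lambda>i. a * coord b x i)"
    using lc_smult[OF frame_family[OF assms(1)], of a "coord b x"]
    by (simp only: lc_coord[OF assms])
  then show ?thesis by (simp add: coord_lc[OF assms(1)])
qed

lemma coord_zero [simp]: "frame b \<Longrightarrow> coord b \<zero>\<^bsub>V\<^esub> i = 0"
  using coord_smult[of b "\<zero>\<^bsub>V\<^esub>" 0 i] by simp

lemma coord_basis:
  assumes "frame b" "j \<le> d" shows "coord b (b j) i = (if i = j then 1 else 0)"
proof -
  have "b j = lc b (\<lambda>i. if i = j then 1 else 0)"
    using lc_single[OF frame_family[OF assms(1)] assms(2), of 1] assms by simp
  then have "coord b (b j) i = coord b (lc b (\<lambda>i. if i = j then 1 else 0)) i" by (rule arg_cong)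
  then show ?thesis using assms(2) by (simp add: coord_lc[OF assms(1)])
qed

lemma frame_nonzero: "frame b \<Longrightarrow> i \<le> d \<Longrightarrow> b i \<noteq> \<zero>\<^bsub>V\<^esub>"
  using coord_basis[of b i i] by (auto simp: coord_zero)

lemma coord_finsum:
  assumes b: "frame b" and y: "\<And>i. i \<in> I \<Longrightarrow> y i \<in> carrier V"
  shows "coord b (\<Oplus>\<^bsub>V\<^esub>i\<in>I. y i) k = (\<Sum>i\<in>I. coord b (y i) k)"
  using y by (induct I rule: infinite_finite_induct) (simp_all add: b finsum_insert Pi_def)

lemma coord_lc_other:
  assumes b: "frame b" and y: "family y"
  shows "coord b (lc y c) k = (\<Sum>i\<le>d. c i * coord b (y i) k)"
  unfolding lc_def using y by (subst coord_finsum[OF b]) (auto intro!: sum.cong simp: b)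

lemma coord_nonzero_ex:
  assumes "frame b" "x \<in> carrier V" "x \<noteq> \<zero>\<^bsub>V\<^esub>"
  shows "\<exists>i\<le>d. coord b x i \<noteq> 0"
  using coord_eqI[OF assms(1,2) zero_closed] assms(1,3) by force

end

section \<open>Linear maps and endomorphisms\<close>

abbreviation lin :: "('k::field, 'v) module \<Rightarrow> ('k, 'w) module \<Rightarrow> ('v \<Rightarrow> 'w) set" where
  "lin V W \<equiv> LinearCombinations.module_hom class_ring V W"

lemma lin_iff: "T \<in> lin V W \<longleftrightarrow>
  (\<forall>x\<in>carrier V. T x \<in> carrier W) \<and>
  (\<forall>x\<in>carrier V. \<forall>y\<in>carrier V. T (x \<oplus>\<^bsub>V\<^esub> y) = T x \<oplus>\<^bsub>W\<^esub> T y) \<and>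
  (\<forall>a. \<forall>x\<in>carrier V. T (a \<odot>\<^bsub>V\<^esub> x) = a \<odot>\<^bsub>W\<^esub> T x)"
  by (auto simp: LinearCombinations.module_hom_def)

lemma lin_in: "T \<in> lin V W \<Longrightarrow> x \<in> carrier V \<Longrightarrow> T x \<in> carrier W"
  and lin_add: "T \<in> lin V W \<Longrightarrow> x \<in> carrier V \<Longrightarrow> y \<in> carrier V \<Longrightarrow> T (x \<oplus>\<^bsub>V\<^esub> y) = T x \<oplus>\<^bsub>W\<^esub> T y"
  and lin_smult: "T \<in> lin V W \<Longrightarrow> x \<in> carrier V \<Longrightarrow> T (a \<odot>\<^bsub>V\<^esub> x) = a \<odot>\<^bsub>W\<^esub> T x"
  by (simp_all add: lin_iff)

locale kspace_pair = V: kspace V d + W: kspace W d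
  for V :: "('k::field, 'v) module" and W :: "('k, 'w) module" and d
begin

lemma lin_zero: "T \<in> lin V W \<Longrightarrow> T \<zero>\<^bsub>V\<^esub> = \<zero>\<^bsub>W\<^esub>"
  using lin_smult[of T V W "\<zero>\<^bsub>V\<^esub>" 0] lin_in[of T V W "\<zero>\<^bsub>V\<^esub>"] by simp

lemma lin_finsum:
  assumes T: "T \<in> lin V W" and y: "\<And>i. i \<in> I \<Longrightarrow> y i \<in> carrier V"
  shows "T (\<Oplus>\<^bsub>V\<^esub>i\<in>I. y i) = (\<Oplus>\<^bsub>W\<^esub>i\<in>I. T (y i))"
  using y
  by (induct I rule: infinite_finite_induct)
     (simp_all add: lin_zero[OF T] lin_in[OF T] lin_add[OF T] V.finsum_insert W.finsum_insert Pi_def)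

lemma lin_lc:
  assumes T: "T \<in> lin V W" and b: "\<forall>i\<le>d. b i \<in> carrier V"
  shows "T (V.lc b c) = W.lc (\<lambda>i. T (b i)) c"
  unfolding V.lc_def W.lc_def using b
  by (subst lin_finsum[OF T]) (auto intro!: W.finsum_cong' simp: lin_in[OF T] lin_smult[OF T])

text \<open>
  The linear map with prescribed values \<open>y i\<close> on a frame \<open>b\<close>; it is extensional because the elements
  of \<^const>\<open>End_alg\<close> are.
\<close>

definition lmap :: "(nat \<Rightarrow> 'v) \<Rightarrow> (nat \<Rightarrow> 'w) \<Rightarrow> 'v \<Rightarrow> 'w" where
  "lmap b y = (\<lambda>x\<in>carrier V. W.lc y (V.coord b x))"

lemma lmap_lin:
  assumes b: "V.frame b" and y: "\<forall>i\<le>d. y i \<in> carrier W"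
  shows "lmap b y \<in> lin V W"
  unfolding lin_iff lmap_def using b y
  by (auto simp: W.lc_add W.lc_smult intro!: W.lc_cong)

lemma lmap_basis:
  assumes b: "V.frame b" and y: "\<forall>i\<le>d. y i \<in> carrier W" and j: "j \<le> d"
  shows "lmap b y (b j) = y j"
proof -
  have "lmap b y (b j) = W.lc y (\<lambda>i. if i = j then 1 else 0)"
    using b y j unfolding lmap_def by (auto intro!: W.lc_cong simp: V.coord_basis)
  then show ?thesis using W.lc_single[OF y j, of 1] y j by simp
qed

lemma lin_eqI:
  assumes "V.frame b" "S \<in> lin V W" "T \<in> lin V W" "\<And>i. i \<le> d \<Longrightarrow> S (b i) = T (b i)" "x \<in> carrier V"
  shows "S x = T x"
proof -
  have "S (V.lc b (V.coord b x)) = T (V.lc b (V.coord b x))"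
    using assms(1,4) lin_in[OF assms(2)] lin_in[OF assms(3)]
    by (subst (1 2) lin_lc) (auto intro!: W.lc_cong simp: assms(2,3))
  then show ?thesis using V.lc_coord assms by simp
qed

end

context kspace begin

sublocale self: kspace_pair V V d by unfold_locales

abbreviation End :: "('v \<Rightarrow> 'v) set" where "End \<equiv> carrier (End_alg V)"

lemma End_iff: "X \<in> End \<longleftrightarrow> X \<in> lin V V \<and> X \<in> extensional (carrier V)"
  by (simp add: End_alg_def)

lemma End_in [simp]: "X \<in> End \<Longrightarrow> x \<in> carrier V \<Longrightarrow> X x \<in> carrier V"
  and End_add: "X \<in> End \<Longrightarrow> x \<in> carrier V \<Longrightarrow> y \<in> carrier V \<Longrightarrow> X (x \<oplus>\<^bsub>V\<^esub> y) = X x \<oplus>\<^bsub>V\<^esub> X y"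
  and End_smult: "X \<in> End \<Longrightarrow> x \<in> carrier V \<Longrightarrow> X (a \<odot>\<^bsub>V\<^esub> x) = a \<odot>\<^bsub>V\<^esub> X x"
  by (simp_all add: End_iff lin_iff)

lemma End_zero [simp]: "X \<in> End \<Longrightarrow> X \<zero>\<^bsub>V\<^esub> = \<zero>\<^bsub>V\<^esub>"
  using self.lin_zero by (simp add: End_iff)

lemma End_lc: "X \<in> End \<Longrightarrow> family b \<Longrightarrow> X (lc b c) = lc (\<lambda>i. X (b i)) c"
  using self.lin_lc by (simp add: End_iff)

lemma End_eqI:
  assumes "frame b" "X \<in> End" "Y \<in> End" "\<And>i. i \<le> d \<Longrightarrow> X (b i) = Y (b i)"
  shows "X = Y"
proof (rule extensionalityI[of _ "carrier V"])
  fix x assume "x \<in> carrier V"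
  then show "X x = Y x" using self.lin_eqI[of b X Y x] assms by (simp add: End_iff)
qed (use assms in \<open>simp_all add: End_iff\<close>)

lemma lmap_End:
  assumes "frame b" "family y" shows "self.lmap b y \<in> End"
  using self.lmap_lin[OF assms] by (simp add: End_iff self.lmap_def)

lemmas lmap_basis = self.lmap_basis

lemma coord_End:
  assumes X: "X \<in> End" and b: "frame b" and x: "x \<in> carrier V"
  shows "coord b (X x) i = (\<Sum>j\<le>d. coord b x j * coord b (X (b j)) i)"
proof -
  have "X x = lc (\<lambda>j. X (b j)) (coord b x)"
    using End_lc[OF X frame_family[OF b], of "coord b x"] lc_coord[OF b x] by simp
  then show ?thesis using coord_lc_other[OF b, of "\<lambda>j. X (b j)" "coord b x" i] X b by simp
qed

lemma coord_eigen:
  assumes X: "X \<in> End" and b: "frame b" and x: "x \<in> carrier V"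
    and e: "\<And>i. i \<le> d \<Longrightarrow> X (b i) = t i \<odot>\<^bsub>V\<^esub> b i"
  shows "coord b (X x) i = t i * coord b x i"
proof (cases "i \<le> d")
  case True
  have "coord b (X x) i = (\<Sum>j\<le>d. if j = i then t i * coord b x i else 0)"
    unfolding coord_End[OF X b x] by (rule sum.cong) (simp_all add: e b coord_basis)
  then show ?thesis using True by simp
qed simp

lemma End_mult: "(X \<otimes>\<^bsub>End_alg V\<^esub> Y) = compose (carrier V) X Y"
  and End_one: "\<one>\<^bsub>End_alg V\<^esub> = (\<lambda>v\<in>carrier V. v)"
  and End_zero_def: "\<zero>\<^bsub>End_alg V\<^esub> = (\<lambda>v\<in>carrier V. \<zero>\<^bsub>V\<^esub>)"
  and End_add_def: "X \<oplus>\<^bsub>End_alg V\<^esub> Y = (\<lambda>v\<in>carrier V. X v \<oplus>\<^bsub>V\<^esub> Y v)"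
  and End_smult_def: "a \<odot>\<^bsub>End_alg V\<^esub> X = (\<lambda>v\<in>carrier V. a \<odot>\<^bsub>V\<^esub> X v)"
  by (simp_all add: End_alg_def)

lemma mult_app [simp]: "x \<in> carrier V \<Longrightarrow> (X \<otimes>\<^bsub>End_alg V\<^esub> Y) x = X (Y x)"
  and one_app [simp]: "x \<in> carrier V \<Longrightarrow> \<one>\<^bsub>End_alg V\<^esub> x = x"
  and zero_app [simp]: "x \<in> carrier V \<Longrightarrow> \<zero>\<^bsub>End_alg V\<^esub> x = \<zero>\<^bsub>V\<^esub>"
  and add_app [simp]: "x \<in> carrier V \<Longrightarrow> (X \<oplus>\<^bsub>End_alg V\<^esub> Y) x = X x \<oplus>\<^bsub>V\<^esub> Y x"
  and smult_app [simp]: "x \<in> carrier V \<Longrightarrow> (a \<odot>\<^bsub>End_alg V\<^esub> X) x = a \<odot>\<^bsub>V\<^esub> X x"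
  by (simp_all add: End_mult End_one End_zero_def End_add_def End_smult_def compose_def)

lemma add_swap: "a \<in> carrier V \<Longrightarrow> b \<in> carrier V \<Longrightarrow> c \<in> carrier V \<Longrightarrow> e \<in> carrier V \<Longrightarrow>
  (a \<oplus>\<^bsub>V\<^esub> b) \<oplus>\<^bsub>V\<^esub> (c \<oplus>\<^bsub>V\<^esub> e) = (a \<oplus>\<^bsub>V\<^esub> c) \<oplus>\<^bsub>V\<^esub> (b \<oplus>\<^bsub>V\<^esub> e)"
  by (simp add: a_ac)

lemma mult_End [simp]: "X \<in> End \<Longrightarrow> Y \<in> End \<Longrightarrow> X \<otimes>\<^bsub>End_alg V\<^esub> Y \<in> End"
  unfolding End_iff lin_iff by (auto simp: End_mult compose_def)

lemma one_End [simp]: "\<one>\<^bsub>End_alg V\<^esub> \<in> End"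
  unfolding End_iff lin_iff by (auto simp: End_one)

lemma zero_End [simp]: "\<zero>\<^bsub>End_alg V\<^esub> \<in> End"
  unfolding End_iff lin_iff by (auto simp: End_zero_def)

lemma add_End [simp]: "X \<in> End \<Longrightarrow> Y \<in> End \<Longrightarrow> X \<oplus>\<^bsub>End_alg V\<^esub> Y \<in> End"
  unfolding End_iff lin_iff by (auto simp: End_add_def smult_add_right add_swap)

lemma smult_End [simp]: "X \<in> End \<Longrightarrow> a \<odot>\<^bsub>End_alg V\<^esub> X \<in> End"
  unfolding End_iff lin_iff by (auto simp: End_smult_def smult_add_right smult_smult mult.commute)

lemma End_ext:
  assumes "X \<in> End" "Y \<in> End" "\<And>x. x \<in> carrier V \<Longrightarrow> X x = Y x" shows "X = Y"
  using assms by (intro extensionalityI[of _ "carrier V"]) (simp_all add: End_iff)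

end

section \<open>Eigenframes\<close>

definition hessenberg :: "nat \<Rightarrow> (nat \<Rightarrow> nat \<Rightarrow> 'k::zero) \<Rightarrow> bool" where
  "hessenberg d a \<longleftrightarrow> (\<forall>i\<le>d. \<forall>j\<le>d. (i > j + 1 \<longrightarrow> a i j = 0) \<and> (i = j + 1 \<longrightarrow> a i j \<noteq> 0))"

context kspace begin

lemma smult_eq_zero: 
  assumes "x \<in> carrier V" "a \<odot>\<^bsub>V\<^esub> x = \<zero>\<^bsub>V\<^esub>" "x \<noteq> \<zero>\<^bsub>V\<^esub>" shows "a = 0"
proof (rule ccontr)
  assume "a \<noteq> 0"
  then have "x = inverse a \<odot>\<^bsub>V\<^esub> (a \<odot>\<^bsub>V\<^esub> x)" using assms(1) by (simp add: smult_smult)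
  then show False using assms by simp
qed

text \<open>
  An eigenframe is a basis of eigenvectors \<open>b i\<close> together with what it determines: the list \<open>t\<close> of
  eigenvalues and the list \<open>Es\<close> of projections onto the lines through the \<open>b i\<close>. All conditions on a
  multiplicity-free endomorphism and its idempotents will be read off from such a frame.
\<close>

definition eigenframe :: "('v \<Rightarrow> 'v) \<Rightarrow> ('v \<Rightarrow> 'v) list \<Rightarrow> 'k list \<Rightarrow> (nat \<Rightarrow> 'v) \<Rightarrow> bool" where
  "eigenframe X Es t b \<longleftrightarrow> frame b \<and> X \<in> End \<and> length Es = d + 1 \<and> length t = d + 1 \<and> distinct t \<and>
     (\<forall>i\<le>d. X (b i) = t ! i \<odot>\<^bsub>V\<^esub> b i) \<and> (\<forall>i\<le>d. Es ! i \<in> End) \<and>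
     (\<forall>i\<le>d. \<forall>j\<le>d. (Es ! i) (b j) = (if i = j then b j else \<zero>\<^bsub>V\<^esub>))"

lemma lc_delta:
  assumes "family b" "k \<le> d" "\<And>i. i \<le> d \<Longrightarrow> y i = (if i = k then b k else \<zero>\<^bsub>V\<^esub>)"
  shows "lc y c = c k \<odot>\<^bsub>V\<^esub> b k"
proof -
  have "lc y c = lc b (\<lambda>i. if i = k then c k else 0)"
    unfolding lc_def using assms by (intro finsum_cong') auto
  then show ?thesis using lc_single[OF assms(1,2)] by simp
qed

lemma eigenframe_proj:
  assumes e: "eigenframe X Es t b" and i: "i \<le> d" and x: "x \<in> carrier V"
  shows "(Es ! i) x = coord b x i \<odot>\<^bsub>V\<^esub> b i"
proof -
  have b: "frame b" and E: "Es ! i \<in> End" using e i by (auto simp: eigenframe_def)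
  have "(Es ! i) x = lc (\<lambda>j. (Es ! i) (b j)) (coord b x)"
    using End_lc[OF E frame_family[OF b], of "coord b x"] by (simp only: lc_coord[OF b x])
  also have "\<dots> = coord b x i \<odot>\<^bsub>V\<^esub> b i"
    using e i by (intro lc_delta frame_family b) (auto simp: eigenframe_def)
  finally show ?thesis .
qed

lemma eigenframe_coord:
  assumes e: "eigenframe X Es t b" and x: "x \<in> carrier V"
  shows "coord b (X x) i = t ! i * coord b x i"
  using e x by (intro coord_eigen) (auto simp: eigenframe_def)

lemma eigenspace_eigenframe:
  assumes e: "eigenframe X Es t b" and k: "k \<le> d"
  shows "eigenspace_on V X (t ! k) = {a \<odot>\<^bsub>V\<^esub> b k | a. True}"
proof -
  have b: "frame b" and X: "X \<in> End" using e by (auto simp: eigenframe_def)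
  have inj: "t ! i = t ! k \<longleftrightarrow> i = k" if "i \<le> d" for i
    using e k that by (simp add: eigenframe_def nth_eq_iff_index_eq)
  have "x = coord b x k \<odot>\<^bsub>V\<^esub> b k" if x: "x \<in> carrier V" and "X x = t ! k \<odot>\<^bsub>V\<^esub> x" for x
  proof (rule coord_eqI[OF b])
    fix i assume i: "i \<le> d"
    have "t ! i * coord b x i = t ! k * coord b x i"
      using eigenframe_coord[OF e x, of i] that by (auto simp: coord_smult[OF b x])
    then show "coord b x i = coord b (coord b x k \<odot>\<^bsub>V\<^esub> b k) i"
      using inj[OF i] frame_in[OF b k] by (cases "i = k") (simp_all add: coord_basis[OF b k] b)
  qed (use x frame_in[OF b k] in simp_all)
  moreover have "X (a \<odot>\<^bsub>V\<^esub> b k) = t ! k \<odot>\<^bsub>V\<^esub> (a \<odot>\<^bsub>V\<^esub> b k)" for a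
    using e k X b by (simp add: End_smult eigenframe_def smult_smult mult.commute)
  ultimately show ?thesis
    using smult_in[OF frame_in[OF b k]] unfolding eigenspace_on_def by blast
qed

lemma eigenvalues_eigenframe:
  assumes e: "eigenframe X Es t b"
  shows "eigenvalues_on V X = {t ! k | k. k \<le> d}"
proof -
  have b: "frame b" using e by (auto simp: eigenframe_def)
  have "\<exists>k\<le>d. \<theta> = t ! k" if x: "x \<in> carrier V" "X x = \<theta> \<odot>\<^bsub>V\<^esub> x" "x \<noteq> \<zero>\<^bsub>V\<^esub>" for x \<theta>
  proof -
    obtain k where k: "k \<le> d" "coord b x k \<noteq> 0" using coord_nonzero_ex[OF b x(1,3)] by blast
    have "t ! k * coord b x k = \<theta> * coord b x k"
      using eigenframe_coord[OF e x(1), of k] x(2) by (auto simp: coord_smult[OF b x(1)])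
    then have "\<theta> = t ! k" using k(2) by simp
    then show ?thesis using k(1) by blast
  qed
  moreover have "b k \<in> eigenspace_on V X (t ! k) \<and> b k \<noteq> \<zero>\<^bsub>V\<^esub>" if "k \<le> d" for k
    using e that frame_nonzero[OF b that] by (simp add: eigenframe_def eigenspace_on_def)
  ultimately show ?thesis unfolding eigenvalues_on_def eigenspace_on_def by blast
qed

text \<open>
  The dimension of an eigenspace is computed in the module with restricted carrier, so it is passed
  through the library facts on spans in submodules.
\<close>

lemma dim_line:
  assumes v: "v \<in> carrier V" "v \<noteq> \<zero>\<^bsub>V\<^esub>"
  shows "vectorspace.dim class_ring (V\<lparr>carrier := {a \<odot>\<^bsub>V\<^esub> v | a. True}\<rparr>) = 1"
proof -
  have "lincomb a {v} = a v \<odot>\<^bsub>V\<^esub> v" for a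
    unfolding lincomb_def using v by (simp add: finsum_insert)
  then have eq: "span {v} = {a \<odot>\<^bsub>V\<^esub> v | a. True}"
    using v by (subst finite_span) (auto intro: exI[of _ "\<lambda>_. _"])
  have sub: "subspace class_ring (span {v}) V" using v by (intro span_is_subspace) auto
  interpret L: vectorspace class_ring "V\<lparr>carrier := span {v}\<rparr>"
    by (rule subspace_is_vs[OF sub])
  have in_sp: "v \<in> span {v}" using in_own_span[of "{v}"] v by auto
  have "L.span {v} = span {v}"
    using span_li_not_depend(1)[of "{v}" "span {v}"] sub in_sp by (auto simp: subspace_def)
  then have "L.dim = 1" using v in_sp by (intro L.dim1I[of v]) auto
  then show ?thesis using eq by simp
qed

text \<open>
  An endomorphism with the defining properties of a primitive idempotent is prescribed on the whole
  eigenframe, hence is one of the projections.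
\<close>

lemma prim_idem_eigenframe:
  assumes e: "eigenframe X Es t b"
  shows "prim_idem V X \<theta> E \<longleftrightarrow> (\<exists>i\<le>d. \<theta> = t ! i \<and> E = Es ! i)"
proof -
  have b: "frame b" using e by (auto simp: eigenframe_def)
  have inj: "t ! i = t ! k \<longleftrightarrow> i = k" if "i \<le> d" "k \<le> d" for i k
    using e that by (simp add: eigenframe_def nth_eq_iff_index_eq)
  have ev: "eigenvalues_on V X = {t ! k | k. k \<le> d}" by (rule eigenvalues_eigenframe[OF e])
  have bin: "b k \<in> eigenspace_on V X (t ! k)" if "k \<le> d" for k
    using e that b by (simp add: eigenframe_def eigenspace_on_def)
  have 1: "prim_idem V X (t ! i) (Es ! i)" if i: "i \<le> d" for i
    unfolding prim_idem_def
  proof (intro conjI ballI)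
    show "t ! i \<in> eigenvalues_on V X" using ev i by auto
    show E: "Es ! i \<in> End" using e i by (simp add: eigenframe_def)
    show "(Es ! i) v = v" if "v \<in> eigenspace_on V X (t ! i)" for v
    proof -
      obtain a where "v = a \<odot>\<^bsub>V\<^esub> b i" using \<open>v \<in> _\<close> eigenspace_eigenframe[OF e i] by blast
      then show ?thesis using e i E frame_in[OF b i] by (simp add: End_smult eigenframe_def)
    qed
    show "(Es ! i) v = \<zero>\<^bsub>V\<^esub>" if m: "\<mu> \<in> eigenvalues_on V X - {t ! i}" and v: "v \<in> eigenspace_on V X \<mu>" for \<mu> v
    proof -
      obtain k where k: "k \<le> d" "\<mu> = t ! k" "i \<noteq> k" using m ev by blast
      obtain a where "v = a \<odot>\<^bsub>V\<^esub> b k" using v k eigenspace_eigenframe[OF e k(1)] by blast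
      then show ?thesis using e i k E frame_in[OF b k(1)] by (simp add: End_smult eigenframe_def)
    qed
  qed
  have 2: "E = Es ! i" if E: "prim_idem V X (t ! i) E" and i: "i \<le> d" for E i
  proof (rule End_eqI[OF b])
    show "E \<in> End" using E by (simp add: prim_idem_def)
    show "Es ! i \<in> End" using 1[OF i] by (simp add: prim_idem_def)
    fix k assume k: "k \<le> d"
    show "E (b k) = (Es ! i) (b k)"
    proof (cases "k = i")
      case True
      then show ?thesis using E 1[OF i] bin[OF k] by (simp add: prim_idem_def)
    next
      case False
      then have "t ! k \<in> eigenvalues_on V X - {t ! i}" using ev k inj[OF k i] by auto
      then show ?thesis using E 1[OF i] bin[OF k] unfolding prim_idem_def by metis
    qed
  qed
  show ?thesis
  proof
    assume E: "prim_idem V X \<theta> E"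
    then obtain i where "i \<le> d" "\<theta> = t ! i" using ev unfolding prim_idem_def by blast
    then show "\<exists>i\<le>d. \<theta> = t ! i \<and> E = Es ! i" using 2 E by blast
  qed (use 1 in auto)
qed

lemma eigenframe_idem_inj:
  assumes e: "eigenframe X Es t b" and "i \<le> d" "j \<le> d" "Es ! i = Es ! j"
  shows "i = j"
proof (rule ccontr)
  assume "i \<noteq> j"
  have "frame b" using e by (simp add: eigenframe_def)
  then show False using e assms(2,3) \<open>i \<noteq> j\<close> assms(4) frame_nonzero[of b i]
    unfolding eigenframe_def by metis
qed

lemma eigenframe_eigenvalues:
  assumes e: "eigenframe X Es t b"
  shows "map (eigenvalue_of_idem V X) Es = t"
proof (rule nth_equalityI)
  show "length (map (eigenvalue_of_idem V X) Es) = length t" using e by (simp add: eigenframe_def)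
  fix i assume "i < length (map (eigenvalue_of_idem V X) Es)"
  then have i: "i \<le> d" and l: "i < length Es" using e by (simp_all add: eigenframe_def)
  have "eigenvalue_of_idem V X (Es ! i) = t ! i"
    unfolding eigenvalue_of_idem_def
  proof (rule the_equality)
    show "prim_idem V X (t ! i) (Es ! i)" using prim_idem_eigenframe[OF e] i by blast
    fix \<theta> assume "prim_idem V X \<theta> (Es ! i)"
    then show "\<theta> = t ! i"
      using prim_idem_eigenframe[OF e] eigenframe_idem_inj[OF e] i by metis
  qed
  then show "map (eigenvalue_of_idem V X) Es ! i = t ! i" using l by simp
qed

lemma eigenframe_imp:
  assumes e: "eigenframe X Es t b"
  shows "multiplicity_free V X" "prim_idem_ordering d V X Es"
proof -
  have b: "frame b" and X: "X \<in> End" using e by (auto simp: eigenframe_def)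
  have "basis (b ` {..d})"
  proof (rule basis_of_independent(1)[OF frame_family[OF b]])
    fix c assume "lc b c = \<zero>\<^bsub>V\<^esub>"
    then show "\<forall>i\<le>d. c i = 0" using b unfolding frame_def by blast
  qed
  moreover have "\<forall>v\<in>b ` {..d}. \<exists>\<theta>. X v = \<theta> \<odot>\<^bsub>V\<^esub> v"
    using e unfolding eigenframe_def by blast
  ultimately have "diagonalizable_on V X" unfolding diagonalizable_on_def by blast
  moreover have "vectorspace.dim class_ring (V\<lparr>carrier := eigenspace_on V X \<theta>\<rparr>) = 1"
    if th: "\<theta> \<in> eigenvalues_on V X" for \<theta>
  proof -
    obtain k where k: "k \<le> d" "\<theta> = t ! k" using th eigenvalues_eigenframe[OF e] by blast
    from dim_line[OF frame_in[OF b k(1)] frame_nonzero[OF b k(1)]] show ?thesis unfolding k(2) eigenspace_eigenframe[OF e k(1)] .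
  qed
  ultimately show "multiplicity_free V X" using X unfolding multiplicity_free_def by blast
  have l: "length Es = d + 1" using e by (simp add: eigenframe_def)
  have "distinct Es"
    unfolding distinct_conv_nth using eigenframe_idem_inj[OF e] l less_Suc_eq_le by auto
  moreover have "set Es = {E. \<exists>\<theta>. prim_idem V X \<theta> E}"
    unfolding prim_idem_eigenframe[OF e] set_conv_nth l using less_Suc_eq_le by auto
  ultimately show "prim_idem_ordering d V X Es" using l by (simp add: prim_idem_ordering_def)
qed

text \<open>
  The \<open>d + 1\<close> distinct idempotents belong to distinct eigenvalues, because diagonalizability makes an
  idempotent unique for its eigenvalue. One eigenvector for each of them gives an independent family,
  since applying the idempotents to a linear relation isolates its terms.
\<close>

lemma eigenframe_exists:
  assumes m: "multiplicity_free V X" and p: "prim_idem_ordering d V X Es"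
  shows "\<exists>t b. eigenframe X Es t b"
proof -
  have X: "X \<in> End" using m by (simp add: multiplicity_free_def)
  obtain B where B: "basis B" "\<forall>v\<in>B. \<exists>\<theta>. X v = \<theta> \<odot>\<^bsub>V\<^esub> v"
    using m by (auto simp: multiplicity_free_def diagonalizable_on_def)
  obtain c where c: "frame c" "c ` {..d} = B" using frame_of_basis[OF B(1)] by blast
  \<comment> \<open>Both endomorphisms are prescribed on the basis of eigenvectors.\<close>
  have uniq: "E = E'" if E: "prim_idem V X \<theta> E" and E': "prim_idem V X \<theta> E'" for \<theta> E E'
  proof (rule End_eqI[OF c(1)])
    show "E \<in> End" "E' \<in> End" using E E' by (simp_all add: prim_idem_def)
    fix k assume k: "k \<le> d"
    then obtain \<mu> where mu: "X (c k) = \<mu> \<odot>\<^bsub>V\<^esub> c k" using B(2) c(2) by blast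
    have es: "c k \<in> eigenspace_on V X \<mu>" using mu c(1) k by (simp add: eigenspace_on_def)
    show "E (c k) = E' (c k)"
    proof (cases "\<mu> = \<theta>")
      case True
      then show ?thesis using E E' es by (simp add: prim_idem_def)
    next
      case False
      then have "\<mu> \<in> eigenvalues_on V X - {\<theta>}"
        using es frame_nonzero[OF c(1) k] by (auto simp: eigenvalues_on_def)
      then show ?thesis using E E' es unfolding prim_idem_def by metis
    qed
  qed
  have l: "length Es = d + 1" and dist: "distinct Es"
    and setE: "set Es = {E. \<exists>\<theta>. prim_idem V X \<theta> E}"
    using p by (auto simp: prim_idem_ordering_def)
  have "\<exists>\<theta>. prim_idem V X \<theta> (Es ! i)" if "i \<le> d" for i
    using setE nth_mem[of i Es] that l by auto
  then obtain s where s: "\<And>i. i \<le> d \<Longrightarrow> prim_idem V X (s i) (Es ! i)" by metis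
  have "\<exists>v\<in>eigenspace_on V X (s i). v \<noteq> \<zero>\<^bsub>V\<^esub>" if "i \<le> d" for i
    using s[OF that] by (simp add: prim_idem_def eigenvalues_on_def)
  then obtain b where b: "\<And>i. i \<le> d \<Longrightarrow> b i \<in> eigenspace_on V X (s i) \<and> b i \<noteq> \<zero>\<^bsub>V\<^esub>" by metis
  have bV: "family b" using b by (simp add: eigenspace_on_def)
  have inj: "i = j" if "i \<le> d" "j \<le> d" "s i = s j" for i j
  proof -
    have "Es ! i = Es ! j" using uniq[OF s[OF that(1)]] s[OF that(2)] that(3) by simp
    then show ?thesis using dist l that by (simp add: nth_eq_iff_index_eq)
  qed
  have E: "Es ! i \<in> End" if "i \<le> d" for i using s[OF that] by (simp add: prim_idem_def)
  have Eb: "(Es ! i) (b j) = (if i = j then b j else \<zero>\<^bsub>V\<^esub>)" if i: "i \<le> d" and j: "j \<le> d" for i j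
  proof (cases "i = j")
    case True
    then show ?thesis using s[OF i] b[OF j] by (simp add: prim_idem_def)
  next
    case False
    have "s j \<in> eigenvalues_on V X" using s[OF j] by (simp add: prim_idem_def)
    then have "s j \<in> eigenvalues_on V X - {s i}" using inj[OF i j] False by auto
    then show ?thesis using s[OF i] b[OF j] False unfolding prim_idem_def by auto
  qed
  have "frame b"
  proof (rule frame_of_independent[OF bV], intro allI impI)
    fix a i assume z: "lc b a = \<zero>\<^bsub>V\<^esub>" and i: "i \<le> d"
    have "(Es ! i) (lc b a) = a i \<odot>\<^bsub>V\<^esub> b i"
      unfolding End_lc[OF E[OF i] bV] by (rule lc_delta[OF bV i]) (simp add: Eb i)
    then have "a i \<odot>\<^bsub>V\<^esub> b i = \<zero>\<^bsub>V\<^esub>" using z E[OF i] by simp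
    then show "a i = 0" using smult_eq_zero b[OF i] bV i by blast
  qed
  moreover have "\<forall>i\<le>d. X (b i) = s i \<odot>\<^bsub>V\<^esub> b i" using b by (simp add: eigenspace_on_def)
  moreover have "inj_on s {..d}" using inj by (auto intro!: inj_onI)
  then have "distinct (map s [0..<d + 1])"
    by (simp add: distinct_map lessThan_Suc_atMost atLeast0LessThan del: upt_Suc)
  ultimately have "eigenframe X Es (map s [0..<d + 1]) b"
    unfolding eigenframe_def using X l E Eb by (auto simp: nth_append less_Suc_eq_le simp del: upt_Suc)
  then show ?thesis by blast
qed

text \<open>
  \<open>E\<^sub>i Y E\<^sub>j\<close> maps \<open>b j\<close> to the \<open>i\<close>-th component of \<open>Y (b j)\<close> and kills the other \<open>b l\<close>; so the conditions that
  define a TH system say that \<open>A\<^sup>*\<close> is upper Hessenberg with nonzero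
  subdiagonal in the eigenframe of \<open>A\<close>, and vice versa.
\<close>

lemma sandwich_zero_iff:
  assumes e: "eigenframe X Es t b" and Y: "Y \<in> End" and i: "i \<le> d" and j: "j \<le> d"
  shows "Es ! i \<otimes>\<^bsub>End_alg V\<^esub> Y \<otimes>\<^bsub>End_alg V\<^esub> Es ! j = \<zero>\<^bsub>End_alg V\<^esub> \<longleftrightarrow> coord b (Y (b j)) i = 0"
proof -
  have b: "frame b" and Ei: "Es ! i \<in> End" and Ej: "Es ! j \<in> End"
    using e i j by (auto simp: eigenframe_def)
  have *: "(Es ! i \<otimes>\<^bsub>End_alg V\<^esub> Y \<otimes>\<^bsub>End_alg V\<^esub> Es ! j) x
      = (coord b x j * coord b (Y (b j)) i) \<odot>\<^bsub>V\<^esub> b i" if x: "x \<in> carrier V" for x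
  proof -
    have "(Es ! i \<otimes>\<^bsub>End_alg V\<^esub> Y \<otimes>\<^bsub>End_alg V\<^esub> Es ! j) x = (Es ! i) (Y ((Es ! j) x))"
      using x Ej by simp
    also have "\<dots> = (Es ! i) (coord b x j \<odot>\<^bsub>V\<^esub> Y (b j))"
      using b j Y by (simp add: eigenframe_proj[OF e j x] End_smult)
    also have "\<dots> = (coord b x j * coord b (Y (b j)) i) \<odot>\<^bsub>V\<^esub> b i"
      using b j Y by (simp add: eigenframe_proj[OF e i])
    finally show ?thesis .
  qed
  show ?thesis
  proof
    assume "Es ! i \<otimes>\<^bsub>End_alg V\<^esub> Y \<otimes>\<^bsub>End_alg V\<^esub> Es ! j = \<zero>\<^bsub>End_alg V\<^esub>"
    then have "coord b (Y (b j)) i \<odot>\<^bsub>V\<^esub> b i = \<zero>\<^bsub>V\<^esub>"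
      using *[OF frame_in[OF b j]] b j by (simp add: coord_basis)
    then show "coord b (Y (b j)) i = 0" using smult_eq_zero frame_in[OF b i] frame_nonzero[OF b i] by blast
  next
    assume "coord b (Y (b j)) i = 0"
    then show "Es ! i \<otimes>\<^bsub>End_alg V\<^esub> Y \<otimes>\<^bsub>End_alg V\<^esub> Es ! j = \<zero>\<^bsub>End_alg V\<^esub>"
      using * b i Y Ei Ej by (intro End_ext) simp_all
  qed
qed

definition th_frames :: "('k, 'v) th_system \<Rightarrow> 'k list \<Rightarrow> 'k list \<Rightarrow> (nat \<Rightarrow> 'v) \<Rightarrow> (nat \<Rightarrow> 'v) \<Rightarrow> bool" where
  "th_frames \<Phi> t ts v w \<longleftrightarrow> th_space \<Phi> = V \<and>
     eigenframe (th_A \<Phi>) (th_E \<Phi>) t v \<and> eigenframe (th_A_star \<Phi>) (th_E_star \<Phi>) ts w"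

lemma th_frames_eigenvalues:
  assumes "th_frames \<Phi> t ts v w"
  shows "eigenvalue_seq \<Phi> = t" "dual_eigenvalue_seq \<Phi> = ts"
  using assms eigenframe_eigenvalues
  unfolding th_frames_def eigenvalue_seq_def dual_eigenvalue_seq_def by auto

lemma th_systems_iff_hessenberg:
  assumes f: "th_frames \<Phi> t ts v w"
  shows "\<Phi> \<in> th_systems d \<longleftrightarrow> 
    hessenberg d (\<lambda>i j. coord v (th_A_star \<Phi> (v j)) i) \<and>
    hessenberg d (\<lambda>i j. coord w (th_A \<Phi> (w j)) i)"
proof -
  have e: "eigenframe (th_A \<Phi>) (th_E \<Phi>) t v" and es: "eigenframe (th_A_star \<Phi>) (th_E_star \<Phi>) ts w"
    and V: "th_space \<Phi> = V"
    using f by (auto simp: th_frames_def)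
  have A: "th_A \<Phi> \<in> End" "th_A_star \<Phi> \<in> End" using e es by (auto simp: eigenframe_def)
  note facts = space eigenframe_imp[OF e] eigenframe_imp[OF es]
  have "\<Phi> \<in> th_systems d \<longleftrightarrow> (\<forall>i\<le>d. \<forall>j\<le>d.
      (i > j + 1 \<longrightarrow> coord v (th_A_star \<Phi> (v j)) i = 0 \<and> coord w (th_A \<Phi> (w j)) i = 0) \<and>
      (i = j + 1 \<longrightarrow> coord v (th_A_star \<Phi> (v j)) i \<noteq> 0 \<and> coord w (th_A \<Phi> (w j)) i \<noteq> 0))"
    unfolding th_systems_def Let_def V mem_Collect_eq
    by (simp only: facts simp_thms sandwich_zero_iff[OF e A(2)] sandwich_zero_iff[OF es A(1)] cong: imp_cong)
  then show ?thesis unfolding hessenberg_def by blast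
qed

lemma th_frames_exists:
  assumes "\<Phi> \<in> th_systems d" "th_space \<Phi> = V"
  shows "\<exists>t ts v w. th_frames \<Phi> t ts v w"
proof -
  have "multiplicity_free V (th_A \<Phi>)" "prim_idem_ordering d V (th_A \<Phi>) (th_E \<Phi>)"
    "multiplicity_free V (th_A_star \<Phi>)" "prim_idem_ordering d V (th_A_star \<Phi>) (th_E_star \<Phi>)"
    using assms(1) unfolding th_systems_def Let_def mem_Collect_eq assms(2) by simp_all
  then show ?thesis using eigenframe_exists assms(2) unfolding th_frames_def by meson
qed

text \<open>
  The vectors of an eigenframe may be scaled independently of each other without changing the
  eigenvalues and the idempotents. This freedom is used to normalize the transition matrix.
\<close>

lemma eigenframe_rescale:
  assumes e: "eigenframe X Es t b" and c: "\<And>k. k \<le> d \<Longrightarrow> c k \<noteq> 0"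
  shows "eigenframe X Es t (\<lambda>k. c k \<odot>\<^bsub>V\<^esub> b k)"
    and "x \<in> carrier V \<Longrightarrow> k \<le> d \<Longrightarrow> coord (\<lambda>k. c k \<odot>\<^bsub>V\<^esub> b k) x k = coord b x k / c k"
proof -
  have b: "frame b" and X: "X \<in> End" using e by (auto simp: eigenframe_def)
  let ?b = "\<lambda>k. c k \<odot>\<^bsub>V\<^esub> b k"
  have fam: "family ?b" using b by simp
  have lcb: "lc ?b a = lc b (\<lambda>k. a k * c k)" for a
    unfolding lc_def using b by (intro finsum_cong') (auto simp: smult_smult)
  have fr: "frame ?b"
  proof (rule frame_of_independent[OF fam], intro allI impI)
    fix a i assume z: "lc ?b a = \<zero>\<^bsub>V\<^esub>" and i: "i \<le> d"
    have "coord b (lc b (\<lambda>k. a k * c k)) i = 0" using z b by (simp add: lcb)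
    then show "a i = 0" using b i c[OF i] by simp
  qed
  show "eigenframe X Es t ?b"
    using e fr c by (auto simp: eigenframe_def End_smult smult_smult mult.commute)
  show "coord ?b x k = coord b x k / c k" if x: "x \<in> carrier V" and k: "k \<le> d"
  proof -
    have "lc b (\<lambda>k. coord ?b x k * c k) = x" using lc_coord[OF fr x] lcb by simp
    then have "coord b x k = coord b (lc b (\<lambda>k. coord ?b x k * c k)) k" by simp
    then have "coord b x k = coord ?b x k * c k" using k by (simp add: coord_lc[OF b])
    then show ?thesis using c[OF k] by simp
  qed
qed

lemma sum_space_eigenframe:
  assumes e: "eigenframe X Es t b" and n: "n \<le> d"
  shows "sum_space V (\<lambda>h. (Es ! h) ` carrier V) n = {x \<in> carrier V. \<forall>k>n. coord b x k = 0}"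
proof -
  have b: "frame b" using e by (simp add: eigenframe_def)
  show ?thesis
  proof (intro equalityI subsetI)
    fix x assume "x \<in> sum_space V (\<lambda>h. (Es ! h) ` carrier V) n"
    then obtain w where x: "x = finsum V w {..n}" and w: "\<forall>h\<le>n. w h \<in> (Es ! h) ` carrier V"
      unfolding sum_space_def by blast
    have wh: "w h \<in> carrier V \<and> (\<forall>k. k \<noteq> h \<longrightarrow> coord b (w h) k = 0)" if h: "h \<le> n" for h
    proof -
      obtain y where y: "y \<in> carrier V" "w h = (Es ! h) y" using w h by blast
      have hd: "h \<le> d" using h n by simp
      show ?thesis using y(2) frame_in[OF b hd]
        by (simp add: eigenframe_proj[OF e hd y(1)] coord_smult[OF b] coord_basis[OF b hd])
    qed
    have "coord b x k = 0" if "k > n" for k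
    proof -
      have "coord b x k = (\<Sum>h\<in>{..n}. coord b (w h) k)"
        unfolding x using wh by (intro coord_finsum[OF b]) simp
      also have "\<dots> = 0" using wh that by (intro sum.neutral) auto
      finally show ?thesis .
    qed
    moreover have "x \<in> carrier V" unfolding x using wh by (intro finsum_closed) auto
    ultimately show "x \<in> {x \<in> carrier V. \<forall>k>n. coord b x k = 0}" by blast
  next
    fix x assume "x \<in> {x \<in> carrier V. \<forall>k>n. coord b x k = 0}"
    then have xV: "x \<in> carrier V" and x0: "\<forall>k>n. coord b x k = 0" by auto
    define w where "w h = (Es ! h) x" for h
    have w: "w h = coord b x h \<odot>\<^bsub>V\<^esub> b h" if "h \<le> d" for h
      unfolding w_def by (rule eigenframe_proj[OF e that xV])
    have wV: "w h \<in> carrier V" if "h \<le> d" for h using w[OF that] frame_in[OF b that] by simp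
    have "finsum V w {..n} = x"
    proof (rule coord_eqI[OF b _ xV])
      show "finsum V w {..n} \<in> carrier V" using wV n by (intro finsum_closed) auto
      fix k assume k: "k \<le> d"
      have "coord b (finsum V w {..n}) k = (\<Sum>h\<in>{..n}. coord b (w h) k)"
        using wV n by (intro coord_finsum[OF b]) simp
      also have "\<dots> = (\<Sum>h\<in>{..n}. if h = k then coord b x k else 0)"
        using w n b by (intro sum.cong) (auto simp: coord_basis)
      also have "\<dots> = coord b x k" using x0 by simp
      finally show "coord b (finsum V w {..n}) k = coord b x k" .
    qed
    moreover have "\<forall>h\<le>n. w h \<in> (Es ! h) ` carrier V" using xV unfolding w_def by blast
    ultimately show "x \<in> sum_space V (\<lambda>h. (Es ! h) ` carrier V) n"
      unfolding sum_space_def by blast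
  qed
qed

lemma End_minus_app:
  assumes X: "X \<in> End" and x: "x \<in> carrier V"
  shows "(X \<ominus>\<^bsub>End_alg V\<^esub> a \<odot>\<^bsub>End_alg V\<^esub> \<one>\<^bsub>End_alg V\<^esub>) x = X x \<oplus>\<^bsub>V\<^esub> (- a) \<odot>\<^bsub>V\<^esub> x"
proof -
  let ?Y = "a \<odot>\<^bsub>End_alg V\<^esub> \<one>\<^bsub>End_alg V\<^esub>"
  let ?Z = "(- a) \<odot>\<^bsub>End_alg V\<^esub> \<one>\<^bsub>End_alg V\<^esub>"
  have Y: "?Y \<in> End" and Z: "?Z \<in> End" by simp_all
  have cancel: "a \<odot>\<^bsub>V\<^esub> y \<oplus>\<^bsub>V\<^esub> (- a) \<odot>\<^bsub>V\<^esub> y = \<zero>\<^bsub>V\<^esub>" if "y \<in> carrier V" for y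
    using that by (simp flip: smult_add_left)
  have "\<ominus>\<^bsub>End_alg V\<^esub> ?Y = ?Z"
    unfolding a_inv_def m_inv_def
  proof (rule the_equality)
    show "?Z \<in> carrier (add_monoid (End_alg V)) \<and>
        ?Y \<otimes>\<^bsub>add_monoid (End_alg V)\<^esub> ?Z = \<one>\<^bsub>add_monoid (End_alg V)\<^esub> \<and>
        ?Z \<otimes>\<^bsub>add_monoid (End_alg V)\<^esub> ?Y = \<one>\<^bsub>add_monoid (End_alg V)\<^esub>"
      using cancel by (auto intro!: End_ext simp: a_comm)
    fix Z' assume "Z' \<in> carrier (add_monoid (End_alg V)) \<and>
        ?Y \<otimes>\<^bsub>add_monoid (End_alg V)\<^esub> Z' = \<one>\<^bsub>add_monoid (End_alg V)\<^esub> \<and>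
        Z' \<otimes>\<^bsub>add_monoid (End_alg V)\<^esub> ?Y = \<one>\<^bsub>add_monoid (End_alg V)\<^esub>"
    then have Z': "Z' \<in> End" and eq: "?Y \<oplus>\<^bsub>End_alg V\<^esub> Z' = \<zero>\<^bsub>End_alg V\<^esub>" by simp_all
    show "Z' = ?Z"
    proof (rule End_ext[OF Z' Z])
      fix y assume y: "y \<in> carrier V"
      have "a \<odot>\<^bsub>V\<^esub> y \<oplus>\<^bsub>V\<^esub> Z' y = (?Y \<oplus>\<^bsub>End_alg V\<^esub> Z') y" using y by simp
      also have "\<dots> = a \<odot>\<^bsub>V\<^esub> y \<oplus>\<^bsub>V\<^esub> (- a) \<odot>\<^bsub>V\<^esub> y" using y by (simp add: eq cancel)
      finally show "Z' y = ?Z y" using y Z' by simp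
    qed
  qed
  then show ?thesis using x by (simp add: a_minus_def)
qed

text \<open>
  An upper Hessenberg map raises the index of the last nonzero coordinate by exactly one,
  unless that index is already \<open>d\<close>.
\<close>

lemma hessenberg_step:
  assumes X: "X \<in> End" and b: "frame b" and H: "hessenberg d (\<lambda>i j. coord b (X (b j)) i)"
    and x: "x \<in> carrier V" and x0: "\<forall>h>m. coord b x h = 0"
  shows "\<forall>h>m + 1. coord b (X x) h = 0"
    and "m < d \<Longrightarrow> coord b x m \<noteq> 0 \<Longrightarrow> coord b (X x) (m + 1) \<noteq> 0"
proof -
  have H0: "coord b (X (b j)) i = 0" if "i > j + 1" "j \<le> d" "i \<le> d" for i j
    using H that unfolding hessenberg_def by blast
  have H1: "coord b (X (b j)) (j + 1) \<noteq> 0" if "j < d" for j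
    using H that unfolding hessenberg_def by (metis Suc_eq_plus1 Suc_leI less_imp_le)
  show "\<forall>h>m + 1. coord b (X x) h = 0"
  proof (intro allI impI)
    fix h assume h: "h > m + 1"
    show "coord b (X x) h = 0"
    proof (cases "h \<le> d")
      case True
      have "coord b x j * coord b (X (b j)) h = 0" if "j \<le> d" for j
        using x0 H0[of j h] h True that by (cases "j > m") auto
      then show ?thesis unfolding coord_End[OF X b x] by (intro sum.neutral) auto
    qed simp
  qed
  assume m: "m < d" and nz: "coord b x m \<noteq> 0"
  have "coord b (X x) (m + 1) = (\<Sum>j\<le>d. if j = m then coord b x m * coord b (X (b m)) (m + 1) else 0)"
    unfolding coord_End[OF X b x]
  proof (rule sum.cong)
    fix j assume "j \<in> {..d}"
    then show "coord b x j * coord b (X (b j)) (m + 1) =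
        (if j = m then coord b x m * coord b (X (b m)) (m + 1) else 0)"
      using x0 H0[of j "m + 1"] m by (cases j m rule: linorder_cases) auto
  qed simp
  then show "coord b (X x) (m + 1) \<noteq> 0" using nz H1[OF m] m by simp
qed

text \<open>
  \<open>krylov X s x n\<close> is \<open>(X - s\<^sub>n\<^sub>-\<^sub>1) \<cdots> (X - s\<^sub>0) x\<close>. In an eigenframe of \<open>X\<close> its coordinates are those of \<open>x\<close>
  multiplied by the values of a polynomial at the eigenvalues; in a frame in which \<open>X\<close> is Hessenberg
  every factor moves the last nonzero coordinate one step up. Comparing the two views is the engine
  of the arguments on the split decomposition.
\<close>

primrec krylov :: "('v \<Rightarrow> 'v) \<Rightarrow> (nat \<Rightarrow> 'k) \<Rightarrow> 'v \<Rightarrow> nat \<Rightarrow> 'v" where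
  "krylov X s x 0 = x"
| "krylov X s x (Suc n) = X (krylov X s x n) \<oplus>\<^bsub>V\<^esub> (- s n) \<odot>\<^bsub>V\<^esub> krylov X s x n"

lemma krylov_in [simp]: "X \<in> End \<Longrightarrow> x \<in> carrier V \<Longrightarrow> krylov X s x n \<in> carrier V"
  by (induct n) simp_all

lemma krylov_coord_eigen:
  assumes e: "eigenframe X Es t b" and x: "x \<in> carrier V"
  shows "coord b (krylov X s x n) k = (\<Prod>l<n. t ! k - s l) * coord b x k"
proof (induct n)
  case (Suc n)
  have b: "frame b" and X: "X \<in> End" using e by (auto simp: eigenframe_def)
  have k: "krylov X s x n \<in> carrier V" using X x by simp
  show ?case using k X
    by (simp add: eigenframe_coord[OF e k] b Suc algebra_simps)
qed simp

lemma krylov_hessenberg: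
  assumes X: "X \<in> End" and b: "frame b" and H: "hessenberg d (\<lambda>i j. coord b (X (b j)) i)"
    and x: "x \<in> carrier V" and x0: "\<forall>h>m. coord b x h = 0" and xm: "coord b x m \<noteq> 0"
  shows "m + n \<le> d \<Longrightarrow> (\<forall>h>m + n. coord b (krylov X s x n) h = 0) \<and> coord b (krylov X s x n) (m + n) \<noteq> 0"
proof (induct n)
  case 0
  then show ?case using x0 xm by simp
next
  case (Suc n)
  let ?y = "krylov X s x n"
  have y: "?y \<in> carrier V" using X x by simp
  have IH: "\<forall>h>m + n. coord b ?y h = 0" "coord b ?y (m + n) \<noteq> 0" using Suc by simp_all
  note st = hessenberg_step[OF X b H y IH(1)]
  have "coord b (krylov X s x (Suc n)) h = coord b (X ?y) h" if "h > m + n" for h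
    using y X IH(1) that by (simp add: b)
  then show ?case using st IH(2) Suc.prems by auto
qed

end

section \<open>The split decomposition\<close>

locale th_framed = kspace V d for V :: "('k::field, 'v) module" and d +
  fixes \<Phi> :: "('k, 'v) th_system" and t ts :: "'k list" and v w :: "nat \<Rightarrow> 'v"
  assumes th_frames: "th_frames \<Phi> t ts v w" and th: "\<Phi> \<in> th_systems d"
begin

abbreviation "A \<equiv> th_A \<Phi>"
abbreviation "As \<equiv> th_A_star \<Phi>"

lemma eA: "eigenframe A (th_E \<Phi>) t v" and eAs: "eigenframe As (th_E_star \<Phi>) ts w"
  and space_eq: "th_space \<Phi> = V"
  using th_frames by (auto simp: th_frames_def)

lemma fv: "frame v" and fw: "frame w" and A: "A \<in> End" and As: "As \<in> End"
  using eA eAs by (auto simp: eigenframe_def)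

lemma HA: "hessenberg d (\<lambda>i j. coord w (A (w j)) i)"
  and HAs: "hessenberg d (\<lambda>i j. coord v (As (v j)) i)"
  using th_systems_iff_hessenberg[OF th_frames] th by blast+

lemma t_inj: "i \<le> d \<Longrightarrow> j \<le> d \<Longrightarrow> t ! i = t ! j \<longleftrightarrow> i = j"
  using eA by (simp add: eigenframe_def nth_eq_iff_index_eq)

lemma ts_inj: "i \<le> d \<Longrightarrow> j \<le> d \<Longrightarrow> ts ! i = ts ! j \<longleftrightarrow> i = j"
  using eAs by (simp add: eigenframe_def nth_eq_iff_index_eq)

lemma w_in: "j \<le> d \<Longrightarrow> w j \<in> carrier V" using fw by simp

text \<open>
  If the component of \<open>w\<^sub>0\<close> along \<open>v\<^sub>k\<close> vanished, then \<open>w\<^sub>0\<close> would be killed by the \<open>d\<close> factors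
  \<open>A - \<theta>\<^sub>i\<close> with \<open>i \<noteq> k\<close>. But \<open>d\<close> factors move \<open>w\<^sub>0\<close> to a vector with nonzero component along \<open>w\<^sub>d\<close>.
\<close>

lemma coord_v_w0: assumes k: "k \<le> d" shows "coord v (w 0) k \<noteq> 0"
proof
  assume z: "coord v (w 0) k = 0"
  \<comment> \<open>The eigenvalues other than the one with index \<open>k\<close>, enumerated.\<close>
  define s where "s l = t ! (if l < k then l else l + 1)" for l
  have "(\<Prod>l<d. t ! i - s l) = 0" if i: "i \<le> d" "i \<noteq> k" for i
  proof -
    define l where "l = (if i < k then i else i - 1)"
    have "l < d" "s l = t ! i" using i k by (auto simp: l_def s_def)
    then show ?thesis by (intro prod_zero bexI[of _ l]) auto
  qed
  then have "coord v (krylov A s (w 0) d) i = 0" if "i \<le> d" for i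
    unfolding krylov_coord_eigen[OF eA w_in[of 0, simplified]] using z that by (cases "i = k") auto
  then have "krylov A s (w 0) d = \<zero>\<^bsub>V\<^esub>"
    using fv A w_in by (intro coord_eqI[OF fv]) simp_all
  moreover have "coord w (krylov A s (w 0) d) (0 + d) \<noteq> 0"
    using krylov_hessenberg[OF A fw HA w_in, of 0 0 d s] by (simp add: coord_basis fw)
  ultimately show False using fw by simp
qed

end

text \<open>
  The eigenframe of \<open>A\<close> is now scaled so that \<open>w\<^sub>0\<close> is the sum of its vectors, which is possible
  because no component of \<open>w\<^sub>0\<close> vanishes.
\<close>

locale th_normalized = th_framed V d \<Phi> t ts v w
  for V :: "('k::field, 'v) module" and d and \<Phi> and t ts :: "'k list" and v w :: "nat \<Rightarrow> 'v" +
  assumes norm: "\<And>k. k \<le> d \<Longrightarrow> coord v (w 0) k = 1"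
begin

text \<open>
  The vectors \<open>u i\<close> span the split decomposition: \<open>u i\<close> lies in the sum of the first \<open>i + 1\<close>
  eigenspaces of \<open>A\<^sup>*\<close> by the Hessenberg shape of \<open>A\<close>, and the factors \<open>A - \<theta>\<^sub>d, \<dots>, A - \<theta>\<^sub>d\<^sub>-\<^sub>i\<^sub>+\<^sub>1\<close> have
  removed its components in the last \<open>i\<close> eigenspaces of \<open>A\<close>.
\<close>

definition u :: "nat \<Rightarrow> 'v" where "u i = krylov A (\<lambda>l. t ! (d - l)) (w 0) i"

lemma u_in [simp]: "u i \<in> carrier V" using A w_in by (simp add: u_def)

lemma u_Suc: "u (Suc i) = A (u i) \<oplus>\<^bsub>V\<^esub> (- t ! (d - i)) \<odot>\<^bsub>V\<^esub> u i" by (simp add: u_def)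

lemma coord_v_u: "k \<le> d \<Longrightarrow> coord v (u i) k = (\<Prod>l<i. t ! k - t ! (d - l))"
  unfolding u_def by (simp add: krylov_coord_eigen[OF eA w_in[of 0, simplified]] norm)

lemma coord_v_u_zero: "i \<le> d \<Longrightarrow> k > d - i \<Longrightarrow> coord v (u i) k = 0"
proof (cases "k \<le> d")
  case True
  assume "i \<le> d" "k > d - i"
  then have "d - k < i" "d - (d - k) = k" using True by auto
  then show ?thesis unfolding coord_v_u[OF True] by (intro prod_zero bexI[of _ "d - k"]) auto
qed simp

lemma coord_v_u_nz: "i \<le> d \<Longrightarrow> coord v (u i) (d - i) \<noteq> 0"
  by (subst coord_v_u) (auto simp: t_inj)

lemma coord_w_u: assumes "i \<le> d" shows "\<forall>h>i. coord w (u i) h = 0" "coord w (u i) i \<noteq> 0"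
  using krylov_hessenberg[OF A fw HA w_in, of 0 0 i "\<lambda>l. t ! (d - l)"] assms
  by (simp_all add: coord_basis fw u_def)

text \<open>
  The sum of the first \<open>i\<close> eigenspaces of \<open>A\<^sup>*\<close> meets the sum of the first \<open>d - i + 1\<close> eigenspaces of
  \<open>A\<close> trivially. A vector in the second space is killed by \<open>d - i + 1\<close> factors \<open>A - \<theta>\<^sub>l\<close>; but these
  factors carry a nonzero vector with last coordinate \<open>m < i\<close> to one with last coordinate
  \<open>m + (d - i + 1) \<le> d\<close>, which is not zero.
\<close>

lemma split_intersection_zero:
  assumes i: "i \<le> d" and y: "y \<in> carrier V"
    and yw: "\<forall>h\<ge>i. coord w y h = 0" and yv: "\<forall>k>d - i. coord v y k = 0"
  shows "y = \<zero>\<^bsub>V\<^esub>"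
proof (rule ccontr)
  assume "y \<noteq> \<zero>\<^bsub>V\<^esub>"
  then obtain h0 where h0: "coord w y h0 \<noteq> 0" using coord_nonzero_ex[OF fw y] by blast
  define m where "m = Max {h. coord w y h \<noteq> 0}"
  have sub: "{h. coord w y h \<noteq> 0} \<subseteq> {..<i}" using yw not_less by auto
  then have fin: "finite {h. coord w y h \<noteq> 0}" using finite_subset by blast
  have m: "coord w y m \<noteq> 0" using Max_in[OF fin] h0 unfolding m_def by blast
  have mi: "m < i" using m sub by auto
  have above: "\<forall>h>m. coord w y h = 0" using Max_ge[OF fin] unfolding m_def by (auto simp: not_less[symmetric])
  define n where "n = d - i + 1"
  have "m + n \<le> d" using mi i unfolding n_def by simp
  then have "coord w (krylov A (\<lambda>l. t ! l) y n) (m + n) \<noteq> 0"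
    using krylov_hessenberg[OF A fw HA y above m] by blast
  moreover have "krylov A (\<lambda>l. t ! l) y n = \<zero>\<^bsub>V\<^esub>"
  proof (rule coord_eqI[OF fv])
    fix k assume "k \<le> d"
    have "(\<Prod>l<n. t ! k - t ! l) = 0" if "k < n" using that by (intro prod_zero) auto
    moreover have "coord v y k = 0" if "\<not> k < n" using that yv unfolding n_def by auto
    ultimately show "coord v (krylov A (\<lambda>l. t ! l) y n) k = coord v \<zero>\<^bsub>V\<^esub> k"
      unfolding krylov_coord_eigen[OF eA y] coord_zero[OF fv] by (cases "k < n") simp_all
  qed (use A y in simp_all)
  ultimately show False by (simp add: fw)
qed

text \<open>
  Subtracting the multiple of \<open>u i\<close> with the same component along \<open>w i\<close> puts a vector of the
  \<open>i\<close>-th split space into the trivial intersection above; so the split space is a line.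
\<close>

lemma split_line:
  assumes i: "i \<le> d" and x: "x \<in> carrier V"
    and xw: "\<forall>h>i. coord w x h = 0" and xv: "\<forall>k>d - i. coord v x k = 0"
  shows "\<exists>c. x = c \<odot>\<^bsub>V\<^esub> u i"
proof -
  define c where "c = coord w x i / coord w (u i) i"
  define y where "y = x \<oplus>\<^bsub>V\<^esub> (- c) \<odot>\<^bsub>V\<^esub> u i"
  have "y = \<zero>\<^bsub>V\<^esub>"
  proof (rule split_intersection_zero[OF i])
    show "y \<in> carrier V" using x by (simp add: y_def)
    show "\<forall>h\<ge>i. coord w y h = 0"
      using xw coord_w_u[OF i] x by (auto simp: y_def fw c_def le_less)
    show "\<forall>k>d - i. coord v y k = 0"
      using xv coord_v_u_zero[OF i] x by (auto simp: y_def fv)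
  qed
  then have "x = y \<oplus>\<^bsub>V\<^esub> c \<odot>\<^bsub>V\<^esub> u i \<Longrightarrow> x = c \<odot>\<^bsub>V\<^esub> u i" by simp
  moreover have "x = y \<oplus>\<^bsub>V\<^esub> c \<odot>\<^bsub>V\<^esub> u i"
    using x unfolding y_def by (intro coord_eqI[OF fv]) (simp_all add: fv)
  ultimately show ?thesis by blast
qed

text \<open>
  \<open>A\<^sup>* - \<theta>\<^sup>*\<^sub>i\<close> removes the last component of \<open>u i\<close> in the eigenframe of \<open>A\<^sup>*\<close>, and by the Hessenberg shape of
  \<open>A\<^sup>*\<close> it adds exactly one component in the eigenframe of \<open>A\<close>. So the result lies in the preceding
  split line, and the new component shows that it is not zero.
\<close>

lemma split_lowering:
  assumes i: "Suc i \<le> d"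
  shows "\<exists>c. c \<noteq> 0 \<and> As (u (Suc i)) \<oplus>\<^bsub>V\<^esub> (- ts ! Suc i) \<odot>\<^bsub>V\<^esub> u (Suc i) = c \<odot>\<^bsub>V\<^esub> u i"
proof -
  let ?x = "As (u (Suc i)) \<oplus>\<^bsub>V\<^esub> (- ts ! Suc i) \<odot>\<^bsub>V\<^esub> u (Suc i)"
  have x: "?x \<in> carrier V" using As by simp
  have u0: "\<forall>k>d - Suc i. coord v (u (Suc i)) k = 0" using coord_v_u_zero[OF i] by blast
  have dd: "d - Suc i < d" "d - Suc i + 1 = d - i" using i by auto
  note st = hessenberg_step[OF As fv HAs u_in u0, unfolded dd(2)]
  have xw: "\<forall>h>i. coord w ?x h = 0"
  proof (intro allI impI)
    fix h assume "h > i"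
    then show "coord w ?x h = 0"
      using coord_w_u(1)[OF i] As by (cases "h = Suc i") (simp_all add: fw eigenframe_coord[OF eAs])
  qed
  have xv: "\<forall>k>d - i. coord v ?x k = 0" using st(1) u0 As by (simp add: fv)
  obtain c where c: "?x = c \<odot>\<^bsub>V\<^esub> u i" using split_line[OF _ x xw xv] i by auto
  have "coord v ?x (d - i) \<noteq> 0"
    using st(2)[OF dd(1) coord_v_u_nz[OF i]] u0 dd As i by (simp add: fv)
  then have "c \<noteq> 0" unfolding c by (auto simp: fv)
  with c show ?thesis by blast
qed

text \<open>
  The factor is defined by the lowering relation; it is identified with \<^const>\<open>split_seq\<close> once the
  split spaces are known to be the lines through the \<open>u i\<close>.
\<close>

definition \<phi> :: "nat \<Rightarrow> 'k" where
  "\<phi> i = (SOME c. c \<noteq> 0 \<and> As (u i) \<oplus>\<^bsub>V\<^esub> (- ts ! i) \<odot>\<^bsub>V\<^esub> u i = c \<odot>\<^bsub>V\<^esub> u (i - 1))"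

lemma phi: assumes "1 \<le> i" "i \<le> d"
  shows "\<phi> i \<noteq> 0" "As (u i) \<oplus>\<^bsub>V\<^esub> (- ts ! i) \<odot>\<^bsub>V\<^esub> u i = \<phi> i \<odot>\<^bsub>V\<^esub> u (i - 1)"
proof -
  obtain j where j: "i = Suc j" using assms(1) by (cases i) auto
  have "\<exists>c. c \<noteq> 0 \<and> As (u i) \<oplus>\<^bsub>V\<^esub> (- ts ! i) \<odot>\<^bsub>V\<^esub> u i = c \<odot>\<^bsub>V\<^esub> u (i - 1)"
    using split_lowering[of j] assms(2) j by simp
  from someI_ex[OF this, folded \<phi>_def]
  show "\<phi> i \<noteq> 0" "As (u i) \<oplus>\<^bsub>V\<^esub> (- ts ! i) \<odot>\<^bsub>V\<^esub> u i = \<phi> i \<odot>\<^bsub>V\<^esub> u (i - 1)" by auto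
qed

lemma split_space_line:
  assumes i: "i \<le> d" shows "split_space d \<Phi> i = {c \<odot>\<^bsub>V\<^esub> u i | c. True}"
proof -
  have "split_space d \<Phi> i = {x \<in> carrier V. \<forall>h>i. coord w x h = 0} \<inter> {x \<in> carrier V. \<forall>k>d - i. coord v x k = 0}"
    unfolding split_space_def Let_def space_eq
    using sum_space_eigenframe[OF eAs i] sum_space_eigenframe[OF eA, of "d - i"] by simp
  also have "\<dots> = {c \<odot>\<^bsub>V\<^esub> u i | c. True}"
  proof (intro equalityI subsetI)
    fix x assume "x \<in> {x \<in> carrier V. \<forall>h>i. coord w x h = 0} \<inter> {x \<in> carrier V. \<forall>k>d - i. coord v x k = 0}"
    then show "x \<in> {c \<odot>\<^bsub>V\<^esub> u i | c. True}" using split_line[OF i, of x] by auto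
  next
    fix x assume "x \<in> {c \<odot>\<^bsub>V\<^esub> u i | c. True}"
    then show "x \<in> {x \<in> carrier V. \<forall>h>i. coord w x h = 0} \<inter> {x \<in> carrier V. \<forall>k>d - i. coord v x k = 0}"
      using coord_w_u(1)[OF i] coord_v_u_zero[OF i] by (auto simp: fv fw)
  qed
  finally show ?thesis .
qed

lemma split_seq_eq:
  assumes i: "1 \<le> i" "i \<le> d" shows "split_seq d \<Phi> i = \<phi> i"
proof -
  let ?T = "(A \<ominus>\<^bsub>End_alg V\<^esub> t ! (d - i + 1) \<odot>\<^bsub>End_alg V\<^esub> \<one>\<^bsub>End_alg V\<^esub>) \<otimes>\<^bsub>End_alg V\<^esub>
        (As \<ominus>\<^bsub>End_alg V\<^esub> ts ! i \<odot>\<^bsub>End_alg V\<^esub> \<one>\<^bsub>End_alg V\<^esub>)"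
  have di: "d - i + 1 = d - (i - 1)" "Suc (i - 1) = i" using i by auto
  have Tu: "?T (c \<odot>\<^bsub>V\<^esub> u i) = (c * \<phi> i) \<odot>\<^bsub>V\<^esub> u i" for c
  proof -
    have "?T (c \<odot>\<^bsub>V\<^esub> u i) = (A \<ominus>\<^bsub>End_alg V\<^esub> t ! (d - i + 1) \<odot>\<^bsub>End_alg V\<^esub> \<one>\<^bsub>End_alg V\<^esub>)
        (As (c \<odot>\<^bsub>V\<^esub> u i) \<oplus>\<^bsub>V\<^esub> (- ts ! i) \<odot>\<^bsub>V\<^esub> (c \<odot>\<^bsub>V\<^esub> u i))"
      by (simp add: End_minus_app[OF As])
    also have "As (c \<odot>\<^bsub>V\<^esub> u i) \<oplus>\<^bsub>V\<^esub> (- ts ! i) \<odot>\<^bsub>V\<^esub> (c \<odot>\<^bsub>V\<^esub> u i)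
        = c \<odot>\<^bsub>V\<^esub> (As (u i) \<oplus>\<^bsub>V\<^esub> (- ts ! i) \<odot>\<^bsub>V\<^esub> u i)"
      using As by (simp add: End_smult smult_add_right smult_smult mult.commute)
    also have "\<dots> = (c * \<phi> i) \<odot>\<^bsub>V\<^esub> u (i - 1)" using i by (simp add: phi smult_smult)
    also have "(A \<ominus>\<^bsub>End_alg V\<^esub> t ! (d - i + 1) \<odot>\<^bsub>End_alg V\<^esub> \<one>\<^bsub>End_alg V\<^esub>) \<dots>
        = A ((c * \<phi> i) \<odot>\<^bsub>V\<^esub> u (i - 1)) \<oplus>\<^bsub>V\<^esub> (- t ! (d - i + 1)) \<odot>\<^bsub>V\<^esub> ((c * \<phi> i) \<odot>\<^bsub>V\<^esub> u (i - 1))"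
      by (simp add: End_minus_app[OF A])
    also have "\<dots> = (c * \<phi> i) \<odot>\<^bsub>V\<^esub> (A (u (i - 1)) \<oplus>\<^bsub>V\<^esub> (- t ! (d - i + 1)) \<odot>\<^bsub>V\<^esub> u (i - 1))"
      using A by (simp add: End_smult smult_add_right smult_smult mult.commute)
    also have "A (u (i - 1)) \<oplus>\<^bsub>V\<^esub> (- t ! (d - i + 1)) \<odot>\<^bsub>V\<^esub> u (i - 1) = u i"
      using u_Suc[of "i - 1"] unfolding di by simp
    finally show ?thesis .
  qed
  have ev: "eigenvalue_seq \<Phi> = t" "dual_eigenvalue_seq \<Phi> = ts"
    using th_frames_eigenvalues[OF th_frames] by auto
  have "split_seq d \<Phi> i = (THE c. \<forall>x\<in>split_space d \<Phi> i. ?T x = c \<odot>\<^bsub>V\<^esub> x)"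
    unfolding split_seq_def Let_def space_eq ev ..
  also have "\<dots> = \<phi> i"
  proof (rule the_equality)
    show "\<forall>x\<in>split_space d \<Phi> i. ?T x = \<phi> i \<odot>\<^bsub>V\<^esub> x"
    proof
      fix x assume "x \<in> split_space d \<Phi> i"
      then obtain c where "x = c \<odot>\<^bsub>V\<^esub> u i" using split_space_line[OF i(2)] by auto
      then show "?T x = \<phi> i \<odot>\<^bsub>V\<^esub> x" using Tu[of c] by (simp add: smult_smult mult.commute)
    qed
    fix c assume c: "\<forall>x\<in>split_space d \<Phi> i. ?T x = c \<odot>\<^bsub>V\<^esub> x"
    have "1 \<odot>\<^bsub>V\<^esub> u i \<in> split_space d \<Phi> i" using split_space_line[OF i(2)] by blast
    then have "?T (1 \<odot>\<^bsub>V\<^esub> u i) = c \<odot>\<^bsub>V\<^esub> (1 \<odot>\<^bsub>V\<^esub> u i)" using c by blast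
    then have "\<phi> i \<odot>\<^bsub>V\<^esub> u i = c \<odot>\<^bsub>V\<^esub> u i" unfolding Tu by simp
    then have "coord w (\<phi> i \<odot>\<^bsub>V\<^esub> u i) i = coord w (c \<odot>\<^bsub>V\<^esub> u i) i" by simp
    then show "c = \<phi> i" using coord_w_u(2)[OF i(2)] by (simp add: fw)
  qed
  finally show ?thesis .
qed

definition coef :: "nat \<Rightarrow> nat \<Rightarrow> 'k" where
  "coef j h = (\<Prod>l<h. ts ! j - ts ! l) / (\<Prod>l=1..h. \<phi> l)"

lemma coef_Suc: "Suc h \<le> d \<Longrightarrow> coef j (Suc h) * \<phi> (Suc h) = coef j h * (ts ! j - ts ! h)"
  using phi(1)[of "Suc h"] by (simp add: coef_def)

lemma As_u: "i \<le> d \<Longrightarrow>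
    coord b (As (u i)) k = ts ! i * coord b (u i) k + (if i = 0 then 0 else \<phi> i * coord b (u (i - 1)) k)"
  if b: "frame b"
proof (cases i)
  case 0
  have "As (u 0) = ts ! 0 \<odot>\<^bsub>V\<^esub> u 0"
    using eAs by (simp add: u_def eigenframe_def)
  then show ?thesis using 0 by (simp add: b)
next
  case (Suc n)
  assume i: "i \<le> d"
  have "coord b (As (u i)) k - ts ! i * coord b (u i) k = coord b (As (u i) \<oplus>\<^bsub>V\<^esub> (- ts ! i) \<odot>\<^bsub>V\<^esub> u i) k"
    using As by (simp add: b)
  also have "\<dots> = \<phi> i * coord b (u (i - 1)) k" using phi(2)[of i] i Suc by (simp add: b)
  finally show ?thesis using Suc by (simp add: algebra_simps)
qed

text \<open>
  With \<open>A\<^sup>* u\<^sub>h = \<theta>\<^sup>*\<^sub>h u\<^sub>h + \<phi>\<^sub>h u\<^sub>h\<^sub>-\<^sub>1\<close> the coefficients of an eigenvector for \<open>\<theta>\<^sup>*\<^sub>j\<close> satisfy the two-term recurrence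
  \<open>c\<^sub>h\<^sub>+\<^sub>1 \<phi>\<^sub>h\<^sub>+\<^sub>1 = c\<^sub>h (\<theta>\<^sup>*\<^sub>j - \<theta>\<^sup>*\<^sub>h)\<close>, which is solved by \<open>coef j\<close>. The sum over \<open>h\<close> telescopes, and the boundary
  term at \<open>h = d\<close> vanishes because \<open>\<theta>\<^sup>*\<^sub>j\<close> is one of \<open>\<theta>\<^sup>*\<^sub>0, \<dots>, \<theta>\<^sup>*\<^sub>d\<close>.
\<close>

lemma dual_eigenvector:
  assumes j: "j \<le> d" shows "As (lc u (coef j)) = ts ! j \<odot>\<^bsub>V\<^esub> lc u (coef j)"
proof (rule coord_eqI[OF fw])
  have fam: "family u" by simp
  show "As (lc u (coef j)) \<in> carrier V" "ts ! j \<odot>\<^bsub>V\<^esub> lc u (coef j) \<in> carrier V" using As by simp_all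
  fix k assume k: "k \<le> d"
  let ?U = "\<lambda>h. coord w (u h) k"
  have tel: "(\<Sum>h\<le>n. coef j h * (ts ! h * ?U h + (if h = 0 then 0 else \<phi> h * ?U (h - 1))))
     = (\<Sum>h\<le>n. coef j h * ts ! j * ?U h) - coef j n * (ts ! j - ts ! n) * ?U n" if "n \<le> d" for n
    using that
  proof (induct n)
    case (Suc n)
    have "coef j (Suc n) * (\<phi> (Suc n) * ?U n) = coef j n * (ts ! j - ts ! n) * ?U n"
      using coef_Suc[OF Suc.prems, of j] by (simp add: mult.assoc[symmetric])
    then have step: "coef j (Suc n) * (ts ! Suc n * ?U (Suc n) + \<phi> (Suc n) * ?U n)
        = coef j (Suc n) * ts ! Suc n * ?U (Suc n) + coef j n * (ts ! j - ts ! n) * ?U n"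
      by (simp add: distrib_left mult.assoc)
    have IH: "(\<Sum>h\<le>n. coef j h * (ts ! h * ?U h + (if h = 0 then 0 else \<phi> h * ?U (h - 1))))
        = (\<Sum>h\<le>n. coef j h * ts ! j * ?U h) - coef j n * (ts ! j - ts ! n) * ?U n"
      using Suc by simp
    show ?case
      unfolding sum.atMost_Suc IH using step
      by (simp add: left_diff_distrib right_diff_distrib)
  qed (simp add: algebra_simps)
  have z: "coef j d * (ts ! j - ts ! d) = 0"
  proof (cases "j = d")
    case False
    then have "(\<Prod>l<d. ts ! j - ts ! l) = 0" using j by (intro prod_zero) auto
    then show ?thesis by (simp add: coef_def)
  qed simp
  have "coord w (As (lc u (coef j))) k = (\<Sum>h\<le>d. coef j h * coord w (As (u h)) k)"
    using As by (simp add: End_lc[OF As fam] coord_lc_other[OF fw])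
  also have "\<dots> = (\<Sum>h\<le>d. coef j h * (ts ! h * ?U h + (if h = 0 then 0 else \<phi> h * ?U (h - 1))))"
    by (intro sum.cong) (auto simp: As_u[OF fw])
  also have "\<dots> = (\<Sum>h\<le>d. coef j h * ts ! j * ?U h)" using tel[of d] z by simp
  also have "\<dots> = coord w (ts ! j \<odot>\<^bsub>V\<^esub> lc u (coef j)) k"
    by (simp add: fw coord_lc_other[OF fw] sum_distrib_left algebra_simps)
  finally show "coord w (As (lc u (coef j))) k = coord w (ts ! j \<odot>\<^bsub>V\<^esub> lc u (coef j)) k" .
qed

text \<open>
  Expanding the eigenvectors \<open>lc u (coef j)\<close> of \<open>A\<^sup>*\<close> in the eigenframe of \<open>A\<close> produces exactly the defining
  sum of the transition matrix.
\<close>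

lemma transition_mat_entry:
  assumes "k \<le> d" "j \<le> d"
  shows "transition_mat d \<Phi> $$ (k, j) = coord v (lc u (coef j)) k"
    and "transition_mat d \<Phi> $$ (k, j) = (\<Sum>h\<le>d. (\<Prod>l<h. t ! k - t ! (d - l)) * (\<Prod>l<h. ts ! j - ts ! l) / (\<Prod>l=1..h. \<phi> l))"
proof -
  have ev: "eigenvalue_seq \<Phi> = t" "dual_eigenvalue_seq \<Phi> = ts"
    using th_frames_eigenvalues[OF th_frames] by auto
  have "(\<Prod>l=1..h. split_seq d \<Phi> l) = (\<Prod>l=1..h. \<phi> l)" if "h \<le> d" for h
    using that by (intro prod.cong) (auto simp: split_seq_eq)
  then show *: "transition_mat d \<Phi> $$ (k, j) = (\<Sum>h\<le>d. (\<Prod>l<h. t ! k - t ! (d - l)) * (\<Prod>l<h. ts ! j - ts ! l) / (\<Prod>l=1..h. \<phi> l))"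
    using assms unfolding transition_mat_def Let_def ev
    by (simp add: atMost_atLeast0)
  show "transition_mat d \<Phi> $$ (k, j) = coord v (lc u (coef j)) k"
    unfolding * using assms
    by (simp add: coord_lc_other[OF fv] coord_v_u coef_def mult.commute)
qed

end

section \<open>Normalized frames and the transition matrix\<close>

context kspace begin

text \<open>
  \<open>X\<close> is the transition matrix from an eigenframe of \<open>A\<close> to an eigenframe of \<open>A\<^sup>*\<close>, both scaled so that
  the first column and the last row of \<open>X\<close> consist of ones. This describes the triple
  \<^const>\<open>vsystem_of\<close> without split sequences, in a form that isomorphisms and affine
  transformations visibly respect.
\<close>

definition normalized_frames :: "('k, 'v) th_system \<Rightarrow> 'k vsystem \<Rightarrow> (nat \<Rightarrow> 'v) \<Rightarrow> (nat \<Rightarrow> 'v) \<Rightarrow> bool" where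
  "normalized_frames \<Phi> S v w \<longleftrightarrow> (case S of (X, t, ts) \<Rightarrow> th_frames \<Phi> t ts v w \<and> X \<in> carrier_mat (d + 1) (d + 1) \<and>
     (\<forall>k\<le>d. \<forall>j\<le>d. coord v (w j) k = X $$ (k, j)) \<and> (\<forall>k\<le>d. X $$ (k, 0) = 1) \<and> (\<forall>j\<le>d. X $$ (d, j) = 1))"

text \<open>
  The eigenvectors built from the split vectors are nonzero, since their coordinate along \<open>v\<^sub>d\<close> is 1,
  and so may serve as the eigenframe of \<open>A\<^sup>*\<close>.
\<close>

lemma th_system_transition:
  assumes th: "\<Phi> \<in> th_systems d" and V: "th_space \<Phi> = V"
  obtains v w \<phi> where "normalized_frames \<Phi> (vsystem_of d \<Phi>) v w"
    "\<And>i. 1 \<le> i \<Longrightarrow> i \<le> d \<Longrightarrow> \<phi> i \<noteq> 0"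
    "\<And>k j. k \<le> d \<Longrightarrow> j \<le> d \<Longrightarrow> transition_mat d \<Phi> $$ (k, j) =
      (\<Sum>h\<le>d. (\<Prod>l<h. eigenvalue_seq \<Phi> ! k - eigenvalue_seq \<Phi> ! (d - l)) *
         (\<Prod>l<h. dual_eigenvalue_seq \<Phi> ! j - dual_eigenvalue_seq \<Phi> ! l) / (\<Prod>l=1..h. \<phi> l))"
proof -
  obtain t ts v0 w where f0: "th_frames \<Phi> t ts v0 w" using th_frames_exists[OF th V] by blast
  interpret N0: th_framed V d \<Phi> t ts v0 w by unfold_locales (fact f0, fact th)
  define v where "v k = coord v0 (w 0) k \<odot>\<^bsub>V\<^esub> v0 k" for k
  have e: "eigenframe (th_A \<Phi>) (th_E \<Phi>) t v"
    unfolding v_def by (rule eigenframe_rescale(1)[OF N0.eA N0.coord_v_w0])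
  have c1: "coord v (w 0) k = 1" if "k \<le> d" for k
    unfolding v_def[abs_def] using N0.coord_v_w0[OF that] that
    by (subst eigenframe_rescale(2)[OF N0.eA N0.coord_v_w0]) (simp_all add: N0.w_in)
  have f: "th_frames \<Phi> t ts v w" using f0 e by (simp add: th_frames_def)
  interpret N: th_normalized V d \<Phi> t ts v w by unfold_locales (fact f, fact th, fact c1)
  have ev: "eigenvalue_seq \<Phi> = t" "dual_eigenvalue_seq \<Phi> = ts"
    using th_frames_eigenvalues[OF f] by auto
  let ?P = "transition_mat d \<Phi>"
  let ?w = "\<lambda>j. lc N.u (N.coef j)"
  have win: "?w j \<in> carrier V" for j by simp
  define c where "c j = coord w (?w j) j" for j
  have wc: "?w j = c j \<odot>\<^bsub>V\<^esub> w j" if j: "j \<le> d" for j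
  proof (rule coord_eqI[OF N.fw])
    fix k assume k: "k \<le> d"
    have "ts ! k * coord w (?w j) k = ts ! j * coord w (?w j) k"
      using eigenframe_coord[OF N.eAs win, of j k] N.dual_eigenvector[OF j] by (auto simp: N.fw)
    then show "coord w (?w j) k = coord w (c j \<odot>\<^bsub>V\<^esub> w j) k"
      using N.ts_inj[OF k j] N.w_in[OF j]
      by (cases "k = j") (simp_all add: c_def N.fw coord_basis j)
  qed (use N.w_in[OF j] in simp_all)
  have first: "?P $$ (k, 0) = 1" if "k \<le> d" for k
  proof -
    have "(\<Prod>l<h. ts ! 0 - ts ! l) = 0" if "h \<noteq> 0" for h
      using that by (intro prod_zero bexI[of _ 0]) auto
    then have "?P $$ (k, 0) = (\<Sum>h\<le>d. if h = 0 then 1 else 0)"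
      unfolding N.transition_mat_entry(2)[OF that le0]
      by (intro sum.cong refl) auto
    then show ?thesis by simp
  qed
  have last: "?P $$ (d, j) = 1" if "j \<le> d" for j
  proof -
    have "(\<Prod>l<h. t ! d - t ! (d - l)) = 0" if "h \<noteq> 0" for h
      using that by (intro prod_zero bexI[of _ 0]) auto
    then have "?P $$ (d, j) = (\<Sum>h\<le>d. if h = 0 then 1 else 0)"
      unfolding N.transition_mat_entry(2)[OF order_refl that]
      by (intro sum.cong refl) auto
    then show ?thesis by simp
  qed
  have c0: "c j \<noteq> 0" if j: "j \<le> d" for j
  proof
    assume "c j = 0"
    then have "?w j = \<zero>\<^bsub>V\<^esub>" using wc[OF j] N.w_in[OF j] by simp
    then have "coord v (?w j) d = 0" by (simp add: N.fv)
    then show False using N.transition_mat_entry(1)[OF order_refl j] last[OF j] by simp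
  qed
  define w' where "w' j = c j \<odot>\<^bsub>V\<^esub> w j" for j
  have es: "eigenframe (th_A_star \<Phi>) (th_E_star \<Phi>) ts w'"
    unfolding w'_def by (rule eigenframe_rescale(1)[OF N.eAs c0])
  have "coord v (w' j) k = ?P $$ (k, j)" if "k \<le> d" "j \<le> d" for j k
    using N.transition_mat_entry(1)[OF that] wc[OF that(2)] by (simp add: w'_def)
  moreover have "?P \<in> carrier_mat (d + 1) (d + 1)" by (simp add: transition_mat_def Let_def)
  ultimately have "normalized_frames \<Phi> (vsystem_of d \<Phi>) v w'"
    using first last e es V by (simp add: normalized_frames_def vsystem_of_def ev th_frames_def)
  then show ?thesis
    using that N.phi(1) N.transition_mat_entry(2) unfolding ev by blast
qed

text \<open>
  Two choices of eigenframes differ by scalars \<open>p\<^sub>k\<close> on the \<open>v\<^sub>k\<close> and \<open>q\<^sub>j\<close> on the \<open>w\<^sub>j\<close>, and then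
  \<open>X\<^sub>k\<^sub>j p\<^sub>k = q\<^sub>j X'\<^sub>k\<^sub>j\<close>. The column of ones makes all \<open>p\<^sub>k\<close> equal to \<open>q\<^sub>0\<close>, the row of ones makes
  all \<open>q\<^sub>j\<close> equal to \<open>p\<^sub>d\<close>; so all scalars agree and cancel.
\<close>

lemma normalized_frames_unique:
  assumes a: "normalized_frames \<Phi> (X, t, ts) v w" and a': "normalized_frames \<Phi> (X', t', ts') v' w'"
  shows "(X, t, ts) = (X', t', ts')"
proof -
  have f: "th_frames \<Phi> t ts v w" and f': "th_frames \<Phi> t' ts' v' w'" using a a' by (auto simp: normalized_frames_def)
  have teq: "t = t'" "ts = ts'" using th_frames_eigenvalues[OF f] th_frames_eigenvalues[OF f'] by auto
  have e: "eigenframe (th_A \<Phi>) (th_E \<Phi>) t v" "eigenframe (th_A_star \<Phi>) (th_E_star \<Phi>) ts w"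
    and e': "eigenframe (th_A \<Phi>) (th_E \<Phi>) t' v'" "eigenframe (th_A_star \<Phi>) (th_E_star \<Phi>) ts' w'"
    using f f' by (auto simp: th_frames_def)
  have fr: "frame v" "frame w" "frame v'" "frame w'" using e e' by (auto simp: eigenframe_def)
  have line: "\<exists>c. \<forall>i\<le>d. c i \<noteq> 0 \<and> b' i = c i \<odot>\<^bsub>V\<^esub> b i"
    if "eigenframe Y Es s b" "eigenframe Y Es s' b'" for Y Es s s' b b'
  proof (intro exI allI impI)
    fix i assume i: "i \<le> d"
    have fb: "frame b" "frame b'" using that by (auto simp: eigenframe_def)
    have "b' i = (Es ! i) (b' i)" using that(2) i by (simp add: eigenframe_def)
    also have "\<dots> = coord b (b' i) i \<odot>\<^bsub>V\<^esub> b i" using eigenframe_proj[OF that(1) i] fb i by simp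
    finally have eq: "b' i = coord b (b' i) i \<odot>\<^bsub>V\<^esub> b i" .
    moreover have "coord b (b' i) i \<noteq> 0"
    proof
      assume "coord b (b' i) i = 0"
      then have "b' i = \<zero>\<^bsub>V\<^esub>" using eq frame_in[OF fb(1) i] by simp
      then show False using frame_nonzero[OF fb(2) i] by simp
    qed
    ultimately show "coord b (b' i) i \<noteq> 0 \<and> b' i = coord b (b' i) i \<odot>\<^bsub>V\<^esub> b i" by blast
  qed
  obtain p where p: "\<And>i. i \<le> d \<Longrightarrow> p i \<noteq> 0 \<and> v i = p i \<odot>\<^bsub>V\<^esub> v' i"
    using line[OF e'(1) e(1)] by blast
  obtain q where q: "\<And>i. i \<le> d \<Longrightarrow> q i \<noteq> 0 \<and> w i = q i \<odot>\<^bsub>V\<^esub> w' i"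
    using line[OF e'(2) e(2)] by blast
  have rel: "X $$ (k, j) * p k = q j * X' $$ (k, j)" if k: "k \<le> d" and j: "j \<le> d" for k j
  proof -
    have w: "w j \<in> carrier V" "w' j \<in> carrier V" using fr j by simp_all
    have "X $$ (k, j) \<odot>\<^bsub>V\<^esub> v k = (th_E \<Phi> ! k) (w j)"
      using eigenframe_proj[OF e(1) k w(1)] a k j by (simp add: normalized_frames_def)
    also have "\<dots> = coord v' (w j) k \<odot>\<^bsub>V\<^esub> v' k" by (rule eigenframe_proj[OF e'(1) k w(1)])
    also have "coord v' (w j) k = q j * X' $$ (k, j)"
      using q[OF j] w a' k j fr by (simp add: normalized_frames_def)
    finally have "coord v' (X $$ (k, j) \<odot>\<^bsub>V\<^esub> (p k \<odot>\<^bsub>V\<^esub> v' k)) k = coord v' ((q j * X' $$ (k, j)) \<odot>\<^bsub>V\<^esub> v' k) k"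
      using p[OF k] by simp
    then show ?thesis using fr k by (simp add: coord_basis smult_smult)
  qed
  have one: "X $$ (k, 0) = 1" "X' $$ (k, 0) = 1" "X $$ (d, k) = 1" "X' $$ (d, k) = 1" if "k \<le> d" for k
    using a a' that by (simp_all add: normalized_frames_def)
  have pq: "p k = q 0" "q k = p d" if "k \<le> d" for k using rel[OF that le0] rel[OF order_refl that] one that by simp_all
  have "X = X'"
  proof (rule eq_matI)
    show "dim_row X = dim_row X'" "dim_col X = dim_col X'" using a a' by (auto simp: normalized_frames_def)
    fix k j assume "k < dim_row X'" "j < dim_col X'"
    then have kj: "k \<le> d" "j \<le> d" using a' by (auto simp: normalized_frames_def)
    have "p k = q j" using pq(1)[OF kj(1)] pq(1)[OF order_refl] pq(2)[OF kj(2)] by simp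
    then show "X $$ (k, j) = X' $$ (k, j)" using rel[OF kj] p[OF kj(1)] by simp
  qed
  then show ?thesis using teq by simp
qed

lemma normalized_frames_vsystem_of:
  assumes "\<Phi> \<in> th_systems d" "normalized_frames \<Phi> S v w"
  shows "vsystem_of d \<Phi> = S"
proof -
  have "th_space \<Phi> = V" using assms(2) by (auto simp: normalized_frames_def th_frames_def)
  then obtain v' w' where "normalized_frames \<Phi> (vsystem_of d \<Phi>) v' w'" using th_system_transition[OF assms(1)] by metis
  then show ?thesis using normalized_frames_unique assms(2) by (metis surj_pair)
qed

end

section \<open>Graded polynomials and Vandermonde systems\<close>

lemma degree_newton: "Polynomial.degree (\<Prod>l<h. [:- s l, 1:] :: 'k::field poly) = h"
  by (subst degree_prod_eq_sum_degree) auto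

text \<open>
  Graded sequences arise from Newton bases with triangular coefficients; the transition matrix has
  this form both by columns and by rows.
\<close>

lemma newton_graded:
  fixes s :: "nat \<Rightarrow> 'k::field" and b :: "nat \<Rightarrow> nat \<Rightarrow> 'k"
  assumes b0: "b 0 0 = 1" and b: "\<And>m. m \<le> d \<Longrightarrow> b m m \<noteq> 0"
  defines "f \<equiv> \<lambda>m. \<Sum>h\<le>m. Polynomial.smult (b m h) (\<Prod>l<h. [:- s l, 1:])"
  shows "graded_polys d f" and "poly (f m) x = (\<Sum>h\<le>m. b m h * (\<Prod>l<h. x - s l))"
proof -
  let ?N = "\<lambda>h. \<Prod>l<h. [:- s l, 1:]"
  have "Polynomial.degree (f m) = m" if m: "m \<le> d" for m
  proof (rule antisym)
    show "Polynomial.degree (f m) \<le> m" unfolding f_def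
      by (rule degree_sum_le) (auto intro: order_trans[OF degree_smult_le] simp: degree_newton)
    have "Polynomial.coeff (f m) m = (\<Sum>h\<le>m. if h = m then b m m * Polynomial.coeff (?N m) m else 0)"
      unfolding f_def coeff_sum
    proof (rule sum.cong)
      fix h assume "h \<in> {..m}"
      then show "Polynomial.coeff (Polynomial.smult (b m h) (?N h)) m = (if h = m then b m m * Polynomial.coeff (?N m) m else 0)"
        by (cases "h = m") (auto intro!: coeff_eq_0 simp: degree_newton)
    qed simp
    also have "\<dots> = b m m * Polynomial.lead_coeff (?N m)" by (simp add: degree_newton)
    also have "\<dots> \<noteq> 0" using b[OF m] by (auto simp: prod_zero_iff)
    finally show "m \<le> Polynomial.degree (f m)" by (rule le_degree)
  qed
  moreover have "f 0 = 1" by (simp add: f_def b0)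
  ultimately show "graded_polys d f" by (simp add: graded_polys_def)
  show "poly (f m) x = (\<Sum>h\<le>m. b m h * (\<Prod>l<h. x - s l))"
    by (simp add: f_def poly_sum poly_prod)
qed

lemma graded_nonzero:
  assumes "graded_polys d f" "i \<le> d" shows "f i \<noteq> 0"
proof
  assume z: "f i = 0"
  then have "i = 0" using assms unfolding graded_polys_def by (metis degree_0)
  then show False using z assms by (simp add: graded_polys_def)
qed

text \<open>
  The coefficient of \<open>f n\<close> is a quotient of leading coefficients. Its nonvanishing for \<open>coeff p n \<noteq> 0\<close>
  is what yields the nonzero subdiagonal of the Hessenberg matrices below.
\<close>

lemma graded_expansion:
  assumes f: "graded_polys d f" and n: "n \<le> d" and p: "Polynomial.degree p \<le> n"
  shows "\<exists>e. p = (\<Sum>i\<le>n. Polynomial.smult (e i) (f i)) \<and> (Polynomial.coeff p n \<noteq> 0 \<longrightarrow> e n \<noteq> 0)"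
  using n p
proof (induct n arbitrary: p)
  case 0
  then have "p = [:Polynomial.coeff p 0:]" by (metis degree_eq_zeroE le_zero_eq coeff_pCons_0)
  then have "p = Polynomial.smult (Polynomial.coeff p 0) (f 0)" using f by (simp add: graded_polys_def)
  then show ?case by (intro exI[of _ "\<lambda>_. Polynomial.coeff p 0"]) simp
next
  case (Suc n)
  have dg: "Polynomial.degree (f (Suc n)) = Suc n" using f Suc.prems by (simp add: graded_polys_def)
  then have lc: "Polynomial.coeff (f (Suc n)) (Suc n) \<noteq> 0"     using graded_nonzero[OF f Suc.prems(1)] by (metis dg leading_coeff_0_iff)
  define c where "c = Polynomial.coeff p (Suc n) / Polynomial.coeff (f (Suc n)) (Suc n)"
  let ?q = "p - Polynomial.smult c (f (Suc n))"
  have "Polynomial.coeff ?q i = 0" if "i > n" for i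
  proof (cases "i = Suc n")
    case True
    then show ?thesis using lc by (simp add: c_def)
  next
    case False
    then have "i > Suc n" using that by simp
    then show ?thesis using Suc.prems(2) dg by (simp add: coeff_eq_0)
  qed
  then have "Polynomial.degree ?q \<le> n" by (intro degree_le) auto
  then obtain e where e: "?q = (\<Sum>i\<le>n. Polynomial.smult (e i) (f i))" using Suc.hyps[of ?q] Suc.prems by auto
  let ?e = "e(Suc n := c)"
  have "p = ?q + Polynomial.smult c (f (Suc n))" by simp
  also have "\<dots> = (\<Sum>i\<le>Suc n. Polynomial.smult (?e i) (f i))" unfolding e by simp
  finally have "p = (\<Sum>i\<le>Suc n. Polynomial.smult (?e i) (f i))" .
  moreover have "Polynomial.coeff p (Suc n) \<noteq> 0 \<longrightarrow> ?e (Suc n) \<noteq> 0" using lc by (simp add: c_def)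
  ultimately show ?case by blast
qed

lemma graded_independent:
  assumes f: "graded_polys d f" and n: "n \<le> d" and z: "(\<Sum>i\<le>n. Polynomial.smult (c i) (f i)) = 0"
  shows "i \<le> n \<Longrightarrow> c i = 0"
  using n z
proof (induct n arbitrary: i)
  case 0
  then show ?case using f by (simp add: graded_polys_def)
next
  case (Suc n)
  have dg: "Polynomial.degree (f i) = i" if "i \<le> Suc n" for i using f Suc.prems that by (simp add: graded_polys_def)
  then have lc: "Polynomial.coeff (f (Suc n)) (Suc n) \<noteq> 0"
    using graded_nonzero[OF f Suc.prems(2)] by (metis dg order_refl leading_coeff_0_iff)
  have "0 = Polynomial.coeff (\<Sum>i\<le>Suc n. Polynomial.smult (c i) (f i)) (Suc n)" using Suc.prems(3) by simp
  also have "\<dots> = (\<Sum>i\<le>Suc n. c i * Polynomial.coeff (f i) (Suc n))" by (simp add: coeff_sum)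
  also have "\<dots> = c (Suc n) * Polynomial.coeff (f (Suc n)) (Suc n)"
  proof -
    have "(\<Sum>i\<le>n. c i * Polynomial.coeff (f i) (Suc n)) = 0"
      using dg by (intro sum.neutral) (auto intro!: coeff_eq_0)
    then show ?thesis by simp
  qed
  finally have top: "c (Suc n) = 0" using lc by simp
  then have "(\<Sum>i\<le>n. Polynomial.smult (c i) (f i)) = 0" using Suc.prems(3) by simp
  then show ?case using Suc.hyps[of i] Suc.prems(1,2) top by (cases "i = Suc n") auto
qed

lemma poly_eq_0_of_roots:
  fixes p :: "'k::field poly"
  assumes t: "length t = d + 1" "distinct t" and p: "Polynomial.degree p \<le> d" and z: "\<And>k. k \<le> d \<Longrightarrow> poly p (t ! k) = 0"
  shows "p = 0"
proof (rule ccontr)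
  assume nz: "p \<noteq> 0"
  have "set t \<subseteq> {x. poly p x = 0}"
    using z t(1) by (auto simp: in_set_conv_nth less_Suc_eq_le)
  then have "card (set t) \<le> card {x. poly p x = 0}" by (intro card_mono poly_roots_finite nz)
  also have "\<dots> \<le> Polynomial.degree p" by (rule card_poly_roots_bound[OF nz])
  finally show False using p t distinct_card[of t] by simp
qed

context kspace begin

text \<open>
  In the defining sum of \<open>P\<^sub>i\<^sub>j\<close> the terms with \<open>h > j\<close> vanish, because \<open>\<theta>\<^sup>*\<^sub>j\<close> is among \<open>\<theta>\<^sup>*\<^sub>0, \<dots>, \<theta>\<^sup>*\<^sub>h\<^sub>-\<^sub>1\<close>,
  and so do the terms with \<open>h > d - i\<close>, because \<open>\<theta>\<^sub>i\<close> is among \<open>\<theta>\<^sub>d, \<dots>, \<theta>\<^sub>d\<^sub>-\<^sub>h\<^sub>+\<^sub>1\<close>. What remains is a Newton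
  expansion of degree \<open>j\<close> in \<open>\<theta>\<^sub>i\<close>, and one of degree \<open>d - i\<close> in \<open>\<theta>\<^sup>*\<^sub>j\<close>.
\<close>

lemma vsystem_of_ws_vandermonde:
  assumes th: "\<Phi> \<in> th_systems d" and V: "th_space \<Phi> = V"
  shows "vsystem_of d \<Phi> \<in> ws_vandermonde d"
proof -
  let ?t = "eigenvalue_seq \<Phi>" and ?ts = "dual_eigenvalue_seq \<Phi>" and ?P = "transition_mat d \<Phi>"
  obtain v w \<phi> where tr: "normalized_frames \<Phi> (vsystem_of d \<Phi>) v w"
    and phi: "\<And>i. 1 \<le> i \<Longrightarrow> i \<le> d \<Longrightarrow> \<phi> i \<noteq> 0"
    and P: "\<And>k j. k \<le> d \<Longrightarrow> j \<le> d \<Longrightarrow> ?P $$ (k, j) =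
      (\<Sum>h\<le>d. (\<Prod>l<h. ?t ! k - ?t ! (d - l)) * (\<Prod>l<h. ?ts ! j - ?ts ! l) / (\<Prod>l=1..h. \<phi> l))"
    by (rule th_system_transition[OF th V]) blast
  have len: "length ?t = d + 1" "distinct ?t" "length ?ts = d + 1" "distinct ?ts" 
    and car: "?P \<in> carrier_mat (d + 1) (d + 1)"
    using tr by (auto simp: normalized_frames_def vsystem_of_def th_frames_def eigenframe_def)
  have inj: "?t ! i = ?t ! j \<longleftrightarrow> i = j" "?ts ! i = ?ts ! j \<longleftrightarrow> i = j" if "i \<le> d" "j \<le> d" for i j
    using len that by (simp_all add: nth_eq_iff_index_eq)
  define c where "c h = (\<Prod>l=1..h. \<phi> l)" for h
  have c: "c h \<noteq> 0" if "h \<le> d" for h using phi that by (auto simp: c_def)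
  define b where "b j h = (\<Prod>l<h. ?ts ! j - ?ts ! l) / c h" for j h
  define bs where "bs m h = (\<Prod>l<h. ?t ! (d - m) - ?t ! (d - l)) / c h" for m h
  have cut: "(\<Sum>h\<le>d. g h) = (\<Sum>h\<le>m. g h)" if "m \<le> d" "\<And>h. m < h \<Longrightarrow> h \<le> d \<Longrightarrow> g h = 0" for g :: "nat \<Rightarrow> 'k" and m
    using that by (intro sum.mono_neutral_right) auto
  have bnz: "b m m \<noteq> 0" "bs m m \<noteq> 0" if m: "m \<le> d" for m
    using c[OF m] m inj by (auto simp: b_def bs_def)
  have b0: "b 0 0 = 1" "bs 0 0 = 1" by (simp_all add: b_def bs_def c_def)
  have bz: "b m h = 0" "bs m h = 0" if "m < h" for m h
  proof -
    have "(\<Prod>l<h. ?ts ! m - ?ts ! l) = 0" "(\<Prod>l<h. ?t ! (d - m) - ?t ! (d - l)) = 0"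
      using that by (auto intro!: prod_zero bexI[of _ m])
    then show "b m h = 0" "bs m h = 0" by (simp_all add: b_def bs_def)
  qed
  note F = newton_graded[where b = b and s = "\<lambda>l. ?t ! (d - l)", OF b0(1) bnz(1)]
  note Fs = newton_graded[where b = bs and s = "\<lambda>l. ?ts ! l", OF b0(2) bnz(2)]
  let ?f = "\<lambda>m. \<Sum>h\<le>m. Polynomial.smult (b m h) (\<Prod>l<h. [:- ?t ! (d - l), 1:])"
  let ?fs = "\<lambda>m. \<Sum>h\<le>m. Polynomial.smult (bs m h) (\<Prod>l<h. [:- ?ts ! l, 1:])"
  have 1: "?P $$ (i, j) = poly (?f j) (?t ! i)" if "i \<le> d" "j \<le> d" for i j
  proof -
    have "?P $$ (i, j) = (\<Sum>h\<le>d. b j h * (\<Prod>l<h. ?t ! i - ?t ! (d - l)))"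
      unfolding P[OF that] b_def c_def by (intro sum.cong) auto
    also have "\<dots> = (\<Sum>h\<le>j. b j h * (\<Prod>l<h. ?t ! i - ?t ! (d - l)))"
      using bz by (intro cut that) auto
    finally show ?thesis using F(2) by simp
  qed
  have 2: "?P $$ (i, j) = poly (?fs (d - i)) (?ts ! j)" if "i \<le> d" "j \<le> d" for i j
  proof -
    have "?P $$ (i, j) = (\<Sum>h\<le>d. bs (d - i) h * (\<Prod>l<h. ?ts ! j - ?ts ! l))"
      unfolding P[OF that] bs_def c_def using that by (intro sum.cong) auto
    also have "\<dots> = (\<Sum>h\<le>d - i. bs (d - i) h * (\<Prod>l<h. ?ts ! j - ?ts ! l))"
      using bz by (intro cut) auto
    finally show ?thesis using Fs(2) by simp
  qed
  have "\<exists>f. graded_polys d f \<and> (\<forall>i\<le>d. \<forall>j\<le>d. ?P $$ (i, j) = poly (f j) (?t ! i))"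
    using F(1) 1 by (intro exI[of _ ?f]) simp
  moreover have "\<exists>fs. graded_polys d fs \<and> (\<forall>i\<le>d. \<forall>j\<le>d. ?P $$ (i, j) = poly (fs (d - i)) (?ts ! j))"
    using Fs(1) 2 by (intro exI[of _ ?fs]) simp
  ultimately show ?thesis
    unfolding ws_vandermonde_def vsystem_of_def mem_Collect_eq prod.case
    using len car by simp
qed

lemma eigenframe_of_frame:
  assumes b: "frame b" and t: "length t = d + 1" "distinct t"
  shows "eigenframe (self.lmap b (\<lambda>i. t ! i \<odot>\<^bsub>V\<^esub> b i))
     (map (\<lambda>i. self.lmap b (\<lambda>j. if i = j then b j else \<zero>\<^bsub>V\<^esub>)) [0..<d + 1]) t b"
proof -
  have f1: "family (\<lambda>i. t ! i \<odot>\<^bsub>V\<^esub> b i)" using b by simp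
  have f2: "family (\<lambda>j. if i = j then b j else \<zero>\<^bsub>V\<^esub>)" for i using b by simp
  have nth: "map (\<lambda>i. self.lmap b (\<lambda>j. if i = j then b j else \<zero>\<^bsub>V\<^esub>)) [0..<d + 1] ! i
      = self.lmap b (\<lambda>j. if i = j then b j else \<zero>\<^bsub>V\<^esub>)" if "i \<le> d" for i
    using that by (subst nth_map) (auto simp del: upt_Suc)
  show ?thesis
    unfolding eigenframe_def
    using b t by (simp add: nth lmap_End[OF b f1] lmap_End[OF b f2] lmap_basis[OF b f1] lmap_basis[OF b f2] del: upt_Suc)
qed

text \<open>
  Take any basis \<open>v\<close>, let \<open>w\<close> be the family with coordinates the columns of \<open>X\<close>, and let \<open>A\<close> and
  \<open>A\<^sup>*\<close> be diagonal in \<open>v\<close> and \<open>w\<close>. The family \<open>w\<close> is a basis because a relation between its members is a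
  polynomial of degree at most \<open>d\<close> with \<open>d + 1\<close> roots. The operators are Hessenberg because multiplication
  by the variable raises the degree in a graded sequence by one: expanding \<open>\<lambda> f\<^sub>j\<close> in the \<open>f\<^sub>i\<close> gives
  the columns of the matrix of \<open>A\<close> in \<open>w\<close>, and expanding \<open>\<lambda> f\<^sup>*\<^sub>d\<^sub>-\<^sub>i\<close> in the \<open>f\<^sup>*\<^sub>h\<close> gives the rows of the
  matrix of \<open>A\<^sup>*\<close> in \<open>v\<close>.
\<close>

lemma th_system_of_vandermonde:
  assumes S: "S \<in> ws_vandermonde d"
  shows "\<exists>\<Phi> v w. \<Phi> \<in> th_systems d \<and> normalized_frames \<Phi> S v w"
proof -
  obtain X t ts where St: "S = (X, t, ts)" by (cases S) auto
  obtain f fs where X: "X \<in> carrier_mat (d + 1) (d + 1)"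
    and t: "length t = d + 1" "distinct t" and ts: "length ts = d + 1" "distinct ts"
    and f: "graded_polys d f" and fs: "graded_polys d fs"
    and Xf: "\<And>i j. i \<le> d \<Longrightarrow> j \<le> d \<Longrightarrow> X $$ (i, j) = poly (f j) (t ! i)"
    and Xfs: "\<And>i j. i \<le> d \<Longrightarrow> j \<le> d \<Longrightarrow> X $$ (i, j) = poly (fs (d - i)) (ts ! j)"
    using S unfolding ws_vandermonde_def St by blast
  obtain v where v: "frame v" using frame_exists by blast
  define w where "w j = lc v (\<lambda>k. X $$ (k, j))" for j
  have w_in: "family w" using v by (simp add: w_def)
  have cw: "coord v (w j) k = X $$ (k, j)" if "k \<le> d" for j k using that v by (simp add: w_def)
  have fdeg: "Polynomial.degree (f j) = j" "Polynomial.degree (fs j) = j" if "j \<le> d" for j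
    using f fs that by (simp_all add: graded_polys_def)
  have w: "frame w"
  proof (rule frame_of_independent[OF w_in])
    fix c assume z: "lc w c = \<zero>\<^bsub>V\<^esub>"
    let ?p = "\<Sum>j\<le>d. Polynomial.smult (c j) (f j)"
    have "?p = 0"
    proof (rule poly_eq_0_of_roots[OF t])
      show "Polynomial.degree ?p \<le> d"
        by (rule degree_sum_le) (auto intro: order_trans[OF degree_smult_le] simp: fdeg)
      fix k assume k: "k \<le> d"
      have "poly ?p (t ! k) = (\<Sum>j\<le>d. c j * coord v (w j) k)"
        using k by (simp add: poly_sum cw Xf)
      also have "\<dots> = coord v (lc w c) k" by (rule coord_lc_other[OF v w_in, symmetric])
      finally show "poly ?p (t ! k) = 0" using z v by simp
    qed
    then show "\<forall>i\<le>d. c i = 0" using graded_independent[OF f order_refl] by blast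
  qed
  let ?A = "self.lmap v (\<lambda>i. t ! i \<odot>\<^bsub>V\<^esub> v i)" and ?As = "self.lmap w (\<lambda>i. ts ! i \<odot>\<^bsub>V\<^esub> w i)"
  let ?E = "map (\<lambda>i. self.lmap v (\<lambda>j. if i = j then v j else \<zero>\<^bsub>V\<^esub>)) [0..<d + 1]"
  let ?Es = "map (\<lambda>i. self.lmap w (\<lambda>j. if i = j then w j else \<zero>\<^bsub>V\<^esub>)) [0..<d + 1]"
  note e = eigenframe_of_frame[OF v t] and es = eigenframe_of_frame[OF w ts]
  have A: "?A \<in> End" and As: "?As \<in> End" using e es by (auto simp: eigenframe_def)
  define \<Phi> where "\<Phi> = \<lparr>th_space = V, th_A = ?A, th_E = ?E, th_A_star = ?As, th_E_star = ?Es\<rparr>"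
  have fr: "th_frames \<Phi> t ts v w" using e es by (simp add: th_frames_def \<Phi>_def)
  have "hessenberg d (\<lambda>i j. coord w (?A (w j)) i)"
  proof -
    have "\<exists>e. (\<forall>i\<le>d. coord w (?A (w j)) i = (if i \<le> j + 1 then e i else 0)) \<and> e (j + 1) \<noteq> 0" if j: "j < d" for j
    proof -
      let ?p = "pCons 0 (f j)"
      have nz: "f j \<noteq> 0" using graded_nonzero[OF f] j by simp
      then have dp: "Polynomial.degree ?p = j + 1" using fdeg(1)[of j] j by simp
      then have "Polynomial.coeff ?p (j + 1) \<noteq> 0" using nz by (metis leading_coeff_0_iff pCons_eq_0_iff)
      then obtain e where ex: "?p = (\<Sum>i\<le>j + 1. Polynomial.smult (e i) (f i))" and enz: "e (j + 1) \<noteq> 0"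
        using graded_expansion[OF f _ eq_refl[OF dp]] j by fastforce
      let ?e = "\<lambda>i. if i \<le> j + 1 then e i else 0"
      have "?A (w j) = lc w ?e"
      proof (rule coord_eqI[OF v])
        show "?A (w j) \<in> carrier V" "lc w ?e \<in> carrier V" using A w w_in j by simp_all
        fix k assume k: "k \<le> d"
        have "coord v (?A (w j)) k = t ! k * X $$ (k, j)"
          using eigenframe_coord[OF e] w_in j k by (simp add: cw)
        also have "\<dots> = poly ?p (t ! k)" using Xf[OF k, of j] j by simp
        also have "\<dots> = (\<Sum>i\<le>j + 1. e i * X $$ (k, i))"
          unfolding ex using Xf[OF k] j by (simp add: poly_sum)
        also have "\<dots> = (\<Sum>i\<le>d. ?e i * coord v (w i) k)"
          using j by (intro sum.mono_neutral_cong_left) (auto simp: cw[OF k])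
        also have "\<dots> = coord v (lc w ?e) k" by (rule coord_lc_other[OF v w_in, symmetric])
        finally show "coord v (?A (w j)) k = coord v (lc w ?e) k" .
      qed
      then show ?thesis using enz by (intro exI[of _ e]) (simp add: coord_lc[OF w])
    qed
    note * = this
    show ?thesis unfolding hessenberg_def
    proof (intro allI impI conjI)
      fix i j assume ij: "i \<le> d" "j \<le> d" "i > j + 1"
      then obtain e where "\<forall>i\<le>d. coord w (?A (w j)) i = (if i \<le> j + 1 then e i else 0)"
        using *[of j] by auto
      then show "coord w (?A (w j)) i = 0" using ij by simp
    next
      fix i j assume ij: "i \<le> d" "j \<le> d" "i = j + 1"
      then obtain e where "\<forall>i\<le>d. coord w (?A (w j)) i = (if i \<le> j + 1 then e i else 0)"
        and "e (j + 1) \<noteq> 0" using *[of j] by auto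
      then show "coord w (?A (w j)) i \<noteq> 0" using ij by simp
    qed
  qed
  moreover have "hessenberg d (\<lambda>i j. coord v (?As (v j)) i)"
  proof -
    \<comment> \<open>Row \<open>i\<close> of the matrix of \<open>A\<^sup>*\<close> in \<open>v\<close>: the functional \<open>x \<mapsto> (A\<^sup>* x)\<^sub>i\<close> agrees on every \<open>w\<^sub>j\<close> with the
        combination of coordinate functionals given by the expansion of \<open>\<lambda> f\<^sup>*\<^sub>d\<^sub>-\<^sub>i\<close>, hence on every \<open>v\<^sub>m\<close>.\<close>
    have "\<exists>e. (\<forall>m\<le>d. coord v (?As (v m)) i = (if d - m \<le> d - i + 1 then e (d - m) else 0)) \<and> e (d - i + 1) \<noteq> 0"
      if i: "i \<le> d" "1 \<le> i" for i
    proof -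
      let ?n = "d - i + 1"
      let ?p = "pCons 0 (fs (d - i))"
      have nz: "fs (d - i) \<noteq> 0" by (rule graded_nonzero[OF fs]) simp
      have nd: "?n \<le> d" using i by simp
      have dp: "Polynomial.degree ?p = ?n" using fdeg(2)[of "d - i"] nz by simp
      then have "Polynomial.coeff ?p ?n \<noteq> 0" using nz by (metis leading_coeff_0_iff pCons_eq_0_iff)
      then obtain e where ex: "?p = (\<Sum>h\<le>?n. Polynomial.smult (e h) (fs h))" and enz: "e ?n \<noteq> 0"
        using graded_expansion[OF fs nd eq_refl[OF dp]] by blast
      have As_w: "coord v (?As (w j)) i = (\<Sum>h\<le>?n. e h * X $$ (d - h, j))" if j: "j \<le> d" for j
      proof -
        have "coord v (?As (w j)) i = ts ! j * X $$ (i, j)"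
          using es j w i by (simp add: eigenframe_def v cw)
        also have "\<dots> = poly ?p (ts ! j)" using Xfs[OF i(1) j] by simp
        also have "\<dots> = (\<Sum>h\<le>?n. e h * X $$ (d - h, j))"
          unfolding ex poly_sum using Xfs[OF _ j] i by (intro sum.cong) auto
        finally show ?thesis .
      qed
      have "coord v (?As (v m)) i = (if d - m \<le> ?n then e (d - m) else 0)" if m: "m \<le> d" for m
      proof -
        let ?c = "coord w (v m)"
        have vm: "v m \<in> carrier V" using v m by simp
        have "coord v (?As (v m)) i = coord v (?As (lc w ?c)) i" using lc_coord[OF w vm] by simp
        also have "\<dots> = (\<Sum>j\<le>d. ?c j * coord v (?As (w j)) i)"
          using As w_in by (simp add: End_lc[OF As w_in] coord_lc_other[OF v])
        also have "\<dots> = (\<Sum>j\<le>d. \<Sum>h\<le>?n. e h * (?c j * X $$ (d - h, j)))"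
          by (intro sum.cong refl) (simp only: atMost_iff As_w sum_distrib_left mult.left_commute)
        also have "\<dots> = (\<Sum>h\<le>?n. e h * (\<Sum>j\<le>d. ?c j * coord v (w j) (d - h)))"
          by (subst sum.swap) (simp add: cw sum_distrib_left)
        also have "\<dots> = (\<Sum>h\<le>?n. e h * coord v (v m) (d - h))"
          unfolding coord_lc_other[OF v w_in, symmetric] lc_coord[OF w vm] ..
        also have "\<dots> = (\<Sum>h\<le>?n. if h = d - m then e (d - m) else 0)"
          using m i by (intro sum.cong) (auto simp: coord_basis[OF v])
        also have "\<dots> = (if d - m \<le> ?n then e (d - m) else 0)" by simp
        finally show ?thesis .
      qed
      then show ?thesis using enz by blast
    qed
    note * = this
    show ?thesis unfolding hessenberg_def
    proof (intro allI impI conjI)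
      fix i j assume ij: "i \<le> d" "j \<le> d" "i > j + 1"
      then obtain e where "\<forall>m\<le>d. coord v (?As (v m)) i = (if d - m \<le> d - i + 1 then e (d - m) else 0)"
        using *[of i] by auto
      moreover have "\<not> d - j \<le> d - i + 1" using ij by simp
      ultimately show "coord v (?As (v j)) i = 0" using ij by simp
    next
      fix i j assume ij: "i \<le> d" "j \<le> d" "i = j + 1"
      then obtain e where "\<forall>m\<le>d. coord v (?As (v m)) i = (if d - m \<le> d - i + 1 then e (d - m) else 0)"
        and "e (d - i + 1) \<noteq> 0"
        using *[of i] by auto
      moreover have "d - j = d - i + 1" using ij by simp
      ultimately show "coord v (?As (v j)) i \<noteq> 0" using ij by simp
    qed
  qed
  ultimately have "\<Phi> \<in> th_systems d"
    unfolding th_systems_iff_hessenberg[OF fr] by (simp add: \<Phi>_def)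
  moreover have "normalized_frames \<Phi> S v w"
  proof -
    have "X $$ (k, 0) = 1" "X $$ (d, k) = 1" if "k \<le> d" for k
      using Xf[OF that, of 0] Xfs[OF _ that, of d] f fs by (simp_all add: graded_polys_def)
    then show ?thesis using fr X cw by (simp add: normalized_frames_def St)
  qed
  ultimately show ?thesis by blast
qed

end

section \<open>Isomorphisms\<close>

lemma alg_isoD:
  assumes "\<gamma> \<in> alg_iso V W"
  shows "X \<in> carrier (End_alg V) \<Longrightarrow> \<gamma> X \<in> carrier (End_alg W)"
    and "X \<in> carrier (End_alg V) \<Longrightarrow> Y \<in> carrier (End_alg V) \<Longrightarrow>
      \<gamma> (X \<otimes>\<^bsub>End_alg V\<^esub> Y) = \<gamma> X \<otimes>\<^bsub>End_alg W\<^esub> \<gamma> Y"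
    and "X \<in> carrier (End_alg V) \<Longrightarrow> Y \<in> carrier (End_alg V) \<Longrightarrow>
      \<gamma> (X \<oplus>\<^bsub>End_alg V\<^esub> Y) = \<gamma> X \<oplus>\<^bsub>End_alg W\<^esub> \<gamma> Y"
    and "X \<in> carrier (End_alg V) \<Longrightarrow> \<gamma> (c \<odot>\<^bsub>End_alg V\<^esub> X) = c \<odot>\<^bsub>End_alg W\<^esub> \<gamma> X"
    and "inj_on \<gamma> (carrier (End_alg V))"
  using assms unfolding alg_iso_def ring_iso_def
  by (auto simp: ring_hom_mult ring_hom_add ring_hom_closed bij_betw_def)

locale endo_kspace_pair = kspace_pair V W d
  for V W :: "('k::field, 'v) module" and d
begin

sublocale opp: kspace_pair W V d by unfold_locales

text \<open>
  The Skolem--Noether theorem for full endomorphism algebras. Identify a vector \<open>x\<close> with the map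
  \<open>Z x\<close> that sends the first basis vector to \<open>x\<close> and the others to 0. These maps form a left ideal,
  on which endomorphisms act by composition as they act on vectors; evaluating the images under
  \<open>\<gamma>\<close> at a vector fixed by the nonzero idempotent \<open>\<gamma> (Z b\<^sub>0)\<close> gives the linear map \<open>\<sigma>\<close>. Its kernel is
  trivial, since every nonzero \<open>x\<close> is moved to \<open>b\<^sub>0\<close> by some endomorphism.
\<close>

theorem alg_iso_inner:
  assumes g: "\<gamma> \<in> alg_iso V W"
  shows "\<exists>\<sigma>\<in>lin V W. (\<forall>x\<in>carrier V. \<sigma> x = \<zero>\<^bsub>W\<^esub> \<longrightarrow> x = \<zero>\<^bsub>V\<^esub>) \<and>
     (\<forall>X\<in>V.End. \<forall>x\<in>carrier V. \<gamma> X (\<sigma> x) = \<sigma> (X x))"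
proof -
  note g_in = alg_isoD(1)[OF g] and g_mult = alg_isoD(2)[OF g] and g_add = alg_isoD(3)[OF g]
    and g_smult = alg_isoD(4)[OF g] and g_inj = alg_isoD(5)[OF g]
  obtain b where b: "V.frame b" using V.frame_exists by blast
  have b0: "b 0 \<in> carrier V" using b by simp
  define Z where "Z x = V.self.lmap b (\<lambda>i. if i = 0 then x else \<zero>\<^bsub>V\<^esub>)" for x
  have fam: "\<forall>i\<le>d. (if i = 0 then x else \<zero>\<^bsub>V\<^esub>) \<in> carrier V" if "x \<in> carrier V" for x
    using that by simp
  have Z: "Z x \<in> V.End" if "x \<in> carrier V" for x
    unfolding Z_def by (rule V.lmap_End[OF b fam[OF that]])
  have Zb: "Z x (b i) = (if i = 0 then x else \<zero>\<^bsub>V\<^esub>)" if "x \<in> carrier V" "i \<le> d" for x i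
    unfolding Z_def by (rule V.lmap_basis[OF b fam[OF that(1)] that(2)])
  have Z_add: "Z (x \<oplus>\<^bsub>V\<^esub> y) = Z x \<oplus>\<^bsub>End_alg V\<^esub> Z y" if "x \<in> carrier V" "y \<in> carrier V" for x y
    using that Z by (intro V.End_eqI[OF b]) (simp_all add: Zb b)
  have Z_smult: "Z (a \<odot>\<^bsub>V\<^esub> x) = a \<odot>\<^bsub>End_alg V\<^esub> Z x" if "x \<in> carrier V" for a x
    using that Z by (intro V.End_eqI[OF b]) (simp_all add: Zb b)
  have Z_mult: "X \<otimes>\<^bsub>End_alg V\<^esub> Z x = Z (X x)" if "X \<in> V.End" "x \<in> carrier V" for X x
    using that Z by (intro V.End_eqI[OF b]) (simp_all add: Zb b)
  let ?P = "Z (b 0)"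
  have P: "?P \<in> V.End" by (rule Z[OF b0])
  have "\<gamma> \<zero>\<^bsub>End_alg V\<^esub> = \<zero>\<^bsub>End_alg W\<^esub>"
  proof -
    have "\<gamma> (0 \<odot>\<^bsub>End_alg V\<^esub> \<zero>\<^bsub>End_alg V\<^esub>) = 0 \<odot>\<^bsub>End_alg W\<^esub> \<gamma> \<zero>\<^bsub>End_alg V\<^esub>"
      by (rule g_smult) simp
    moreover have "0 \<odot>\<^bsub>End_alg V\<^esub> \<zero>\<^bsub>End_alg V\<^esub> = \<zero>\<^bsub>End_alg V\<^esub>" by (intro V.End_ext) simp_all
    moreover have "0 \<odot>\<^bsub>End_alg W\<^esub> \<gamma> \<zero>\<^bsub>End_alg V\<^esub> = \<zero>\<^bsub>End_alg W\<^esub>"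
      using g_in[OF V.zero_End] by (intro W.End_ext) simp_all
    ultimately show ?thesis by simp
  qed
  moreover have "?P \<noteq> \<zero>\<^bsub>End_alg V\<^esub>"
    using Zb[OF b0 le0] V.frame_nonzero[OF b le0] b0 by auto
  ultimately have "\<gamma> ?P \<noteq> \<zero>\<^bsub>End_alg W\<^esub>"
    using inj_onD[OF g_inj _ P V.zero_End] by metis
  then have "\<exists>y\<in>carrier W. \<gamma> ?P y \<noteq> \<zero>\<^bsub>W\<^esub>"
    using W.End_ext[OF g_in[OF P] W.zero_End] by force
  then obtain y where y: "y \<in> carrier W" and nz: "\<gamma> ?P y \<noteq> \<zero>\<^bsub>W\<^esub>" by blast
  define w where "w = \<gamma> ?P y"
  have w: "w \<in> carrier W" using y g_in[OF P] by (simp add: w_def)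
  have "\<gamma> ?P w = (\<gamma> ?P \<otimes>\<^bsub>End_alg W\<^esub> \<gamma> ?P) y" using y by (simp add: w_def)
  also have "\<dots> = \<gamma> (?P \<otimes>\<^bsub>End_alg V\<^esub> ?P) y" by (simp add: g_mult P)
  also have "\<dots> = w" using Z_mult[OF P b0] Zb[OF b0 le0] by (simp add: w_def)
  finally have Pw: "\<gamma> ?P w = w" .
  define \<sigma> where "\<sigma> x = \<gamma> (Z x) w" for x
  have lin: "\<sigma> \<in> lin V W"
    unfolding lin_iff \<sigma>_def using w g_in Z by (simp add: Z_add Z_smult g_add g_smult)
  have inter: "\<gamma> X (\<sigma> x) = \<sigma> (X x)" if "X \<in> V.End" "x \<in> carrier V" for X x
  proof -
    have "\<gamma> X (\<sigma> x) = (\<gamma> X \<otimes>\<^bsub>End_alg W\<^esub> \<gamma> (Z x)) w" using w by (simp add: \<sigma>_def)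
    also have "\<dots> = \<gamma> (X \<otimes>\<^bsub>End_alg V\<^esub> Z x) w" using that Z by (simp add: g_mult)
    finally show ?thesis using Z_mult[OF that] by (simp add: \<sigma>_def)
  qed
  have "x = \<zero>\<^bsub>V\<^esub>" if x: "x \<in> carrier V" and z: "\<sigma> x = \<zero>\<^bsub>W\<^esub>" for x
  proof (rule ccontr)
    assume "x \<noteq> \<zero>\<^bsub>V\<^esub>"
    then obtain i where i: "i \<le> d" "V.coord b x i \<noteq> 0" using V.coord_nonzero_ex[OF b x] by blast
    let ?y = "\<lambda>j. if j = i then inverse (V.coord b x i) \<odot>\<^bsub>V\<^esub> b 0 else \<zero>\<^bsub>V\<^esub>"
    let ?Y = "V.self.lmap b ?y"
    have fy: "\<forall>j\<le>d. ?y j \<in> carrier V" using b0 by simp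
    have Y: "?Y \<in> V.End" by (rule V.lmap_End[OF b fy])
    have "?Y x = V.lc (\<lambda>j. ?Y (b j)) (V.coord b x)"
      using V.End_lc[OF Y V.frame_family[OF b], of "V.coord b x"] by (simp only: V.lc_coord[OF b x])
    also have "\<dots> = V.lc (\<lambda>j. if j = i then b 0 else \<zero>\<^bsub>V\<^esub>) (\<lambda>j. if j = i then 1 else 0)"
      unfolding V.lc_def
      using i b0 V.lmap_basis[OF b fy] by (intro V.finsum_cong') (auto simp: V.smult_smult)
    also have "\<dots> = b 0"
      using V.lc_single[of "\<lambda>j. if j = i then b 0 else \<zero>\<^bsub>V\<^esub>" i 1] b0 i by simp
    finally have "\<sigma> (b 0) = \<gamma> ?Y (\<sigma> x)" using inter[OF Y x] by simp
    also have "\<dots> = \<zero>\<^bsub>W\<^esub>" using z g_in[OF Y] by simp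
    finally show False using Pw nz by (simp add: \<sigma>_def w_def)
  qed
  then show ?thesis using lin inter by blast
qed

lemma frame_image:
  assumes s: "\<sigma> \<in> lin V W" and inj: "\<forall>x\<in>carrier V. \<sigma> x = \<zero>\<^bsub>W\<^esub> \<longrightarrow> x = \<zero>\<^bsub>V\<^esub>" and b: "V.frame b"
  shows "W.frame (\<lambda>i. \<sigma> (b i))" and "x \<in> carrier V \<Longrightarrow> W.coord (\<lambda>i. \<sigma> (b i)) (\<sigma> x) k = V.coord b x k"
proof -
  have fam: "\<forall>i\<le>d. \<sigma> (b i) \<in> carrier W" using b s by (simp add: lin_in)
  have im: "\<sigma> (V.lc b c) = W.lc (\<lambda>i. \<sigma> (b i)) c" for c using b by (intro lin_lc[OF s]) simp
  show fr: "W.frame (\<lambda>i. \<sigma> (b i))"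
  proof (rule W.frame_of_independent[OF fam])
    fix c assume "W.lc (\<lambda>i. \<sigma> (b i)) c = \<zero>\<^bsub>W\<^esub>"
    then have "V.lc b c = \<zero>\<^bsub>V\<^esub>" using im inj b by simp
    then show "\<forall>i\<le>d. c i = 0" using b unfolding V.frame_def by blast
  qed
  show "W.coord (\<lambda>i. \<sigma> (b i)) (\<sigma> x) k = V.coord b x k" if x: "x \<in> carrier V"
  proof -
    have "\<sigma> x = W.lc (\<lambda>i. \<sigma> (b i)) (V.coord b x)" using im[of "V.coord b x"] by (simp add: V.lc_coord[OF b x])
    then show ?thesis by (cases "k \<le> d") (simp_all add: W.coord_lc[OF fr])
  qed
qed

text \<open>
  A map \<open>\<sigma>\<close> that intertwines \<open>\<gamma>\<close> carries eigenframes to eigenframes and leaves all coordinates unchanged.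
\<close>

lemma normalized_frames_image:
  assumes g: "\<gamma> \<in> alg_iso V W"
    and s: "\<sigma> \<in> lin V W" and inj: "\<forall>x\<in>carrier V. \<sigma> x = \<zero>\<^bsub>W\<^esub> \<longrightarrow> x = \<zero>\<^bsub>V\<^esub>"
    and inter: "\<forall>X\<in>V.End. \<forall>x\<in>carrier V. \<gamma> X (\<sigma> x) = \<sigma> (X x)"
    and tr: "V.normalized_frames \<Phi> S v w"
    and Psi: "th_space \<Psi> = W" "th_A \<Psi> = \<gamma> (th_A \<Phi>)" "th_A_star \<Psi> = \<gamma> (th_A_star \<Phi>)"
      "th_E \<Psi> = map \<gamma> (th_E \<Phi>)" "th_E_star \<Psi> = map \<gamma> (th_E_star \<Phi>)"
  shows "W.normalized_frames \<Psi> S (\<lambda>i. \<sigma> (v i)) (\<lambda>i. \<sigma> (w i))"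
proof -
  have e: "W.eigenframe (\<gamma> X) (map \<gamma> Es) t (\<lambda>i. \<sigma> (b i))" if ef: "V.eigenframe X Es t b" for X Es t b
  proof -
    have b: "V.frame b" and X: "X \<in> V.End" and Es: "\<And>i. i \<le> d \<Longrightarrow> Es ! i \<in> V.End"
      using ef by (auto simp: V.eigenframe_def)
    have "\<gamma> X (\<sigma> (b i)) = t ! i \<odot>\<^bsub>W\<^esub> \<sigma> (b i)" if "i \<le> d" for i
      using inter X b that ef by (simp add: V.eigenframe_def lin_smult[OF s])
    moreover have "\<gamma> (Es ! i) (\<sigma> (b j)) = (if i = j then \<sigma> (b j) else \<zero>\<^bsub>W\<^esub>)" if "i \<le> d" "j \<le> d" for i j
      using inter Es[OF that(1)] b that ef by (simp add: V.eigenframe_def lin_zero[OF s])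
    ultimately show ?thesis
      using ef frame_image(1)[OF s inj b] alg_isoD(1)[OF g] Es X
      unfolding V.eigenframe_def W.eigenframe_def by simp
  qed
  obtain X t ts where S: "S = (X, t, ts)" by (cases S) auto
  have th: "V.eigenframe (th_A \<Phi>) (th_E \<Phi>) t v" "V.eigenframe (th_A_star \<Phi>) (th_E_star \<Phi>) ts w"
    using tr by (auto simp: S V.normalized_frames_def V.th_frames_def)
  have fr: "V.frame v" "V.frame w" using th by (auto simp: V.eigenframe_def)
  have "W.th_frames \<Psi> t ts (\<lambda>i. \<sigma> (v i)) (\<lambda>i. \<sigma> (w i))"
    unfolding W.th_frames_def using e[OF th(1)] e[OF th(2)] Psi by simp
  moreover have "W.coord (\<lambda>i. \<sigma> (v i)) (\<sigma> (w j)) k = X $$ (k, j)" if "k \<le> d" "j \<le> d" for k j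
    using frame_image(2)[OF s inj fr(1)] fr(2) tr that by (simp add: S V.normalized_frames_def)
  ultimately show ?thesis using tr by (simp add: S V.normalized_frames_def W.normalized_frames_def)
qed

text \<open>
  The linear map that sends one eigenframe of \<open>A\<close> to the other also matches the eigenframes of \<open>A\<^sup>*\<close>,
  because both have the coordinates \<open>X\<close>. Conjugation by it is the isomorphism.
\<close>

lemma alg_iso_of_normalized_frames:
  assumes tr: "V.normalized_frames \<Phi> S v w" and tr': "W.normalized_frames \<Psi> S v' w'"
  shows "\<exists>\<gamma>\<in>alg_iso V W. th_A \<Psi> = \<gamma> (th_A \<Phi>) \<and> th_A_star \<Psi> = \<gamma> (th_A_star \<Phi>) \<and>
        th_E \<Psi> = map \<gamma> (th_E \<Phi>) \<and> th_E_star \<Psi> = map \<gamma> (th_E_star \<Phi>)"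
proof -
  obtain X t ts where S: "S = (X, t, ts)" by (cases S) auto
  have th: "V.eigenframe (th_A \<Phi>) (th_E \<Phi>) t v" "V.eigenframe (th_A_star \<Phi>) (th_E_star \<Phi>) ts w"
    using tr by (auto simp: S V.normalized_frames_def V.th_frames_def)
  have th': "W.eigenframe (th_A \<Psi>) (th_E \<Psi>) t v'" "W.eigenframe (th_A_star \<Psi>) (th_E_star \<Psi>) ts w'"
    using tr' by (auto simp: S W.normalized_frames_def W.th_frames_def)
  have fr: "V.frame v" "V.frame w" and fr': "W.frame v'" "W.frame w'"
    using th th' by (auto simp: V.eigenframe_def W.eigenframe_def)
  define \<sigma> where "\<sigma> = lmap v v'"
  define \<tau> where "\<tau> = opp.lmap v' v"
  have s: "\<sigma> \<in> lin V W" unfolding \<sigma>_def by (rule lmap_lin[OF fr(1) W.frame_family[OF fr'(1)]])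
  have t: "\<tau> \<in> lin W V" unfolding \<tau>_def by (rule opp.lmap_lin[OF fr'(1) V.frame_family[OF fr(1)]])
  have sv: "\<sigma> (v i) = v' i" if "i \<le> d" for i
    unfolding \<sigma>_def by (rule lmap_basis[OF fr(1) W.frame_family[OF fr'(1)] that])
  have tv: "\<tau> (v' i) = v i" if "i \<le> d" for i
    unfolding \<tau>_def by (rule opp.lmap_basis[OF fr'(1) V.frame_family[OF fr(1)] that])
  note s_in [simp] = lin_in[OF s] and t_in [simp] = lin_in[OF t]
  have ts_id [simp]: "\<tau> (\<sigma> x) = x" if x: "x \<in> carrier V" for x
    using V.self.lin_eqI[OF fr(1), of "\<lambda>x. \<tau> (\<sigma> x)" "\<lambda>x. x" x] x fr(1) sv tv
    by (simp add: lin_iff lin_add[OF s] lin_add[OF t] lin_smult[OF s] lin_smult[OF t])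
  have st_id [simp]: "\<sigma> (\<tau> y) = y" if y: "y \<in> carrier W" for y
    using W.self.lin_eqI[OF fr'(1), of "\<lambda>x. \<sigma> (\<tau> x)" "\<lambda>x. x" y] y fr'(1) sv tv
    by (simp add: lin_iff lin_add[OF s] lin_add[OF t] lin_smult[OF s] lin_smult[OF t])
  have sw: "\<sigma> (w j) = w' j" if j: "j \<le> d" for j
  proof -
    have "\<sigma> (w j) = \<sigma> (V.lc v (V.coord v (w j)))" using V.lc_coord[OF fr(1)] fr(2) j by simp
    also have "\<dots> = W.lc (\<lambda>i. \<sigma> (v i)) (V.coord v (w j))" using fr by (intro lin_lc[OF s]) simp
    also have "\<dots> = W.lc v' (W.coord v' (w' j))"
      using fr' sv tr tr' j by (intro W.lc_cong) (simp_all add: S V.normalized_frames_def W.normalized_frames_def)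
    also have "\<dots> = w' j" using W.lc_coord[OF fr'(1)] fr'(2) j by simp
    finally show ?thesis .
  qed
  define \<gamma> where "\<gamma> X = (\<lambda>y\<in>carrier W. \<sigma> (X (\<tau> y)))" for X
  define \<delta> where "\<delta> Y = (\<lambda>x\<in>carrier V. \<tau> (Y (\<sigma> x)))" for Y
  have g_app [simp]: "\<gamma> X y = \<sigma> (X (\<tau> y))" if "y \<in> carrier W" for X y using that by (simp add: \<gamma>_def)
  have d_app [simp]: "\<delta> Y x = \<tau> (Y (\<sigma> x))" if "x \<in> carrier V" for Y x using that by (simp add: \<delta>_def)
  have g_in [simp]: "\<gamma> X \<in> W.End" if "X \<in> V.End" for X
    using that unfolding W.End_iff
    by (simp add: lin_iff lin_add[OF s] lin_add[OF t] lin_smult[OF s] lin_smult[OF t] V.End_add V.End_smult)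
       (simp add: \<gamma>_def)
  have d_in [simp]: "\<delta> Y \<in> V.End" if "Y \<in> W.End" for Y
    using that unfolding V.End_iff
    by (simp add: lin_iff lin_add[OF s] lin_add[OF t] lin_smult[OF s] lin_smult[OF t] W.End_add W.End_smult)
       (simp add: \<delta>_def)
  have "\<gamma> \<in> Ring.ring_hom (End_alg V) (End_alg W)"
  proof (rule ring_hom_memI)
    fix X Y assume XY: "X \<in> V.End" "Y \<in> V.End"
    show "\<gamma> (X \<otimes>\<^bsub>End_alg V\<^esub> Y) = \<gamma> X \<otimes>\<^bsub>End_alg W\<^esub> \<gamma> Y"
      using XY by (intro W.End_ext) simp_all
    show "\<gamma> (X \<oplus>\<^bsub>End_alg V\<^esub> Y) = \<gamma> X \<oplus>\<^bsub>End_alg W\<^esub> \<gamma> Y"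
      using XY by (intro W.End_ext) (simp_all add: lin_add[OF s])
  next
    show "\<gamma> \<one>\<^bsub>End_alg V\<^esub> = \<one>\<^bsub>End_alg W\<^esub>" by (intro W.End_ext) simp_all
  qed simp
  moreover have "bij_betw \<gamma> V.End W.End"
  proof (rule bij_betw_byWitness[where f' = \<delta>])
    show "\<forall>X\<in>V.End. \<delta> (\<gamma> X) = X" by (intro ballI V.End_ext) simp_all
    show "\<forall>Y\<in>W.End. \<gamma> (\<delta> Y) = Y" by (intro ballI W.End_ext) simp_all
  qed auto
  moreover have "\<gamma> (c \<odot>\<^bsub>End_alg V\<^esub> X) = c \<odot>\<^bsub>End_alg W\<^esub> \<gamma> X" if "X \<in> V.End" for c X
    using that by (intro W.End_ext) (simp_all add: lin_smult[OF s])
  ultimately have iso: "\<gamma> \<in> alg_iso V W" by (simp add: alg_iso_def ring_iso_def)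
  \<comment> \<open>An endomorphism and its idempotents are determined by an eigenframe and the eigenvalues.\<close>
  have conj: "X' = \<gamma> X \<and> Es' = map \<gamma> Es"
    if ef: "V.eigenframe X Es r b" and ef': "W.eigenframe X' Es' r b'" and sb: "\<And>i. i \<le> d \<Longrightarrow> \<sigma> (b i) = b' i"
    for X X' Es Es' r b b'
  proof -
    have b: "V.frame b" and b': "W.frame b'" and XX: "X \<in> V.End" "X' \<in> W.End"
      and E: "\<And>i. i \<le> d \<Longrightarrow> Es ! i \<in> V.End" "\<And>i. i \<le> d \<Longrightarrow> Es' ! i \<in> W.End"
      and len: "length Es = d + 1" "length Es' = d + 1"
      using ef ef' by (auto simp: V.eigenframe_def W.eigenframe_def)
    have tb: "\<tau> (b' i) = b i" if "i \<le> d" for i using sb[OF that] ts_id[of "b i"] b that by simp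
    have "X' = \<gamma> X"
      using XX b b' tb sb ef ef'
      by (intro W.End_eqI[OF b']) (simp_all add: V.eigenframe_def W.eigenframe_def lin_smult[OF s])
    moreover have "Es' ! i = \<gamma> (Es ! i)" if "i \<le> d" for i
      using E[OF that] b b' tb sb ef ef' that
      by (intro W.End_eqI[OF b']) (simp_all add: V.eigenframe_def W.eigenframe_def lin_zero[OF s])
    ultimately show ?thesis using len by (auto intro!: nth_equalityI)
  qed
  show ?thesis using iso conj[OF th(1) th'(1) sv] conj[OF th(2) th'(2) sw] by blast
qed

end

lemma kspace_th_systems: "\<Phi> \<in> th_systems d \<Longrightarrow> kspace (th_space \<Phi>) d"
  by (simp add: kspace_def th_systems_def Let_def)

text \<open>
  Isomorphism is the kernel of the map to Vandermonde systems: the normalized frames determine a TH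
  system up to isomorphism, and algebra isomorphisms preserve them.
\<close>

theorem th_iso_iff:
  "(\<Phi>, \<Psi>) \<in> th_iso d \<longleftrightarrow> \<Phi> \<in> th_systems d \<and> \<Psi> \<in> th_systems d \<and> vsystem_of d \<Phi> = vsystem_of d \<Psi>"
proof (cases "\<Phi> \<in> th_systems d \<and> \<Psi> \<in> th_systems d")
  case True
  then have P: "\<Phi> \<in> th_systems d" "\<Psi> \<in> th_systems d" by auto
  interpret V: kspace "th_space \<Phi>" d by (rule kspace_th_systems[OF P(1)])
  interpret W: kspace "th_space \<Psi>" d by (rule kspace_th_systems[OF P(2)])
  interpret endo_kspace_pair "th_space \<Phi>" "th_space \<Psi>" d by unfold_locales
  obtain v w where tr: "V.normalized_frames \<Phi> (vsystem_of d \<Phi>) v w"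
    by (rule V.th_system_transition[OF P(1) refl]) blast
  obtain v' w' where tr': "W.normalized_frames \<Psi> (vsystem_of d \<Psi>) v' w'"
    by (rule W.th_system_transition[OF P(2) refl]) blast
  show ?thesis
  proof
    assume "(\<Phi>, \<Psi>) \<in> th_iso d"
    then obtain \<gamma> where g: "\<gamma> \<in> alg_iso (th_space \<Phi>) (th_space \<Psi>)"
      and eq: "th_A \<Psi> = \<gamma> (th_A \<Phi>)" "th_A_star \<Psi> = \<gamma> (th_A_star \<Phi>)"
        "th_E \<Psi> = map \<gamma> (th_E \<Phi>)" "th_E_star \<Psi> = map \<gamma> (th_E_star \<Phi>)"
      unfolding th_iso_def by blast
    obtain \<sigma> where "\<sigma> \<in> lin (th_space \<Phi>) (th_space \<Psi>)"
      "\<forall>x\<in>carrier (th_space \<Phi>). \<sigma> x = \<zero>\<^bsub>th_space \<Psi>\<^esub> \<longrightarrow> x = \<zero>\<^bsub>th_space \<Phi>\<^esub>"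
      "\<forall>X\<in>V.End. \<forall>x\<in>carrier (th_space \<Phi>). \<gamma> X (\<sigma> x) = \<sigma> (X x)"
      using alg_iso_inner[OF g] by blast
    from normalized_frames_image[OF g this tr refl eq] 
    show "\<Phi> \<in> th_systems d \<and> \<Psi> \<in> th_systems d \<and> vsystem_of d \<Phi> = vsystem_of d \<Psi>"
      using W.normalized_frames_vsystem_of[OF P(2)] P by simp
  next
    assume "\<Phi> \<in> th_systems d \<and> \<Psi> \<in> th_systems d \<and> vsystem_of d \<Phi> = vsystem_of d \<Psi>"
    then have "W.normalized_frames \<Psi> (vsystem_of d \<Phi>) v' w'" using tr' by simp
    from alg_iso_of_normalized_frames[OF tr this] show "(\<Phi>, \<Psi>) \<in> th_iso d" using P by (simp add: th_iso_def)
  qed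
qed (auto simp: th_iso_def)

section \<open>Affine transformations and quotients\<close>

context kspace begin

lemma affine_op_app: "x \<in> carrier V \<Longrightarrow> affine_op V \<alpha> \<beta> X x = \<alpha> \<odot>\<^bsub>V\<^esub> X x \<oplus>\<^bsub>V\<^esub> \<beta> \<odot>\<^bsub>V\<^esub> x"
  by (simp add: affine_op_def)

lemma affine_op_End: "X \<in> End \<Longrightarrow> affine_op V \<alpha> \<beta> X \<in> End"
  by (simp add: affine_op_def)

lemma eigenframe_affine:
  assumes e: "eigenframe X Es t b" and a: "\<alpha> \<noteq> 0"
  shows "eigenframe (affine_op V \<alpha> \<beta> X) Es (map (\<lambda>x. \<alpha> * x + \<beta>) t) b"
proof -
  have b: "frame b" using e by (simp add: eigenframe_def)
  have "distinct (map (\<lambda>x. \<alpha> * x + \<beta>) t)"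
    using e a by (auto simp: eigenframe_def distinct_map intro!: inj_onI)
  moreover have "affine_op V \<alpha> \<beta> X (b i) = (\<alpha> * t ! i + \<beta>) \<odot>\<^bsub>V\<^esub> b i" if "i \<le> d" for i
    using e that b by (simp add: eigenframe_def affine_op_app smult_smult smult_add_left)
  ultimately show ?thesis
    using e unfolding eigenframe_def by (auto simp: affine_op_End)
qed

text \<open>
  Adding a multiple of the identity only affects the diagonal, and scaling keeps the subdiagonal
  nonzero.
\<close>

lemma hessenberg_affine:
  assumes X: "X \<in> End" and b: "frame b" and a: "\<alpha> \<noteq> 0"
    and H: "hessenberg d (\<lambda>i j. coord b (X (b j)) i)"
  shows "hessenberg d (\<lambda>i j. coord b (affine_op V \<alpha> \<beta> X (b j)) i)"
proof -
  have "coord b (affine_op V \<alpha> \<beta> X (b j)) i = \<alpha> * coord b (X (b j)) i" if "j \<le> d" "i > j" for i j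
    using X b that by (simp add: affine_op_app coord_basis)
  then show ?thesis using H a unfolding hessenberg_def by simp
qed

end

fun affine_vsystem :: "'k::field \<Rightarrow> 'k \<Rightarrow> 'k \<Rightarrow> 'k \<Rightarrow> 'k vsystem \<Rightarrow> 'k vsystem" where
  "affine_vsystem \<alpha> \<beta> \<alpha>s \<beta>s (X, t, ts) = (X, map (\<lambda>x. \<alpha> * x + \<beta>) t, map (\<lambda>x. \<alpha>s * x + \<beta>s) ts)"

lemma vsystem_affine_of_iff:
  "vsystem_affine_of T S \<longleftrightarrow> (\<exists>\<alpha> \<beta> \<alpha>s \<beta>s. \<alpha> \<noteq> 0 \<and> \<alpha>s \<noteq> 0 \<and> T = affine_vsystem \<alpha> \<beta> \<alpha>s \<beta>s S)"
  by (cases S) (simp add: vsystem_affine_of_def)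

text \<open>
  An affine transformation keeps both eigenframes, so the transition matrix is unchanged and only the
  eigenvalues are transformed.
\<close>

lemma th_affine_vsystem_of:
  assumes P: "\<Phi> \<in> th_systems d" and a: "\<alpha> \<noteq> 0" "\<alpha>s \<noteq> 0"
  shows "th_affine \<alpha> \<beta> \<alpha>s \<beta>s \<Phi> \<in> th_systems d"
    and "vsystem_of d (th_affine \<alpha> \<beta> \<alpha>s \<beta>s \<Phi>) = affine_vsystem \<alpha> \<beta> \<alpha>s \<beta>s (vsystem_of d \<Phi>)"
proof -
  interpret kspace "th_space \<Phi>" d by (rule kspace_th_systems[OF P])
  let ?\<Psi> = "th_affine \<alpha> \<beta> \<alpha>s \<beta>s \<Phi>"
  obtain v w where tr: "normalized_frames \<Phi> (vsystem_of d \<Phi>) v w"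
    by (rule th_system_transition[OF P refl]) blast
  obtain X t ts where S: "vsystem_of d \<Phi> = (X, t, ts)" by (cases "vsystem_of d \<Phi>") auto
  have f: "th_frames \<Phi> t ts v w" using tr by (simp add: S normalized_frames_def)
  then have e: "eigenframe (th_A \<Phi>) (th_E \<Phi>) t v" "eigenframe (th_A_star \<Phi>) (th_E_star \<Phi>) ts w"
    by (simp_all add: th_frames_def)
  have En: "th_A \<Phi> \<in> End" "th_A_star \<Phi> \<in> End" "frame v" "frame w" using e by (auto simp: eigenframe_def)
  have f': "th_frames ?\<Psi> (map (\<lambda>x. \<alpha> * x + \<beta>) t) (map (\<lambda>x. \<alpha>s * x + \<beta>s) ts) v w"
    using eigenframe_affine[OF e(1) a(1)] eigenframe_affine[OF e(2) a(2)]
    by (simp add: th_frames_def th_affine_def)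
  show TH: "?\<Psi> \<in> th_systems d"
    unfolding th_systems_iff_hessenberg[OF f']
    using P[unfolded th_systems_iff_hessenberg[OF f]]
      hessenberg_affine[OF En(1,4) a(1)] hessenberg_affine[OF En(2,3) a(2)]
    by (simp add: th_affine_def)
  have "normalized_frames ?\<Psi> (affine_vsystem \<alpha> \<beta> \<alpha>s \<beta>s (vsystem_of d \<Phi>)) v w"
    using tr f' by (simp add: S normalized_frames_def)
  then show "vsystem_of d ?\<Psi> = affine_vsystem \<alpha> \<beta> \<alpha>s \<beta>s (vsystem_of d \<Phi>)"
    by (rule normalized_frames_vsystem_of[OF TH])
qed

lemma affine_vsystem_comp:
  "affine_vsystem a b as bs (affine_vsystem \<alpha> \<beta> \<alpha>s \<beta>s S)
    = affine_vsystem (a * \<alpha>) (a * \<beta> + b) (as * \<alpha>s) (as * \<beta>s + bs) S"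
  by (cases S) (simp add: algebra_simps)

lemma affine_vsystem_id: "affine_vsystem 1 0 1 0 S = S"
  by (cases S) simp

lemma vsystem_affine_ofI: "a \<noteq> 0 \<Longrightarrow> as \<noteq> 0 \<Longrightarrow> vsystem_affine_of (affine_vsystem a b as bs S) S"
  unfolding vsystem_affine_of_iff by blast

lemma vsystem_affine_of_refl: "vsystem_affine_of S S"
  using vsystem_affine_ofI[of 1 1 0 0 S] by (simp add: affine_vsystem_id)

lemma vsystem_affine_of_sym:
  assumes "vsystem_affine_of T S" shows "vsystem_affine_of S T"
proof -
  obtain \<alpha> \<beta> \<alpha>s \<beta>s where a: "\<alpha> \<noteq> 0" "\<alpha>s \<noteq> 0" and T: "T = affine_vsystem \<alpha> \<beta> \<alpha>s \<beta>s S"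
    using assms by (auto simp: vsystem_affine_of_iff)
  have "S = affine_vsystem (inverse \<alpha>) (- inverse \<alpha> * \<beta>) (inverse \<alpha>s) (- inverse \<alpha>s * \<beta>s) T"
    using a by (simp add: T affine_vsystem_comp affine_vsystem_id)
  then show ?thesis
    using vsystem_affine_ofI[of "inverse \<alpha>" "inverse \<alpha>s" _ _ T] a by (metis inverse_nonzero_iff_nonzero)
qed

lemma vsystem_affine_of_trans:
  assumes "vsystem_affine_of T S" "vsystem_affine_of U T" shows "vsystem_affine_of U S"
  using assms unfolding vsystem_affine_of_iff by (metis affine_vsystem_comp mult_eq_0_iff)

lemma vsystem_affine_rel_iff:
  "(S, T) \<in> vsystem_affine_rel d \<longleftrightarrow> S \<in> ws_vandermonde d \<and> T \<in> ws_vandermonde d \<and> vsystem_affine_of S T"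
  unfolding vsystem_affine_rel_def using vsystem_affine_of_sym by blast

lemma equiv_vsystem_affine_rel: "equiv (ws_vandermonde d) (vsystem_affine_rel d)"
proof (rule equivI)
  show "vsystem_affine_rel d \<subseteq> ws_vandermonde d \<times> ws_vandermonde d" by (auto simp: vsystem_affine_rel_iff)
  show "refl_on (ws_vandermonde d) (vsystem_affine_rel d)"
    by (auto simp: refl_on_def vsystem_affine_rel_iff vsystem_affine_of_refl)
  show "sym (vsystem_affine_rel d)"
    by (auto intro!: symI simp: vsystem_affine_rel_iff vsystem_affine_of_sym)
  show "Relation.trans (vsystem_affine_rel d)"
    by (rule transI) (use vsystem_affine_of_trans in \<open>auto simp: vsystem_affine_rel_iff\<close>)
qed

lemma vsystem_of_ws: "\<Phi> \<in> th_systems d \<Longrightarrow> vsystem_of d \<Phi> \<in> ws_vandermonde d"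
  using kspace.vsystem_of_ws_vandermonde[OF kspace_th_systems] by blast

lemma th_affine_iso_iff:
  "(\<Phi>, \<Psi>) \<in> th_affine_iso d \<longleftrightarrow> \<Phi> \<in> th_systems d \<and> \<Psi> \<in> th_systems d \<and>
     (vsystem_of d \<Phi>, vsystem_of d \<Psi>) \<in> vsystem_affine_rel d"
proof (cases "\<Phi> \<in> th_systems d \<and> \<Psi> \<in> th_systems d")
  case True
  then have P: "\<Phi> \<in> th_systems d" "\<Psi> \<in> th_systems d" by auto
  have "(\<Phi>, th_affine \<alpha> \<beta> \<alpha>s \<beta>s \<Psi>) \<in> th_iso d \<longleftrightarrow>
      vsystem_of d \<Phi> = affine_vsystem \<alpha> \<beta> \<alpha>s \<beta>s (vsystem_of d \<Psi>)"
    if "\<alpha> \<noteq> 0" "\<alpha>s \<noteq> 0" for \<alpha> \<beta> \<alpha>s \<beta>s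
    using th_affine_vsystem_of[OF P(2) that] P(1) by (simp add: th_iso_iff)
  then have "(\<Phi>, \<Psi>) \<in> th_affine_iso d \<longleftrightarrow> vsystem_affine_of (vsystem_of d \<Phi>) (vsystem_of d \<Psi>)"
    unfolding th_affine_iso_def vsystem_affine_of_iff using P by blast
  then show ?thesis using P vsystem_of_ws[OF P(1)] vsystem_of_ws[OF P(2)] unfolding vsystem_affine_rel_iff by blast
qed (auto simp: th_affine_iso_def)

text \<open>
  A surjection along which one equivalence relation is the pull-back of another induces a bijection of
  the quotients; the bijection sends a class to its image.
\<close>

lemma quotient_bij_of_surj:
  assumes into: "F ` X = Y" and Q: "equiv Y Q"
    and R: "\<And>x y. (x, y) \<in> R \<longleftrightarrow> x \<in> X \<and> y \<in> X \<and> (F x, F y) \<in> Q"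
  shows "\<exists>g. (\<forall>x\<in>X. g (R `` {x}) = Q `` {F x}) \<and> bij_betw g (X // R) (Y // Q)"
proof (intro exI conjI ballI)
  have sub: "Q \<subseteq> Y \<times> Y" using Q by (simp add: equiv_def refl_on_def)
  show im: "F ` (R `` {x}) = Q `` {F x}" if x: "x \<in> X" for x
  proof (intro equalityI subsetI)
    fix z assume z: "z \<in> Q `` {F x}"
    then obtain y where "y \<in> X" "z = F y" using sub into by blast
    then show "z \<in> F ` (R `` {x})" using z x R by auto
  qed (use R in auto)
  show "bij_betw ((`) F) (X // R) (Y // Q)"
    unfolding bij_betw_def
  proof (intro conjI inj_onI)
    fix C D assume "C \<in> X // R" "D \<in> X // R" and eq: "F ` C = F ` D"
    then obtain x y where xy: "x \<in> X" "C = R `` {x}" "y \<in> X" "D = R `` {y}" by (auto elim!: quotientE)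
    have "Q `` {F x} = Q `` {F y}" using eq by (simp only: xy(2,4) im[OF xy(1)] im[OF xy(3)])
    then have "(F x, z) \<in> Q \<longleftrightarrow> (F y, z) \<in> Q" for z by blast
    then show "C = D" using xy(1,3) R by (auto simp: xy(2,4))
  next
    have "(`) F ` (X // R) = (\<lambda>x. F ` (R `` {x})) ` X" by (auto simp: quotient_def)
    also have "\<dots> = (\<lambda>x. Q `` {F x}) ` X" by (rule image_cong[OF refl im])
    also have "\<dots> = Y // Q" unfolding into[symmetric] by (auto simp: quotient_def)
    finally show "(`) F ` (X // R) = Y // Q" .
  qed
qed

theorem corollary19p12:
  fixes d :: nat
  assumes "\<exists>V :: ('k::field, 'v) module. space_of_dim (d + 1) V"
  shows "(\<forall>\<Phi> \<in> (th_systems d :: ('k, 'v) th_system set).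
            rho d (th_iso d `` {\<Phi>}) = (transition_mat d \<Phi>, eigenvalue_seq \<Phi>, dual_eigenvalue_seq \<Phi>))
       \<and> bij_betw (rho d) ((th_systems d :: ('k, 'v) th_system set) // th_iso d) (ws_vandermonde d)
       \<and> (\<exists>\<rho>'.
            (\<forall>\<Phi> \<in> (th_systems d :: ('k, 'v) th_system set).
               \<rho>' (th_affine_iso d `` {\<Phi>}) = vsystem_affine_rel d `` {rho d (th_iso d `` {\<Phi>})})
          \<and> bij_betw \<rho>' ((th_systems d :: ('k, 'v) th_system set) // th_affine_iso d)
                        (ws_vandermonde d // vsystem_affine_rel d))"
proof -
  let ?T = "th_systems d :: ('k, 'v) th_system set"
  \<comment> \<open>The triple is constant on an isomorphism class, and the class is not empty.\<close>
  have rho: "rho d (th_iso d `` {\<Phi>}) = vsystem_of d \<Phi>" if "\<Phi> \<in> ?T" for \<Phi>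
    unfolding rho_def
  proof (rule the_equality)
    show "\<forall>\<Psi>\<in>th_iso d `` {\<Phi>}. vsystem_of d \<Psi> = vsystem_of d \<Phi>"
      unfolding Image_singleton th_iso_iff by simp
    fix S assume "\<forall>\<Psi>\<in>th_iso d `` {\<Phi>}. vsystem_of d \<Psi> = S"
    moreover have "\<Phi> \<in> th_iso d `` {\<Phi>}" unfolding Image_singleton th_iso_iff using that by simp
    ultimately have "vsystem_of d \<Phi> = S" by (rule bspec)
    then show "S = vsystem_of d \<Phi>" by (rule sym)
  qed
  obtain V :: "('k, 'v) module" where V: "kspace V d" using assms by (auto simp: kspace_def)
  have im: "vsystem_of d ` ?T = ws_vandermonde d"
  proof (intro equalityI subsetI)
    fix S :: "'k vsystem" assume "S \<in> ws_vandermonde d"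
    then obtain \<Phi> :: "('k, 'v) th_system" and v w where "\<Phi> \<in> ?T" "kspace.normalized_frames V d \<Phi> S v w"
      using kspace.th_system_of_vandermonde[OF V] by blast
    then have "\<Phi> \<in> ?T \<and> vsystem_of d \<Phi> = S" using kspace.normalized_frames_vsystem_of[OF V] by blast
    then show "S \<in> vsystem_of d ` ?T" by blast
  next
    fix S :: "'k vsystem" assume "S \<in> vsystem_of d ` ?T"
    then show "S \<in> ws_vandermonde d" using vsystem_of_ws by blast
  qed
  have "bij_betw (rho d) (?T // th_iso d) (ws_vandermonde d)"
    unfolding bij_betw_def
  proof (intro conjI inj_onI)
    fix C D assume "C \<in> ?T // th_iso d" "D \<in> ?T // th_iso d" and eq: "rho d C = rho d D"
    then obtain \<Phi> \<Psi> where *: "\<Phi> \<in> ?T" "C = th_iso d `` {\<Phi>}" "\<Psi> \<in> ?T" "D = th_iso d `` {\<Psi>}"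
      unfolding quotient_def by blast
    have "vsystem_of d \<Phi> = vsystem_of d \<Psi>" using eq by (simp only: *(2,4) rho[OF *(1)] rho[OF *(3)])
    then show "C = D" unfolding *(2,4) Image_singleton th_iso_iff using *(1,3) by simp
  next
    have "rho d ` (?T // th_iso d) = (\<lambda>\<Phi>. rho d (th_iso d `` {\<Phi>})) ` ?T"
      by (auto simp: quotient_def)
    also have "\<dots> = vsystem_of d ` ?T" by (rule image_cong[OF refl rho])
    finally show "rho d ` (?T // th_iso d) = ws_vandermonde d" using im by simp
  qed
  moreover have "\<exists>g. (\<forall>\<Phi>\<in>?T. g (th_affine_iso d `` {\<Phi>}) = vsystem_affine_rel d `` {vsystem_of d \<Phi>}) \<and>
      bij_betw g (?T // th_affine_iso d) (ws_vandermonde d // vsystem_affine_rel d)"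
    by (rule quotient_bij_of_surj[OF im equiv_vsystem_affine_rel th_affine_iso_iff])
  ultimately show ?thesis
    by (intro conjI ballI) (simp_all only: rho vsystem_of_def ball_simps cong: ball_cong)
qed

end
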